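(* Let $E$ be a row-finite directed graph. (i) If $C^*(E)$ has a faithful semifinite trace then no loop in $E$ can have an exit. (ii) If $C^*(E)$ has a gauge invariant, semifinite, lower semicontinuous trace $\tau$ then $\tau\circ\Phi=\tau$ and $$\tau(S_\mu S_\nu^* )=\delta_{\mu,\nu}\,\tau(p_{r(\mu)})$$ for all $\mu,\nu\in E^*$ with $r(\mu)=r(\nu)$. In particular, $\tau$ is supported on $C^*(\{S_\mu S_\mu^*:\mu\in E^*\})$.
   Context: A directed graph $E=(E^0,E^1,r,s)$ has countable sets $E^0$ (vertices), $E^1$ (edges) and range and source maps $r,s:E^1\to E^0$. It is row-finite if each vertex emits at most finitely many edges. A path of length $|\mu|=n\ge1$ is $\mu=\mu_1\cdots\mu_n$ with edges satisfying $r(\mu_i)=s(\mu_{i+1})$; vertices are paths of length $0$; $E^*$ is the set of all finite paths and $r,s$ extend to $E^*$. A loop is a path $L\in E^*$ with $s(L)=r(L)$; it has an exit if for some $i$ the vertex $s(L_i)$ emits more than one edge. $C^*(E)$ is the universal $C^*$-algebra generated by mutually orthogonal projections $p_v$ ($v\in E^0$) and partial isometries $S_e$ ($e\in E^1$) with $S_e^*S_e=p_{r(e)}$ and $p_v=\sum_{s(e)=v}S_eS_e^*$ whenever $v$ emits at least one edge. Put $S_\mu=S_{\mu_1}\cdots S_{\mu_n}$ and $S_v=p_v$; then $\mathrm{span}\{S_\mu S_\nu^*:r(\mu)=r(\nu)\}$ is dense in $C^*(E)$. $C^*(\{S_\mu S_\mu^*:\mu\in E^*\})$ denotes the $C^*$-subalgebra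 generated by the elements $S_\mu S_\mu^*$. The gauge action of $S^1$ is $\gamma_z(S_e)=zS_e$, $\gamma_z(p_v)=p_v$, and $\Phi(a)=\frac1{2\pi}\int_{S^1}\gamma_z(a)\,d\theta$ ($z=e^{i\theta}$) is the expectation onto the fixed point algebra. A trace on a $C^*$-algebra $A$ is a map $\tau:A^+\to[0,\infty]$ with $\tau(a+b)=\tau(a)+\tau(b)$, $\tau(\lambda a)=\lambda\tau(a)$ for $a,b\in A^+$, $\lambda\ge0$ (with $0\cdot\infty=0$), and $\tau(a^*a)=\tau(aa^* )$ for $a\in A$. It is faithful if $\tau(a^*a)=0\Rightarrow a=0$; semifinite if $\{a\in A^+:\tau(a)<\infty\}$ is norm dense in $A^+$; lower semicontinuous if $a_n\to a$ in norm in $A^+$ implies $\tau(a)\le\liminf_n\tau(a_n)$; gauge invariant if $\tau\circ\gamma_z=\tau$ for all $z\in S^1$. A semifinite trace is extended by linearity to a linear functional on a dense two-sided ideal of $A$ (its domain), which for $A=C^*(E)$ contains every $S_\mu S_\nu^*$. *)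

theory Defs
  imports
    "HOL-Analysis.Analysis"
    "HOL-Algebra.Ring"
    "Graph_Theory.Arc_Walk"
begin

section \<open>C*-algebras\<close>

text \<open>C*-algebras, not assumed unital, as a type class.  The class \<open>banach\<close> supplies norm,
  completeness and the integration theory of HOL-Analysis; the real scalar multiplication is tied
  to the complex one by \<open>scaleR_scaleC\<close>.\<close>

class cstar_algebra = banach + real_normed_algebra +
  fixes scaleC :: "complex \<Rightarrow> 'a \<Rightarrow> 'a"  (infixr \<open>*\<^sub>C\<close> 75)
    and star :: "'a \<Rightarrow> 'a"  (\<open>_\<dagger>\<close> [1000] 999)
  assumes scaleR_scaleC: "r *\<^sub>R x = complex_of_real r *\<^sub>C x"
    and scaleC_add_right: "c *\<^sub>C (x + y) = c *\<^sub>C x + c *\<^sub>C y"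
    and scaleC_add_left: "(c + d) *\<^sub>C x = c *\<^sub>C x + d *\<^sub>C x"
    and scaleC_scaleC: "c *\<^sub>C d *\<^sub>C x = (c * d) *\<^sub>C x"
    and scaleC_one: "1 *\<^sub>C x = x"
    and mult_scaleC_left: "(c *\<^sub>C x) * y = c *\<^sub>C (x * y)"
    and mult_scaleC_right: "x * (c *\<^sub>C y) = c *\<^sub>C (x * y)"
    and norm_scaleC: "norm (c *\<^sub>C x) = cmod c * norm x"
    and star_star: "(x\<dagger>)\<dagger> = x"
    and star_add: "(x + y)\<dagger> = x\<dagger> + y\<dagger>"
    and star_scaleC: "(c *\<^sub>C x)\<dagger> = cnj c *\<^sub>C x\<dagger>"
    and star_mult: "(x * y)\<dagger> = y\<dagger> * x\<dagger>"
    and cstar_identity: "norm (x\<dagger> * x) = (norm x)\<^sup>2"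

text \<open>The universal property of a graph algebra quantifies over all C*-algebras, hence over
  structures and not over types of a class.  For this purpose we also need C*-algebras with an
  explicit carrier.  The field \<open>one\<close> that the record inherits from \<open>ring\<close> plays no role.\<close>

record 'b cstar_struct = "'b ring" +
  smul :: "complex \<Rightarrow> 'b \<Rightarrow> 'b"
  adj :: "'b \<Rightarrow> 'b"
  nrm :: "'b \<Rightarrow> real"

locale cstar_algebra_on = abelian_group B for B :: "'b cstar_struct" (structure) +
  assumes mult_closed: "\<lbrakk>x \<in> carrier B; y \<in> carrier B\<rbrakk> \<Longrightarrow> x \<otimes> y \<in> carrier B"
    and mult_assoc: "\<lbrakk>x \<in> carrier B; y \<in> carrier B; z \<in> carrier B\<rbrakk>
      \<Longrightarrow> (x \<otimes> y) \<otimes> z = x \<otimes> (y \<otimes> z)"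
    and distrib_right: "\<lbrakk>x \<in> carrier B; y \<in> carrier B; z \<in> carrier B\<rbrakk>
      \<Longrightarrow> (x \<oplus> y) \<otimes> z = x \<otimes> z \<oplus> y \<otimes> z"
    and distrib_left: "\<lbrakk>x \<in> carrier B; y \<in> carrier B; z \<in> carrier B\<rbrakk>
      \<Longrightarrow> x \<otimes> (y \<oplus> z) = x \<otimes> y \<oplus> x \<otimes> z"
    and smul_closed: "x \<in> carrier B \<Longrightarrow> smul B c x \<in> carrier B"
    and smul_add_right: "\<lbrakk>x \<in> carrier B; y \<in> carrier B\<rbrakk>
      \<Longrightarrow> smul B c (x \<oplus> y) = smul B c x \<oplus> smul B c y"
    and smul_add_left: "x \<in> carrier B \<Longrightarrow> smul B (c + d) x = smul B c x \<oplus> smul B d x"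
    and smul_smul: "x \<in> carrier B \<Longrightarrow> smul B c (smul B d x) = smul B (c * d) x"
    and smul_one: "x \<in> carrier B \<Longrightarrow> smul B 1 x = x"
    and mult_smul_left: "\<lbrakk>x \<in> carrier B; y \<in> carrier B\<rbrakk>
      \<Longrightarrow> smul B c x \<otimes> y = smul B c (x \<otimes> y)"
    and mult_smul_right: "\<lbrakk>x \<in> carrier B; y \<in> carrier B\<rbrakk>
      \<Longrightarrow> x \<otimes> smul B c y = smul B c (x \<otimes> y)"
    and adj_closed: "x \<in> carrier B \<Longrightarrow> adj B x \<in> carrier B"
    and adj_adj: "x \<in> carrier B \<Longrightarrow> adj B (adj B x) = x"
    and adj_add: "\<lbrakk>x \<in> carrier B; y \<in> carrier B\<rbrakk> \<Longrightarrow> adj B (x \<oplus> y) = adj B x \<oplus> adj B y"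
    and adj_smul: "x \<in> carrier B \<Longrightarrow> adj B (smul B c x) = smul B (cnj c) (adj B x)"
    and adj_mult: "\<lbrakk>x \<in> carrier B; y \<in> carrier B\<rbrakk> \<Longrightarrow> adj B (x \<otimes> y) = adj B y \<otimes> adj B x"
    and nrm_nonneg: "x \<in> carrier B \<Longrightarrow> nrm B x \<ge> 0"
    and nrm_eq_zero: "x \<in> carrier B \<Longrightarrow> nrm B x = 0 \<longleftrightarrow> x = \<zero>"
    and nrm_smul: "x \<in> carrier B \<Longrightarrow> nrm B (smul B c x) = cmod c * nrm B x"
    and nrm_triangle: "\<lbrakk>x \<in> carrier B; y \<in> carrier B\<rbrakk> \<Longrightarrow> nrm B (x \<oplus> y) \<le> nrm B x + nrm B y"
    and nrm_mult: "\<lbrakk>x \<in> carrier B; y \<in> carrier B\<rbrakk> \<Longrightarrow> nrm B (x \<otimes> y) \<le> nrm B x * nrm B y"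
    and nrm_cstar: "x \<in> carrier B \<Longrightarrow> nrm B (adj B x \<otimes> x) = (nrm B x)\<^sup>2"
    and nrm_complete: "\<lbrakk>\<And>n. f n \<in> carrier B;
        \<And>\<epsilon>. \<epsilon> > 0 \<Longrightarrow> \<exists>N. \<forall>m\<ge>N. \<forall>n\<ge>N. nrm B (f m \<ominus> f n) < \<epsilon>\<rbrakk>
      \<Longrightarrow> \<exists>x\<in>carrier B. (\<lambda>n. nrm B (f n \<ominus> x)) \<longlonglongrightarrow> 0"

definition star_hom :: "'b cstar_struct \<Rightarrow> 'c cstar_struct \<Rightarrow> ('b \<Rightarrow> 'c) \<Rightarrow> bool" where
  "star_hom A B \<phi> \<longleftrightarrow>
     (\<forall>x\<in>carrier A. \<phi> x \<in> carrier B) \<and>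
     (\<forall>x\<in>carrier A. \<forall>y\<in>carrier A. \<phi> (x \<oplus>\<^bsub>A\<^esub> y) = \<phi> x \<oplus>\<^bsub>B\<^esub> \<phi> y) \<and>
     (\<forall>x\<in>carrier A. \<forall>y\<in>carrier A. \<phi> (x \<otimes>\<^bsub>A\<^esub> y) = \<phi> x \<otimes>\<^bsub>B\<^esub> \<phi> y) \<and>
     (\<forall>c. \<forall>x\<in>carrier A. \<phi> (smul A c x) = smul B c (\<phi> x)) \<and>
     (\<forall>x\<in>carrier A. \<phi> (adj A x) = adj B (\<phi> x))"

definition univ_cstar :: "'a::cstar_algebra cstar_struct" where
  "univ_cstar = \<lparr>carrier = UNIV, mult = (*), one = undefined, zero = 0, add = (+),
     smul = scaleC, adj = star, nrm = norm\<rparr>"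

lemma univ_cstar_simps [simp]:
  "carrier univ_cstar = UNIV" "mult univ_cstar = (*)" "zero univ_cstar = 0"
  "add univ_cstar = (+)" "smul univ_cstar = scaleC" "adj univ_cstar = star"
  "nrm univ_cstar = norm"
  by (simp_all add: univ_cstar_def)

lemma abelian_group_univ_cstar: "abelian_group (univ_cstar :: 'a::cstar_algebra cstar_struct)"
  by (rule abelian_groupI) (auto simp: add_ac intro: exI[of _ "- x" for x])

lemma a_minus_univ_cstar [simp]:
  "x \<ominus>\<^bsub>univ_cstar\<^esub> y = x - (y :: 'a::cstar_algebra)"
proof -
  interpret abelian_group "univ_cstar :: 'a cstar_struct" by (rule abelian_group_univ_cstar)
  have "\<ominus>\<^bsub>univ_cstar\<^esub> y = - y"
    using minus_equality[of "- y" y] by simp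
  then show ?thesis by (simp add: a_minus_def)
qed

lemma finsum_univ_cstar [simp]:
  "finsum (univ_cstar :: 'a::cstar_algebra cstar_struct) f I = sum f I"
proof -
  interpret abelian_group "univ_cstar :: 'a cstar_struct" by (rule abelian_group_univ_cstar)
  show ?thesis by (induction I rule: infinite_finite_induct) auto
qed

lemma cstar_algebra_on_univ: "cstar_algebra_on (univ_cstar :: 'a::cstar_algebra cstar_struct)"
proof (intro cstar_algebra_on.intro abelian_group_univ_cstar cstar_algebra_on_axioms.intro)
  fix f :: "nat \<Rightarrow> 'a"
  assume "\<And>\<epsilon>. \<epsilon> > 0 \<Longrightarrow>
    \<exists>N. \<forall>m\<ge>N. \<forall>n\<ge>N. nrm univ_cstar (f m \<ominus>\<^bsub>univ_cstar\<^esub> f n) < \<epsilon>"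
  then have "Cauchy f" by (simp add: Cauchy_def dist_norm)
  then obtain x where "f \<longlonglongrightarrow> x" using Cauchy_convergent convergent_def by blast
  then show "\<exists>x\<in>carrier univ_cstar.
      (\<lambda>n. nrm univ_cstar (f n \<ominus>\<^bsub>univ_cstar\<^esub> x)) \<longlonglongrightarrow> 0"
    by (auto simp: tendsto_norm_zero_iff LIM_zero_iff)
qed (simp_all add: mult.assoc distrib_left distrib_right scaleC_add_right scaleC_add_left
    scaleC_scaleC scaleC_one mult_scaleC_left mult_scaleC_right star_star star_add star_scaleC
    star_mult norm_scaleC norm_triangle_ineq norm_mult_ineq cstar_identity)

text \<open>The complex linear span of a set \<open>X\<close> is \<open>module.span scaleC X\<close>.\<close>

lemma vector_space_scaleC: "vector_space (scaleC :: complex \<Rightarrow> 'a \<Rightarrow> 'a::cstar_algebra)"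
  by unfold_locales (simp_all add: scaleC_add_right scaleC_add_left scaleC_scaleC scaleC_one)

definition cstar_subalgebra :: "'a::cstar_algebra set \<Rightarrow> bool" where
  "cstar_subalgebra C \<longleftrightarrow> module.subspace scaleC C \<and> closed C \<and>
     (\<forall>x\<in>C. \<forall>y\<in>C. x * y \<in> C) \<and> (\<forall>x\<in>C. x\<dagger> \<in> C)"

definition cstar_generated :: "'a::cstar_algebra set \<Rightarrow> 'a set" where
  "cstar_generated X = \<Inter>{C. cstar_subalgebra C \<and> X \<subseteq> C}"

section \<open>Graphs and paths\<close>

definition countable_digraph :: "('v, 'e) pre_digraph \<Rightarrow> bool" where
  "countable_digraph E \<longleftrightarrow> wf_digraph E \<and> countable (verts E) \<and> countable (arcs E)"

definition row_finite :: "('v, 'e) pre_digraph \<Rightarrow> bool" where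
  "row_finite E \<longleftrightarrow> (\<forall>v\<in>verts E. finite (out_arcs E v))"

text \<open>A path is its source together with its list of edges; \<open>(v, [])\<close> is the vertex \<open>v\<close> regarded
  as a path of length 0.\<close>

definition paths :: "('v, 'e) pre_digraph \<Rightarrow> ('v \<times> 'e list) set" where
  "paths E = {(u, es). \<exists>v. pre_digraph.awalk E u es v}"

definition path_source :: "'v \<times> 'e list \<Rightarrow> 'v" where
  "path_source \<mu> = fst \<mu>"

definition path_range :: "('v, 'e) pre_digraph \<Rightarrow> 'v \<times> 'e list \<Rightarrow> 'v" where
  "path_range E \<mu> = (if snd \<mu> = [] then fst \<mu> else head E (last (snd \<mu>)))"

definition loops :: "('v, 'e) pre_digraph \<Rightarrow> ('v \<times> 'e list) set" where
  "loops E = {L \<in> paths E. path_source L = path_range E L}"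

definition has_exit :: "('v, 'e) pre_digraph \<Rightarrow> 'v \<times> 'e list \<Rightarrow> bool" where
  "has_exit E L \<longleftrightarrow>
     (\<exists>e\<in>set (snd L). \<exists>f\<in>out_arcs E (tail E e). \<exists>g\<in>out_arcs E (tail E e). f \<noteq> g)"

section \<open>Graph C*-algebras\<close>

definition CK_family ::
  "('v, 'e) pre_digraph \<Rightarrow> 'b cstar_struct \<Rightarrow> ('v \<Rightarrow> 'b) \<Rightarrow> ('e \<Rightarrow> 'b) \<Rightarrow> bool" where
  "CK_family E B p S \<longleftrightarrow>
     (\<forall>v\<in>verts E. p v \<in> carrier B \<and> p v \<otimes>\<^bsub>B\<^esub> p v = p v \<and> adj B (p v) = p v) \<and>
     (\<forall>v\<in>verts E. \<forall>w\<in>verts E. v \<noteq> w \<longrightarrow> p v \<otimes>\<^bsub>B\<^esub> p w = \<zero>\<^bsub>B\<^esub>) \<and>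
     (\<forall>e\<in>arcs E. S e \<in> carrier B \<and> S e \<otimes>\<^bsub>B\<^esub> adj B (S e) \<otimes>\<^bsub>B\<^esub> S e = S e) \<and>
     (\<forall>e\<in>arcs E. adj B (S e) \<otimes>\<^bsub>B\<^esub> S e = p (head E e)) \<and>
     (\<forall>v\<in>verts E. out_arcs E v \<noteq> {} \<longrightarrow>
        p v = (\<Oplus>\<^bsub>B\<^esub>e\<in>out_arcs E v. S e \<otimes>\<^bsub>B\<^esub> adj B (S e)))"

text \<open>The type \<open>'a\<close> is (a copy of) C*(E) with canonical generators \<open>p\<close>, \<open>S\<close>.  Within HOL the test
  algebras \<open>B\<close> of the universal property have to be carried by subsets of one fixed type; the type
  used is large enough for this to be no restriction.  For countable \<open>E\<close>, the C*-algebra generated by a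
  Cuntz-Krieger family is separable, so it has at most continuum many elements and is isomorphic to
  one carried by a subset of \<open>nat \<Rightarrow> nat \<Rightarrow> complex\<close>.  The summand \<open>'a\<close> makes copies of \<open>'a\<close>
  itself available as test algebras.  Uniqueness of the homomorphism follows from generation.\<close>

definition graph_cstar_algebra ::
  "('v, 'e) pre_digraph \<Rightarrow> ('v \<Rightarrow> 'a::cstar_algebra) \<Rightarrow> ('e \<Rightarrow> 'a) \<Rightarrow> bool" where
  "graph_cstar_algebra E p S \<longleftrightarrow>
     CK_family E univ_cstar p S \<and>
     cstar_generated (p ` verts E \<union> S ` arcs E) = UNIV \<and>
     (\<forall>(B :: ('a + (nat \<Rightarrow> nat \<Rightarrow> complex)) cstar_struct) q T.
        cstar_algebra_on B \<and> CK_family E B q T \<longrightarrow>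
        (\<exists>\<phi>. star_hom univ_cstar B \<phi> \<and>
             (\<forall>v\<in>verts E. \<phi> (p v) = q v) \<and> (\<forall>e\<in>arcs E. \<phi> (S e) = T e)))"

text \<open>\<open>S\<^sub>\<mu>\<close>, as a product of the generators.\<close>

fun path_elem :: "('v \<Rightarrow> 'a::cstar_algebra) \<Rightarrow> ('e \<Rightarrow> 'a) \<Rightarrow> 'v \<times> 'e list \<Rightarrow> 'a" where
  "path_elem p S (v, []) = p v"
| "path_elem p S (v, e # es) = foldl (\<lambda>x f. x * S f) (S e) es"

text \<open>The gauge action; the automorphism is unique because the generators generate.\<close>

definition gauge_action ::
  "('v, 'e) pre_digraph \<Rightarrow> ('v \<Rightarrow> 'a::cstar_algebra) \<Rightarrow> ('e \<Rightarrow> 'a) \<Rightarrow> complex \<Rightarrow> 'a \<Rightarrow> 'a" where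
  "gauge_action E p S z = (THE \<gamma>. star_hom univ_cstar univ_cstar \<gamma> \<and>
     (\<forall>e\<in>arcs E. \<gamma> (S e) = z *\<^sub>C S e) \<and> (\<forall>v\<in>verts E. \<gamma> (p v) = p v))"

definition gauge_expectation ::
  "('v, 'e) pre_digraph \<Rightarrow> ('v \<Rightarrow> 'a::cstar_algebra) \<Rightarrow> ('e \<Rightarrow> 'a) \<Rightarrow> 'a \<Rightarrow> 'a" where
  "gauge_expectation E p S a =
     (1 / (2 * pi)) *\<^sub>R integral {0..2 * pi} (\<lambda>\<theta>. gauge_action E p S (cis \<theta>) a)"

section \<open>Traces\<close>

definition pos_cone :: "'a::cstar_algebra set" where
  "pos_cone = {b\<dagger> * b | b. True}"

text \<open>Only the values of \<open>\<tau>\<close> on \<open>pos_cone\<close> are meaningful.\<close>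

definition is_trace :: "('a::cstar_algebra \<Rightarrow> ennreal) \<Rightarrow> bool" where
  "is_trace \<tau> \<longleftrightarrow>
     (\<forall>a\<in>pos_cone. \<forall>b\<in>pos_cone. \<tau> (a + b) = \<tau> a + \<tau> b) \<and>
     (\<forall>a\<in>pos_cone. \<forall>l\<ge>0. \<tau> (l *\<^sub>R a) = ennreal l * \<tau> a) \<and>
     (\<forall>a. \<tau> (a\<dagger> * a) = \<tau> (a * a\<dagger>))"

definition faithful_trace :: "('a::cstar_algebra \<Rightarrow> ennreal) \<Rightarrow> bool" where
  "faithful_trace \<tau> \<longleftrightarrow> (\<forall>a. \<tau> (a\<dagger> * a) = 0 \<longrightarrow> a = 0)"

definition finite_cone :: "('a::cstar_algebra \<Rightarrow> ennreal) \<Rightarrow> 'a set" where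
  "finite_cone \<tau> = {a \<in> pos_cone. \<tau> a < \<infinity>}"

definition semifinite_trace :: "('a::cstar_algebra \<Rightarrow> ennreal) \<Rightarrow> bool" where
  "semifinite_trace \<tau> \<longleftrightarrow> pos_cone \<subseteq> closure (finite_cone \<tau>)"

definition lsc_trace :: "('a::cstar_algebra \<Rightarrow> ennreal) \<Rightarrow> bool" where
  "lsc_trace \<tau> \<longleftrightarrow> (\<forall>f a. (\<forall>n. f n \<in> pos_cone) \<and> a \<in> pos_cone \<and> f \<longlonglongrightarrow> a \<longrightarrow>
     \<tau> a \<le> liminf (\<lambda>n. \<tau> (f n)))"

definition gauge_invariant_trace ::
  "('v, 'e) pre_digraph \<Rightarrow> ('v \<Rightarrow> 'a::cstar_algebra) \<Rightarrow> ('e \<Rightarrow> 'a) \<Rightarrow> ('a \<Rightarrow> ennreal) \<Rightarrow> bool"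
  where
  "gauge_invariant_trace E p S \<tau> \<longleftrightarrow>
     (\<forall>z. cmod z = 1 \<longrightarrow> (\<forall>a\<in>pos_cone. \<tau> (gauge_action E p S z a) = \<tau> a))"

text \<open>The extension of a trace by linearity.  As \<open>finite_cone \<tau>\<close> is a convex cone, its complex linear
  span consists of the elements \<open>a - b + i (c - d)\<close> with \<open>a, b, c, d\<close> in the cone.  Lemma
  \<open>trace_ext_eq\<close> shows that the value is independent of the representation.\<close>

definition trace_domain :: "('a::cstar_algebra \<Rightarrow> ennreal) \<Rightarrow> 'a set" where
  "trace_domain \<tau> = {a - b + \<i> *\<^sub>C (c - d) | a b c d.
     a \<in> finite_cone \<tau> \<and> b \<in> finite_cone \<tau> \<and> c \<in> finite_cone \<tau> \<and> d \<in> finite_cone \<tau>}"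

definition trace_ext :: "('a::cstar_algebra \<Rightarrow> ennreal) \<Rightarrow> 'a \<Rightarrow> complex" where
  "trace_ext \<tau> x = (THE t. \<exists>a\<in>finite_cone \<tau>. \<exists>b\<in>finite_cone \<tau>. \<exists>c\<in>finite_cone \<tau>.
     \<exists>d\<in>finite_cone \<tau>. x = a - b + \<i> *\<^sub>C (c - d) \<and>
     t = Complex (enn2real (\<tau> a) - enn2real (\<tau> b)) (enn2real (\<tau> c) - enn2real (\<tau> d)))"

lemma pos_cone_star: "a \<in> pos_cone \<Longrightarrow> a\<dagger> = a"
  by (auto simp: pos_cone_def star_mult star_star)

lemma scaleC_minus_left_cstar: "(- c) *\<^sub>C x = - (c *\<^sub>C (x :: 'a::cstar_algebra))"
proof -
  interpret vector_space "scaleC :: complex \<Rightarrow> 'a \<Rightarrow> 'a" by (rule vector_space_scaleC)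
  show ?thesis by (rule scale_minus_left)
qed

lemma star_diff: "((x :: 'a::cstar_algebra) - y)\<dagger> = x\<dagger> - y\<dagger>"
  using star_add[of "x - y" y] by (simp add: algebra_simps)

lemma real_imag_parts_unique:
  fixes x y x' y' :: "'a::cstar_algebra"
  assumes "x\<dagger> = x" "y\<dagger> = y" "x'\<dagger> = x'" "y'\<dagger> = y'"
    and eq: "x + \<i> *\<^sub>C y = x' + \<i> *\<^sub>C y'"
  shows "x = x'" "y = y'"
proof -
  have "(x + \<i> *\<^sub>C y)\<dagger> = (x' + \<i> *\<^sub>C y')\<dagger>" by (simp only: eq)
  then have eq': "x - \<i> *\<^sub>C y = x' - \<i> *\<^sub>C y'"
    using assms(1-4) by (simp add: star_add star_scaleC scaleC_minus_left_cstar)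
  have "2 *\<^sub>R x = (x + \<i> *\<^sub>C y) + (x - \<i> *\<^sub>C y)" by (simp add: scaleR_2)
  also have "\<dots> = 2 *\<^sub>R x'" unfolding eq eq' by (simp add: scaleR_2)
  finally show xx: "x = x'" by simp
  have "\<i> *\<^sub>C y = \<i> *\<^sub>C y'" using eq xx by simp
  then have "(- \<i>) *\<^sub>C \<i> *\<^sub>C y = (- \<i>) *\<^sub>C \<i> *\<^sub>C y'" by simp
  then show "y = y'" by (simp add: scaleC_scaleC scaleC_one)
qed

lemma trace_diff_unique:
  assumes "is_trace \<tau>" and fin: "a \<in> finite_cone \<tau>" "b \<in> finite_cone \<tau>" "c \<in> finite_cone \<tau>"
    "d \<in> finite_cone \<tau>" and "a - b = c - d"
  shows "enn2real (\<tau> a) - enn2real (\<tau> b) = enn2real (\<tau> c) - enn2real (\<tau> d)"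
proof -
  have "a + d = c + b" using \<open>a - b = c - d\<close> by (simp add: algebra_simps)
  then have "\<tau> a + \<tau> d = \<tau> c + \<tau> b"
    using assms unfolding is_trace_def finite_cone_def by (metis (no_types, lifting) mem_Collect_eq)
  then have "enn2real (\<tau> a + \<tau> d) = enn2real (\<tau> c + \<tau> b)" by simp
  then show ?thesis using fin by (simp add: finite_cone_def enn2real_plus)
qed

lemma trace_ext_eq:
  assumes "is_trace \<tau>" "a \<in> finite_cone \<tau>" "b \<in> finite_cone \<tau>" "c \<in> finite_cone \<tau>"
    "d \<in> finite_cone \<tau>"
  shows "trace_ext \<tau> (a - b + \<i> *\<^sub>C (c - d)) =
    Complex (enn2real (\<tau> a) - enn2real (\<tau> b)) (enn2real (\<tau> c) - enn2real (\<tau> d))"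
  unfolding trace_ext_def
proof (rule the_equality)
  fix t
  assume "\<exists>a'\<in>finite_cone \<tau>. \<exists>b'\<in>finite_cone \<tau>. \<exists>c'\<in>finite_cone \<tau>. \<exists>d'\<in>finite_cone \<tau>.
     a - b + \<i> *\<^sub>C (c - d) = a' - b' + \<i> *\<^sub>C (c' - d') \<and>
     t = Complex (enn2real (\<tau> a') - enn2real (\<tau> b')) (enn2real (\<tau> c') - enn2real (\<tau> d'))"
  then obtain a' b' c' d' where fin: "a' \<in> finite_cone \<tau>" "b' \<in> finite_cone \<tau>"
      "c' \<in> finite_cone \<tau>" "d' \<in> finite_cone \<tau>"
    and eq: "a - b + \<i> *\<^sub>C (c - d) = a' - b' + \<i> *\<^sub>C (c' - d')"
    and t: "t = Complex (enn2real (\<tau> a') - enn2real (\<tau> b'))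
      (enn2real (\<tau> c') - enn2real (\<tau> d'))" by blast
  have sa: "x\<dagger> = x" if "x \<in> finite_cone \<tau>" for x
    using that by (simp add: finite_cone_def pos_cone_star)
  have "a - b = a' - b'" "c - d = c' - d'"
    using real_imag_parts_unique[OF _ _ _ _ eq] assms fin by (simp_all add: star_diff sa)
  then show "t = Complex (enn2real (\<tau> a) - enn2real (\<tau> b)) (enn2real (\<tau> c) - enn2real (\<tau> d))"
    using trace_diff_unique[OF assms(1)] assms fin unfolding t by metis
qed (use assms in blast)

section \<open>The diagonal\<close>

definition diagonal ::
  "('v, 'e) pre_digraph \<Rightarrow> ('v \<Rightarrow> 'a::cstar_algebra) \<Rightarrow> ('e \<Rightarrow> 'a) \<Rightarrow> 'a set" where
  "diagonal E p S = cstar_generated {path_elem p S \<mu> * (path_elem p S \<mu>)\<dagger> | \<mu>. \<mu> \<in> paths E}"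

definition off_diagonal ::
  "('v, 'e) pre_digraph \<Rightarrow> ('v \<Rightarrow> 'a::cstar_algebra) \<Rightarrow> ('e \<Rightarrow> 'a) \<Rightarrow> 'a set" where
  "off_diagonal E p S = closure (module.span scaleC
     {path_elem p S \<mu> * (path_elem p S \<nu>)\<dagger> | \<mu> \<nu>. \<mu> \<in> paths E \<and> \<nu> \<in> paths E \<and>
        path_range E \<mu> = path_range E \<nu> \<and> \<mu> \<noteq> \<nu>})"

text \<open>A trace is supported on the diagonal if it vanishes on the complementary part, the closed span of the
  \<open>S\<^sub>\<mu> S\<^sub>\<nu>\<dagger>\<close> with \<open>\<mu> \<noteq> \<nu>\<close>, and is determined by its restriction to the diagonal (among the traces of
  the class under consideration).\<close>

definition supported_on_diagonal ::
  "('v, 'e) pre_digraph \<Rightarrow> ('v \<Rightarrow> 'a::cstar_algebra) \<Rightarrow> ('e \<Rightarrow> 'a) \<Rightarrow> ('a \<Rightarrow> ennreal) \<Rightarrow> bool"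
  where
  "supported_on_diagonal E p S \<tau> \<longleftrightarrow>
     (\<forall>x \<in> trace_domain \<tau> \<inter> off_diagonal E p S. trace_ext \<tau> x = 0) \<and>
     (\<forall>\<sigma>. is_trace \<sigma> \<and> semifinite_trace \<sigma> \<and> lsc_trace \<sigma> \<and> gauge_invariant_trace E p S \<sigma> \<and>
        (\<forall>d \<in> diagonal E p S \<inter> pos_cone. \<sigma> d = \<tau> d) \<longrightarrow> (\<forall>a\<in>pos_cone. \<sigma> a = \<tau> a))"

end

theory Submission
  imports Defs
begin

text \<open>A projection always has finite trace when \<open>\<tau>\<close> is semifinite.  For an edge \<open>e\<close> the trace property
  gives \<open>\<tau> (p (head e)) = \<tau> (S\<^sub>e S\<^sub>e\<dagger>)\<close>, one of the summands of \<open>\<tau> (p (tail e))\<close>.  Around a loop all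
  these values agree, so the range projection of an exit has trace 0; but no generator \<open>S\<^sub>f\<close> vanishes,
  because the graph has a Cuntz-Krieger family of nonzero partial isometries on a Hilbert space.

  For the second part, let \<open>P\<^sub>n\<close> be the sum of the first \<open>n\<close> vertex projections.  The functional
  \<open>x \<mapsto> \<tau> (P\<^sub>n x P\<^sub>n)\<close> is bounded and gauge invariant, hence unchanged by averaging over the gauge
  action, and lower semicontinuity gives \<open>\<tau> (P\<^sub>n a P\<^sub>n) \<longlonglongrightarrow> \<tau> a\<close> for positive \<open>a\<close>.  This reduces everything to the
  monomials \<open>S\<^sub>\<mu> S\<^sub>\<nu>\<dagger>\<close>, whose closed span is the whole algebra.  If \<open>\<mu>\<close> and \<open>\<nu>\<close> have different
  lengths, a suitable rotation maps the monomial to its negative; if the lengths agree and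
  \<open>\<mu> \<noteq> \<nu>\<close>, then \<open>S\<^sub>\<nu>\<dagger> S\<^sub>\<mu> = 0\<close>.

  Positivity of the averaged element needs the positive cone to be closed and convex, i.e. positivity of
  \<open>x\<dagger> x\<close> in the spectral sense.\<close>

section \<open>Elementary C*-algebra\<close>

text \<open>The trace lives on the positive cone, may be infinite there and is not assumed norm
  continuous, so it cannot simply be taken inside the integral defining the expectation, nor be
  evaluated on limits of combinations of monomials. Compressing by \<open>P\<^sub>n\<close> cures
  both: \<open>P\<^sub>n\<close> has finite trace, and for self-adjoint \<open>x\<close> the
  elements \<open>norm x P\<^sub>n \<plusminus> P\<^sub>n x P\<^sub>n\<close> are positive with a
  sum of finite trace, which makes the compressed functional bounded. Going back, write
  \<open>a = b\<dagger> b\<close>: the trace property turns the compression into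
  \<open>b P\<^sub>n b\<dagger>\<close>, which converges in norm to \<open>b b\<dagger>\<close> and
  lies below it, so lower semicontinuity meets a matching upper bound. Positivity is extracted from
  a single square root iteration for \<open>1 - x\<close>; commutation properties of the roots take
  the place of functional calculus. The Hilbert space is indexed by \<open>nat\<close> so that the
  matrix of an operator lies in the type \<open>nat \<Rightarrow> nat \<Rightarrow> complex\<close>
  provided for test algebras. Row-finiteness lets the finitely many edges at a vertex share its
  infinite block by residues.\<close>

lemma scaleC_zero_right [simp]: "c *\<^sub>C (0 :: 'a::cstar_algebra) = 0"
  using scaleC_add_right[of c "0::'a" 0] by simp

lemma scaleC_zero_left [simp]: "0 *\<^sub>C (x :: 'a::cstar_algebra) = 0"
  using scaleC_add_left[of 0 0 x] by simp

lemma scaleC_minus_right: "c *\<^sub>C (- x) = - (c *\<^sub>C (x :: 'a::cstar_algebra))"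
  using scaleC_add_right[of c x "- x"] by (simp add: eq_neg_iff_add_eq_0 add.commute)

lemma scaleC_diff_right: "c *\<^sub>C (x - y) = c *\<^sub>C x - c *\<^sub>C (y :: 'a::cstar_algebra)"
  using scaleC_add_right[of c x "- y"] by (simp add: scaleC_minus_right)

lemma scaleC_i_i: "\<i> *\<^sub>C \<i> *\<^sub>C x = - (x :: 'a::cstar_algebra)"
  by (simp add: scaleC_scaleC scaleC_minus_left_cstar scaleC_one)

lemma star_zero [simp]: "(0 :: 'a::cstar_algebra)\<dagger> = 0"
  using star_add[of "0::'a" 0] by simp

lemma star_minus: "(- x)\<dagger> = - (x\<dagger> :: 'a::cstar_algebra)"
  using star_diff[of 0 x] by simp

lemma star_scaleR: "(r *\<^sub>R x)\<dagger> = r *\<^sub>R (x\<dagger> :: 'a::cstar_algebra)"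
  by (simp add: scaleR_scaleC star_scaleC)

lemma star_sum: "(\<Sum>i\<in>I. f i)\<dagger> = (\<Sum>i\<in>I. (f i :: 'a::cstar_algebra)\<dagger>)"
  by (induction I rule: infinite_finite_induct) (simp_all add: star_add)

lemma star_one [simp]: "(1 :: 'a::{cstar_algebra, real_normed_algebra_1})\<dagger> = 1"
  by (metis mult_1 mult_1_right star_mult star_star)

text \<open>The inequality for \<open>x\<close> gives \<open>norm x \<le> norm (st x)\<close> after
  cancelling one factor. Used at \<open>st x\<close> as well it makes \<open>st\<close> isometric,
  and submultiplicativity supplies the missing half of the identity.\<close>

lemma cstar_identityI:
  fixes st :: "'a::real_normed_algebra \<Rightarrow> 'a"
  assumes ge: "\<And>x. (norm x)\<^sup>2 \<le> norm (st x * x)" and st: "\<And>x. st (st x) = x"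
  shows "norm (st x) = norm x" "norm (st x * x) = (norm x)\<^sup>2"
proof -
  have *: "norm y \<le> norm (st y)" for y
  proof (cases "y = 0")
    case False
    have "norm y * norm y \<le> norm (st y) * norm y"
      using ge[of y] norm_mult_ineq[of "st y" y] by (simp add: power2_eq_square)
    then show ?thesis using False by simp
  qed simp
  show eq: "norm (st x) = norm x" using *[of x] *[of "st x"] by (simp add: st)
  show "norm (st x * x) = (norm x)\<^sup>2"
    using ge[of x] norm_mult_ineq[of "st x" x] by (simp add: eq power2_eq_square)
qed

text \<open>The upper bound for the scalar \<open>inverse c\<close>, applied to
  \<open>sc c x\<close>, is the lower bound for \<open>c\<close>.\<close>

lemma norm_scaleCI:
  fixes sc :: "complex \<Rightarrow> 'a::real_normed_vector \<Rightarrow> 'a"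
  assumes le: "\<And>c x. norm (sc c x) \<le> cmod c * norm x"
    and inv: "c \<noteq> 0 \<Longrightarrow> sc (inverse c) (sc c x) = x"
  shows "norm (sc c x) = cmod c * norm x"
proof (cases "c = 0")
  case False
  have "norm x \<le> inverse (cmod c) * norm (sc c x)"
    using le[of "inverse c" "sc c x"] inv[OF False] by (simp add: norm_inverse)
  then show ?thesis using False le[of c x] by (simp add: field_simps)
qed (use le[of c x] in simp)

lemma norm_le_sqrtI:
  assumes "(norm y)\<^sup>2 \<le> K * (norm x)\<^sup>2"
  shows "norm y \<le> sqrt K * norm x"
  using real_le_rsqrt[OF assms] by (simp add: real_sqrt_mult)

lemma norm_star [simp]: "norm (x\<dagger>) = norm (x :: 'a::cstar_algebra)"
  by (rule cstar_identityI) (simp_all add: cstar_identity star_star)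

lemma bounded_linear_star: "bounded_linear (star :: 'a::cstar_algebra \<Rightarrow> 'a)"
  by (rule bounded_linear_intro[where K = 1]) (simp_all add: star_add star_scaleR)

lemma bounded_linear_scaleC: "bounded_linear (scaleC c :: 'a::cstar_algebra \<Rightarrow> 'a)"
  by (rule bounded_linear_intro[where K = "cmod c"])
    (simp_all add: scaleC_add_right scaleR_scaleC scaleC_scaleC norm_scaleC mult.commute)

lemma norm_self_adjoint_square:
  "(h :: 'a::cstar_algebra)\<dagger> = h \<Longrightarrow> norm (h * h) = (norm h)\<^sup>2"
  using cstar_identity[of h] by simp

lemma star_mult_self_eq_0_iff: "(x :: 'a::cstar_algebra)\<dagger> * x = 0 \<longleftrightarrow> x = 0"
  using cstar_identity[of x] by auto

section \<open>Unitization\<close>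

text \<open>The norm is the operator norm of the action by left multiplication; the maximum with the modulus
  of the scalar part keeps it definite when the algebra already has a unit.\<close>

datatype 'a unitization = Unitize (alg: 'a) (scal: complex)

abbreviation embed :: "'a \<Rightarrow> 'a unitization" where "embed a \<equiv> Unitize a 0"

lemma unitization_eqI: "alg u = alg v \<Longrightarrow> scal u = scal v \<Longrightarrow> u = v"
  by (cases u; cases v) simp

instantiation unitization :: (cstar_algebra) ring_1
begin

definition "0 = Unitize 0 0"
definition "1 = Unitize 0 1"
definition "u + v = Unitize (alg u + alg v) (scal u + scal v)"
definition "u - v = Unitize (alg u - alg v) (scal u - scal v)"
definition "- u = Unitize (- alg u) (- scal u)"
definition "u * v =
  Unitize (alg u * alg v + scal u *\<^sub>C alg v + scal v *\<^sub>C alg u) (scal u * scal v)"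

lemma unitization_simps [simp]:
  "alg 0 = (0 :: 'a)" "scal (0 :: 'a unitization) = 0"
  "alg 1 = (0 :: 'a)" "scal (1 :: 'a unitization) = 1"
  "alg (u + v) = alg u + (alg v :: 'a)" "scal (u + v) = scal u + scal (v :: 'a unitization)"
  "alg (u - v) = alg u - (alg v :: 'a)" "scal (u - v) = scal u - scal (v :: 'a unitization)"
  "alg (- u) = - (alg u :: 'a)" "scal (- u) = - scal (u :: 'a unitization)"
  "alg (u * v) = alg u * alg v + scal u *\<^sub>C alg v + scal v *\<^sub>C (alg u :: 'a)"
  "scal (u * v) = scal u * scal (v :: 'a unitization)"
  by (simp_all add: zero_unitization_def one_unitization_def plus_unitization_def
      minus_unitization_def uminus_unitization_def times_unitization_def)

instance
  by standard (auto intro!: unitization_eqI simp: algebra_simps scaleC_add_left scaleC_add_right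
      scaleC_scaleC mult_scaleC_left mult_scaleC_right scaleC_one zero_unitization_def
      one_unitization_def)

end

definition unit_act :: "'a::cstar_algebra unitization \<Rightarrow> 'a \<Rightarrow> 'a" where
  "unit_act u x = alg u * x + scal u *\<^sub>C x"

lemma bounded_linear_unit_act: "bounded_linear (unit_act u)"
  unfolding unit_act_def
  by (intro bounded_linear_add bounded_linear_mult_right bounded_linear_scaleC)

lemma unit_act_mult: "unit_act (u * v) x = unit_act u (unit_act v x)"
  by (simp add: unit_act_def algebra_simps scaleC_add_left scaleC_add_right
      scaleC_scaleC mult_scaleC_left mult_scaleC_right)

text \<open>The test vector \<open>a\<dagger>\<close> attains the norm, since
  \<open>norm (a * a\<dagger>)\<close> is \<open>(norm a)\<^sup>2\<close>.\<close>

lemma onorm_embed: "onorm (unit_act (embed a)) = norm (a :: 'a::cstar_algebra)"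
proof (rule antisym)
  show "onorm (unit_act (embed a)) \<le> norm a"
    by (rule onorm_bound) (simp_all add: unit_act_def norm_mult_ineq)
  have "(norm a)\<^sup>2 \<le> onorm (unit_act (embed a)) * norm a"
    using onorm[OF bounded_linear_unit_act, of "embed a" "a\<dagger>"] cstar_identity[of "a\<dagger>"]
    by (simp add: unit_act_def star_star)
  then show "norm a \<le> onorm (unit_act (embed a))"
    using onorm_pos_le[OF bounded_linear_unit_act, of "embed a"]
    by (cases "norm a = 0") (simp_all add: power2_eq_square)
qed

instantiation unitization :: (cstar_algebra) real_normed_algebra_1
begin

definition "r *\<^sub>R u = Unitize (r *\<^sub>R alg u) (r *\<^sub>R scal u)"
definition "norm u = max (cmod (scal u)) (onorm (unit_act u))"
definition "dist u v = norm (u - v :: 'a unitization)"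
definition "sgn u = inverse (norm u) *\<^sub>R (u :: 'a unitization)"
definition "uniformity = (INF e\<in>{0<..}. principal {(u, v :: 'a unitization). dist u v < e})"
definition "open U =
  (\<forall>u\<in>U. eventually (\<lambda>(u', v :: 'a unitization). u' = u \<longrightarrow> v \<in> U) uniformity)"

lemma unitization_scaleR_simps [simp]:
  "alg (r *\<^sub>R u) = r *\<^sub>R (alg u :: 'a)" "scal (r *\<^sub>R u) = r *\<^sub>R scal (u :: 'a unitization)"
  by (simp_all add: scaleR_unitization_def)

instance
proof
  fix u v :: "'a unitization" and r s :: real
  show "r *\<^sub>R (u + v) = r *\<^sub>R u + r *\<^sub>R v" "(r + s) *\<^sub>R u = r *\<^sub>R u + s *\<^sub>R u"
    "r *\<^sub>R s *\<^sub>R u = (r * s) *\<^sub>R u" "1 *\<^sub>R u = u"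
    "r *\<^sub>R u * v = r *\<^sub>R (u * v)" "u * r *\<^sub>R v = r *\<^sub>R (u * v)"
    by (auto intro!: unitization_eqI simp: algebra_simps scaleR_scaleC scaleC_add_left
        scaleC_add_right scaleC_scaleC mult_scaleC_left mult_scaleC_right scaleC_one
        scaleR_conv_of_real[where 'a = complex])
  have act_add: "unit_act (u + v) = (\<lambda>x. unit_act u x + unit_act v x)"
    by (auto simp: unit_act_def algebra_simps scaleC_add_left)
  have act_scale: "unit_act (r *\<^sub>R u) = (\<lambda>x. r *\<^sub>R unit_act u x)"
    by (auto simp: unit_act_def algebra_simps scaleR_scaleC scaleC_scaleC mult_scaleC_left
        scaleC_add_right scaleR_conv_of_real[where 'a = complex])
  have act_mult: "unit_act (u * v) = unit_act u \<circ> unit_act v"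
    by (auto simp: unit_act_mult)
  note bl = bounded_linear_unit_act
  show "norm (u + v) \<le> norm u + norm v"
    using onorm_triangle[OF bl bl, of u v] norm_triangle_ineq[of "scal u" "scal v"]
    by (auto simp: norm_unitization_def act_add max_def)
  show "norm (r *\<^sub>R u) = \<bar>r\<bar> * norm u"
    by (auto simp: norm_unitization_def act_scale onorm_scaleR[OF bl] max_mult_distrib_left)
  have "onorm (unit_act u) * onorm (unit_act v) \<le> norm u * norm v"
    by (intro mult_mono) (auto simp: norm_unitization_def onorm_pos_le[OF bl] max.coboundedI1)
  then have "onorm (unit_act (u * v)) \<le> norm u * norm v"
    using onorm_compose[OF bl bl, of u v] by (simp add: act_mult)
  moreover have "cmod (scal u) * cmod (scal v) \<le> norm u * norm v"
    by (intro mult_mono) (auto simp: norm_unitization_def max.coboundedI1)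
  ultimately show "norm (u * v) \<le> norm u * norm v"
    by (simp add: norm_unitization_def[of "u * v"] norm_mult)
  show "(norm u = 0) = (u = 0)"
  proof
    assume "norm u = 0"
    then have "scal u = 0" "onorm (unit_act u) = 0"
      using onorm_pos_le[OF bl, of u] norm_ge_zero[of "scal u"] unfolding norm_unitization_def
      by (auto simp: max_def split: if_splits)
    then show "u = 0"
      using onorm_embed[of "alg u"] by (cases u) (simp add: zero_unitization_def)
  next
    assume "u = 0"
    moreover have "unit_act (0 :: 'a unitization) = (\<lambda>x. 0)" by (simp add: unit_act_def fun_eq_iff)
    ultimately show "norm u = 0" by (simp add: norm_unitization_def onorm_zero)
  qed
  have "unit_act (1 :: 'a unitization) = (\<lambda>x. x)"
    by (simp add: unit_act_def fun_eq_iff scaleC_one)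
  \<comment> \<open>On the zero algebra the identity operator has norm 0, so only an upper bound for
    it is used; the value 1 comes from the scalar part.\<close>
  then show "norm (1 :: 'a unitization) = 1"
    using onorm_id_le[where 'a = 'a] by (simp add: norm_unitization_def max_absorb1)
qed (simp_all add: dist_unitization_def sgn_unitization_def uniformity_unitization_def
    open_unitization_def)

end

lemma norm_embed [simp]: "norm (embed a) = norm (a :: 'a::cstar_algebra)"
  by (simp add: norm_unitization_def onorm_embed)

lemma norm_Unitize_scalar: "norm (Unitize 0 c :: 'a::cstar_algebra unitization) = cmod c"
proof -
  have "unit_act (Unitize 0 c :: 'a unitization) = scaleC c" by (simp add: unit_act_def fun_eq_iff)
  moreover have "onorm (scaleC c :: 'a \<Rightarrow> 'a) \<le> cmod c"
    by (rule onorm_bound) (simp_all add: norm_scaleC)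
  ultimately show ?thesis by (simp add: norm_unitization_def)
qed

lemma norm_unitization_le: "norm u \<le> norm (alg u) + cmod (scal (u :: 'a::cstar_algebra unitization))"
proof -
  have "u = embed (alg u) + Unitize 0 (scal u)" by (simp add: unitization_eqI)
  then show ?thesis by (metis norm_triangle_ineq norm_embed norm_Unitize_scalar)
qed

text \<open>Removing the scalar part costs at most another \<open>norm u\<close>, whence the factor
  2. Both coordinate maps are thus bounded, and completeness can be checked coordinatewise.\<close>

lemma norm_alg_le: "norm (alg u) \<le> 2 * norm (u :: 'a::cstar_algebra unitization)"
proof -
  have "embed (alg u) = u - Unitize 0 (scal u)" by (simp add: unitization_eqI)
  then have "norm (alg u) \<le> norm u + cmod (scal u)"
    by (metis norm_triangle_ineq4 norm_embed norm_Unitize_scalar)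
  then show ?thesis by (simp add: norm_unitization_def)
qed

lemma cmod_scal_le: "cmod (scal u) \<le> norm (u :: 'a::cstar_algebra unitization)"
  by (simp add: norm_unitization_def)

instantiation unitization :: (cstar_algebra) cstar_algebra
begin

definition "c *\<^sub>C u = Unitize (c *\<^sub>C alg u) (c * scal u)"
definition "u\<dagger> = Unitize ((alg u)\<dagger>) (cnj (scal u))"

lemma unitization_star_simps [simp]:
  "alg (c *\<^sub>C u) = c *\<^sub>C (alg u :: 'a)" "scal (c *\<^sub>C u) = c * scal (u :: 'a unitization)"
  "alg (u\<dagger>) = (alg u :: 'a)\<dagger>" "scal (u\<dagger>) = cnj (scal (u :: 'a unitization))"
  by (simp_all add: scaleC_unitization_def star_unitization_def)

instance
proof
  fix f :: "nat \<Rightarrow> 'a unitization"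
  assume f: "Cauchy f"
  have "bounded_linear (alg :: 'a unitization \<Rightarrow> 'a)"
    by (rule bounded_linear_intro[where K = 2]) (use norm_alg_le in \<open>simp_all add: mult.commute[of _ 2]\<close>)
  moreover have "bounded_linear (scal :: 'a unitization \<Rightarrow> complex)"
    by (rule bounded_linear_intro[where K = 1]) (simp_all add: cmod_scal_le)
  ultimately have "Cauchy (\<lambda>n. alg (f n))" and cauchy_scal: "Cauchy (\<lambda>n. scal (f n))"
    using f by (auto intro: bounded_linear.Cauchy)
  then obtain a where a: "(\<lambda>n. alg (f n)) \<longlonglongrightarrow> a" using Cauchy_convergent convergent_def by blast
  obtain c where c: "(\<lambda>n. scal (f n)) \<longlonglongrightarrow> c"
    using Cauchy_convergent[OF cauchy_scal] convergent_def by blast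
  have "(\<lambda>n. norm (alg (f n) - a) + cmod (scal (f n) - c)) \<longlonglongrightarrow> 0"
    using tendsto_add[OF tendsto_norm_zero[OF LIM_zero[OF a]] tendsto_norm_zero[OF LIM_zero[OF c]]]
    by simp
  then have "(\<lambda>n. norm (f n - Unitize a c)) \<longlonglongrightarrow> 0"
    by (rule Lim_null_comparison[rotated])
      (use norm_unitization_le[of "f n - Unitize a c" for n] in \<open>auto intro!: always_eventually\<close>)
  then have "f \<longlonglongrightarrow> Unitize a c" using LIM_zero_cancel tendsto_norm_zero_iff by blast
  then show "convergent f" by (auto simp: convergent_def)
next
  fix u v :: "'a unitization" and c d :: complex and r :: real
  show "r *\<^sub>R u = complex_of_real r *\<^sub>C u" "c *\<^sub>C (u + v) = c *\<^sub>C u + c *\<^sub>C v"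
    "(c + d) *\<^sub>C u = c *\<^sub>C u + d *\<^sub>C u" "c *\<^sub>C d *\<^sub>C u = (c * d) *\<^sub>C u" "1 *\<^sub>C u = u"
    "(c *\<^sub>C u) * v = c *\<^sub>C (u * v)" "u * (c *\<^sub>C v) = c *\<^sub>C (u * v)"
    "(u\<dagger>)\<dagger> = u" "(u + v)\<dagger> = u\<dagger> + v\<dagger>" "(c *\<^sub>C u)\<dagger> = cnj c *\<^sub>C u\<dagger>" "(u * v)\<dagger> = v\<dagger> * u\<dagger>"
    by (auto intro!: unitization_eqI simp: algebra_simps scaleR_scaleC scaleC_add_left
        scaleC_add_right scaleC_scaleC mult_scaleC_left mult_scaleC_right scaleC_one star_star
        star_add star_scaleC star_mult scaleR_conv_of_real[where 'a = complex])
  have le: "norm (c *\<^sub>C u) \<le> cmod c * norm u" for c and u :: "'a unitization"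
  proof -
    have "c *\<^sub>C u = Unitize 0 c * u" by (simp add: unitization_eqI)
    then show ?thesis by (metis norm_mult_ineq norm_Unitize_scalar)
  qed
  show "norm (c *\<^sub>C u) = cmod c * norm u"
    by (rule norm_scaleCI[OF le]) (simp add: unitization_eqI scaleC_scaleC scaleC_one)
  \<comment> \<open>The vectors \<open>unit_act u x\<close> lie in the original algebra, so its
    C*-identity applies to them and bounds the operator norm of \<open>u\<close> through that of
    \<open>u\<dagger> * u\<close>.\<close>
  have ge: "(norm u)\<^sup>2 \<le> norm (u\<dagger> * u)" for u :: "'a unitization"
  proof -
    have "norm (unit_act u x) \<le> sqrt (norm (u\<dagger> * u)) * norm x" for x
    proof -
      have "(norm (unit_act u x))\<^sup>2 = norm (x\<dagger> * unit_act (u\<dagger> * u) x)"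
        unfolding cstar_identity[symmetric]
        by (simp add: unit_act_def star_add star_mult star_scaleC algebra_simps scaleC_add_right
            scaleC_add_left mult_scaleC_left mult_scaleC_right scaleC_scaleC)
      also have "\<dots> \<le> norm x * (onorm (unit_act (u\<dagger> * u)) * norm x)"
        by (rule order_trans[OF norm_mult_ineq])
          (auto intro!: mult_left_mono onorm[OF bounded_linear_unit_act])
      also have "\<dots> \<le> norm x * (norm (u\<dagger> * u) * norm x)"
        by (intro mult_left_mono mult_right_mono) (auto simp: norm_unitization_def)
      finally have "(norm (unit_act u x))\<^sup>2 \<le> norm (u\<dagger> * u) * (norm x)\<^sup>2"
        by (simp add: power2_eq_square mult_ac)
      then show ?thesis by (rule norm_le_sqrtI)
    qed
    then have "onorm (unit_act u) \<le> sqrt (norm (u\<dagger> * u))" by (rule onorm_bound[rotated]) simp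
    moreover have "cmod (scal u) \<le> sqrt (norm (u\<dagger> * u))"
      using cmod_scal_le[of "u\<dagger> * u"] by (intro real_le_rsqrt) (simp add: norm_mult power2_eq_square)
    ultimately have "norm u \<le> sqrt (norm (u\<dagger> * u))" by (simp add: norm_unitization_def[of u])
    then have "(norm u)\<^sup>2 \<le> (sqrt (norm (u\<dagger> * u)))\<^sup>2" by (intro power_mono) simp_all
    then show ?thesis by simp
  qed
  then show "norm (u\<dagger> * u) = (norm u)\<^sup>2"
    by (rule cstar_identityI) (simp add: unitization_eqI star_star)
qed

end

lemma embed_simps:
  "embed (a + b) = embed a + embed (b :: 'a::cstar_algebra)"
  "embed (a - b) = embed a - embed b" "embed (- a) = - embed a"
  "embed (a * b) = embed a * embed b" "embed (c *\<^sub>C a) = c *\<^sub>C embed a"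
  "embed (r *\<^sub>R a) = r *\<^sub>R embed a" "embed (a\<dagger>) = (embed a)\<dagger>" "embed 0 = 0"
  by (simp_all add: unitization_eqI)

section \<open>Positivity\<close>

text \<open>\<open>1 - y\<close> is the square root of \<open>1 - x\<close>, expressed without a unit.  It is the limit of
  \<open>y\<^sub>0 = 0\<close>, \<open>y\<^sub>n\<^sub>+\<^sub>1 = (x + y\<^sub>n\<^sup>2) / 2\<close>; the same iteration started at \<open>x = 1\<close> in the reals majorizes the
  increments and increases to 1.\<close>

lemma sqrt_one_minus_exists:
  fixes x :: "'a::cstar_algebra"
  assumes x: "norm x \<le> 1"
  obtains y where "2 *\<^sub>R y = x + y * y" "norm y \<le> 1" "x\<dagger> = x \<Longrightarrow> y\<dagger> = y"
    "\<And>w. w * x = x * w \<Longrightarrow> w * y = y * w"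
proof -
  define Y where "Y = rec_nat 0 (\<lambda>_ y. (1/2) *\<^sub>R (x + y * y))"
  define \<eta> where "\<eta> = rec_nat 0 (\<lambda>_ t. (1 + t * t) / 2 :: real)"
  have Y0: "Y 0 = 0" and YS: "Y (Suc n) = (1/2) *\<^sub>R (x + Y n * Y n)" for n
    by (simp_all only: Y_def nat.rec)
  have \<eta>0: "\<eta> 0 = 0" and \<eta>S: "\<eta> (Suc n) = (1 + \<eta> n * \<eta> n) / 2" for n by (simp_all add: \<eta>_def)
  have \<eta>b: "0 \<le> \<eta> n \<and> \<eta> n \<le> 1" for n
  proof (induction n)
    case (Suc n)
    then have "\<eta> n * \<eta> n \<le> 1 * 1" by (intro mult_mono) auto
    then show ?case using Suc by (simp add: \<eta>S)
  qed (simp add: \<eta>0)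
  have comm: "w * Y n = Y n * w" if w: "w * x = x * w" for w n
  proof (induction n)
    case (Suc n)
    have "w * (Y n * Y n) = Y n * Y n * w"
      by (metis (no_types, lifting) Suc.IH mult.assoc)
    then show ?case by (simp add: YS algebra_simps w)
  qed (simp add: Y0)
  have Yx: "x * Y n = Y n * x" for n by (rule comm) simp
  have YY: "Y m * Y n = Y n * Y m" for m n by (rule comm) (simp add: Yx)
  have bound: "norm (Y n) \<le> \<eta> n \<and> norm (Y (Suc n) - Y n) \<le> \<eta> (Suc n) - \<eta> n" for n
  proof (induction n)
    case 0
    show ?case using x by (simp add: Y0 YS \<eta>0 \<eta>S)
  next
    case (Suc n)
    have 1: "norm (Y (Suc n)) \<le> \<eta> (Suc n)"
      using Suc norm_triangle_ineq[of "Y (Suc n) - Y n" "Y n"] by simp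
    \<comment> \<open>Iterates commute, so the difference of two squares factors. The real
      increments factor in the same way, which carries the majorization to the next step.\<close>
    have "Y (Suc (Suc n)) - Y (Suc n) = (1/2) *\<^sub>R ((Y (Suc n) - Y n) * (Y (Suc n) + Y n))"
      unfolding YS[of "Suc n"] by (subst (2) YS) (simp add: algebra_simps YY[of n "Suc n"])
    then have "norm (Y (Suc (Suc n)) - Y (Suc n)) \<le> (1/2) * (norm (Y (Suc n) - Y n) * norm (Y (Suc n) + Y n))"
      by (simp add: norm_mult_ineq)
    also have "\<dots> \<le> (1/2) * ((\<eta> (Suc n) - \<eta> n) * (\<eta> (Suc n) + \<eta> n))"
    proof (intro mult_left_mono mult_mono)
      show "norm (Y (Suc n) + Y n) \<le> \<eta> (Suc n) + \<eta> n"
        using Suc 1 norm_triangle_ineq[of "Y (Suc n)" "Y n"] by linarith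
      show "0 \<le> \<eta> (Suc n) - \<eta> n" using Suc norm_ge_zero[of "Y (Suc n) - Y n"] by linarith
    qed (use Suc in auto)
    also have "\<dots> = \<eta> (Suc (Suc n)) - \<eta> (Suc n)"
      unfolding \<eta>S[of "Suc n"] by (subst (3) \<eta>S) (simp add: field_simps)
    finally show ?case using 1 by simp
  qed
  have "summable (\<lambda>n. \<eta> (Suc n) - \<eta> n)"
  proof (rule bounded_imp_summable)
    show "0 \<le> \<eta> (Suc n) - \<eta> n" for n using bound[of n] order_trans[OF norm_ge_zero] by blast
    show "(\<Sum>k\<le>n. \<eta> (Suc k) - \<eta> k) \<le> 1" for n
      using \<eta>b[of "Suc n"] sum_lessThan_telescope[of \<eta> "Suc n"] by (simp add: \<eta>0 lessThan_Suc_atMost)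
  qed
  then have "summable (\<lambda>n. Y (Suc n) - Y n)"
    by (rule summable_comparison_test[rotated]) (use bound in blast)
  then have "convergent (\<lambda>n. Y 0 + (\<Sum>k<n. Y (Suc k) - Y k))"
    by (intro convergent_add convergent_const) (simp add: summable_iff_convergent)
  then obtain y where y: "Y \<longlonglongrightarrow> y"
    by (auto simp: sum_lessThan_telescope convergent_def)
  show thesis
  proof
    have "(\<lambda>n. 2 *\<^sub>R Y (Suc n)) \<longlonglongrightarrow> x + y * y"
      unfolding YS by (auto intro!: tendsto_intros y)
    moreover have "(\<lambda>n. 2 *\<^sub>R Y (Suc n)) \<longlonglongrightarrow> 2 *\<^sub>R y"
      using LIMSEQ_Suc[OF y] by (auto intro!: tendsto_intros)
    ultimately show "2 *\<^sub>R y = x + y * y" using LIMSEQ_unique by blast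
    show "norm y \<le> 1"
      by (rule LIMSEQ_le_const2[OF tendsto_norm[OF y]]) (use bound \<eta>b order_trans in blast)
    show "y\<dagger> = y" if "x\<dagger> = x"
    proof -
      have "(Y n)\<dagger> = Y n" for n
        by (induction n) (simp_all add: Y0 YS star_scaleR star_add star_mult that)
      then have "Y \<longlonglongrightarrow> y\<dagger>" using bounded_linear.tendsto[OF bounded_linear_star y] by simp
      then show ?thesis using y by (rule LIMSEQ_unique)
    qed
    show "w * y = y * w" if "w * x = x * w" for w
    proof (rule LIMSEQ_unique)
      show "(\<lambda>n. w * Y n) \<longlonglongrightarrow> w * y" by (intro tendsto_intros y)
      show "(\<lambda>n. w * Y n) \<longlonglongrightarrow> y * w" unfolding comm[OF that] by (intro tendsto_intros y)
    qed
  qed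
qed

text \<open>The bound on \<open>1 - k\<close> is carried along because, after rescaling, it
  certifies that the root is itself \<open>psd\<close>.\<close>

lemma unital_sqrt_one_minus:
  fixes x :: "'a::{cstar_algebra, real_normed_algebra_1}"
  assumes "norm x \<le> 1" "x\<dagger> = x"
  obtains k where "k\<dagger> = k" "k * k = 1 - x" "norm (1 - k) \<le> 1" "\<And>w. w * x = x * w \<Longrightarrow> w * k = k * w"
proof -
  obtain y where y: "2 *\<^sub>R y = x + y * y" "norm y \<le> 1" "x\<dagger> = x \<Longrightarrow> y\<dagger> = y"
    "\<And>w. w * x = x * w \<Longrightarrow> w * y = y * w"
    using sqrt_one_minus_exists[OF assms(1)] by blast
  show thesis
  proof (rule that)
    show "(1 - y)\<dagger> = 1 - y" using y(3)[OF assms(2)] by (simp add: star_diff)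
    have "(1 - y) * (1 - y) = 1 - 2 *\<^sub>R y + y * y" by (simp add: algebra_simps scaleR_2)
    then show "(1 - y) * (1 - y) = 1 - x" by (simp add: y(1))
    show "norm (1 - (1 - y)) \<le> 1" using y(2) by simp
    show "w * (1 - y) = (1 - y) * w" if "w * x = x * w" for w
      using y(4)[OF that] by (simp add: algebra_simps)
  qed
qed

text \<open>\<open>h + i k\<close> is \<open>sqrt t\<close> times a unitary, and \<open>h\<close> is its real part.\<close>

lemma norm_le_of_sum_of_squares:
  fixes h k :: "'a::{cstar_algebra, real_normed_algebra_1}"
  assumes "h\<dagger> = h" "k\<dagger> = k" "h * k = k * h" and sum: "h * h + k * k = t *\<^sub>R 1" and "t \<ge> 0"
  shows "(norm h)\<^sup>2 \<le> t"
proof -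
  define u where "u = h + \<i> *\<^sub>C k"
  have us: "u\<dagger> = h - \<i> *\<^sub>C k"
    by (simp add: u_def star_add star_scaleC assms scaleC_minus_left_cstar)
  have "u\<dagger> * u = h * h + k * k"
    unfolding us unfolding u_def
    by (simp add: algebra_simps mult_scaleC_left mult_scaleC_right scaleC_i_i assms(3)
        scaleC_diff_right)
  then have nu: "(norm u)\<^sup>2 = t" using cstar_identity[of u] \<open>t \<ge> 0\<close> by (simp add: sum)
  have "2 *\<^sub>R h = u + u\<dagger>" unfolding us unfolding u_def by (simp add: scaleR_2)
  then have "norm (2 *\<^sub>R h) \<le> norm u + norm u" by (metis norm_triangle_ineq norm_star)
  then have "norm h \<le> norm u" by simp
  then show ?thesis using nu by (metis norm_ge_zero power_mono)
qed

lemma commuting_squares_sum_eq_0: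
  fixes h k :: "'a::{cstar_algebra, real_normed_algebra_1}"
  assumes "h\<dagger> = h" "k\<dagger> = k" "h * k = k * h" "h * h + k * k = 0"
  shows "h = 0"
proof -
  have "(norm h)\<^sup>2 \<le> 0"
    by (rule norm_le_of_sum_of_squares[OF assms(1-3)]) (simp_all add: assms(4))
  then show ?thesis by simp
qed

text \<open>For self-adjoint \<open>a\<close> and \<open>t \<ge> norm a\<close>, the spectrum of \<open>a\<close> is nonnegative iff
  \<open>norm (t - a) \<le> t\<close>.\<close>

definition psd :: "'a::{cstar_algebra, real_normed_algebra_1} \<Rightarrow> bool" where
  "psd a \<longleftrightarrow> a\<dagger> = a \<and> (\<exists>t. norm (t *\<^sub>R 1 - a) \<le> t)"

text \<open>With \<open>x = 1 - a / t\<close> the certificate \<open>norm (t - a) \<le> t\<close>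
  reads \<open>norm x \<le> 1\<close>, and \<open>sqrt t\<close> times the root of
  \<open>1 - x\<close> squares to \<open>a\<close>. The commutation clause makes roots of commuting
  elements commute.\<close>

lemma psd_sqrt:
  assumes "psd (a :: 'a::{cstar_algebra, real_normed_algebra_1})"
  obtains h where "h\<dagger> = h" "psd h" "h * h = a" "\<And>w. w * a = a * w \<Longrightarrow> w * h = h * w"
proof -
  obtain t where sa: "a\<dagger> = a" and t: "norm (t *\<^sub>R 1 - a) \<le> t" using assms by (auto simp: psd_def)
  have "t \<ge> 0" using t norm_ge_zero order_trans by blast
  show thesis
  proof (cases "t = 0")
    case True
    then have "a = 0" using t by simp
    then show thesis by (intro that[of 0]) (auto simp: psd_def intro: exI[of _ 0])
  next
    case False
    with \<open>t \<ge> 0\<close> have "t > 0" by simp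
    define x where "x = 1 - (1 / t) *\<^sub>R a"
    have "x = (1 / t) *\<^sub>R (t *\<^sub>R 1 - a)" using \<open>t > 0\<close> by (simp add: x_def algebra_simps)
    then have "norm x \<le> 1" using t \<open>t > 0\<close> by simp
    moreover have "x\<dagger> = x" by (simp add: x_def star_diff star_scaleR sa)
    ultimately obtain k where k: "k\<dagger> = k" "k * k = 1 - x" "norm (1 - k) \<le> 1"
      "\<And>w. w * x = x * w \<Longrightarrow> w * k = k * w"
      using unital_sqrt_one_minus by blast
    define h where "h = sqrt t *\<^sub>R k"
    have hsa: "h\<dagger> = h" by (simp add: h_def star_scaleR k(1))
    have "sqrt t *\<^sub>R 1 - h = sqrt t *\<^sub>R (1 - k)" by (simp add: h_def algebra_simps)
    then have "norm (sqrt t *\<^sub>R 1 - h) \<le> sqrt t" using k(3) \<open>t > 0\<close> by simp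
    then have "psd h" using hsa by (auto simp: psd_def)
    moreover have "h * h = a" using \<open>t > 0\<close> by (simp add: h_def k(2) x_def)
    moreover have "w * h = h * w" if "w * a = a * w" for w
    proof -
      have "w * k = k * w" by (rule k(4)) (simp add: x_def algebra_simps that)
      then show ?thesis by (simp add: h_def)
    qed
    ultimately show thesis using that hsa by blast
  qed
qed

text \<open>A root \<open>g\<close> of \<open>r - h * h\<close> commutes with \<open>h\<close>, and
  the two squares add up to \<open>r\<close>. Hence \<open>norm g\<close> is at most
  \<open>sqrt r\<close>, and squaring bounds \<open>r - h * h\<close>.\<close>

lemma norm_diff_square_le:
  fixes h :: "'a::{cstar_algebra, real_normed_algebra_1}"
  assumes sa: "h\<dagger> = h" and r: "(norm h)\<^sup>2 \<le> r"
  shows "norm (r *\<^sub>R 1 - h * h) \<le> r"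
proof (cases "r = 0")
  case True
  then show ?thesis using r by simp
next
  case False
  then have "r > 0" using r by (smt (verit) zero_le_power2)
  define x where "x = (1 / r) *\<^sub>R (h * h)"
  have "norm x \<le> 1" using r \<open>r > 0\<close> by (simp add: x_def norm_self_adjoint_square[OF sa])
  moreover have "x\<dagger> = x" by (simp add: x_def star_scaleR star_mult sa)
  ultimately obtain k where k: "k\<dagger> = k" "k * k = 1 - x" "\<And>w. w * x = x * w \<Longrightarrow> w * k = k * w"
    using unital_sqrt_one_minus by blast
  have hk: "h * k = k * h" by (rule k(3)) (simp add: x_def mult.assoc)
  define g where "g = sqrt r *\<^sub>R k"
  have g: "g\<dagger> = g" "g * g = r *\<^sub>R 1 - h * h" "g * h = h * g"
    using \<open>r > 0\<close> by (simp_all add: g_def star_scaleR k(1,2) hk x_def algebra_simps)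
  have "(norm g)\<^sup>2 \<le> r"
    by (rule norm_le_of_sum_of_squares[OF g(1) sa g(3)]) (use \<open>r > 0\<close> in \<open>simp_all add: g(2)\<close>)
  then show ?thesis using norm_self_adjoint_square[OF g(1)] g(2) by simp
qed

lemma psd_square: "h\<dagger> = h \<Longrightarrow> psd (h * h)"
  using norm_diff_square_le[of h "(norm h)\<^sup>2"] by (auto simp: psd_def star_mult)

text \<open>Replaces the unspecified \<open>t\<close> in \<open>psd\<close> by any bound of the
  norm: being a square of a self-adjoint element, \<open>a\<close> falls under
  \<open>norm_diff_square_le\<close>.\<close>

lemma psd_norm_diff_le:
  assumes "psd a" "norm a \<le> r"
  shows "norm (r *\<^sub>R 1 - a) \<le> r"
proof -
  obtain h where h: "h\<dagger> = h" "h * h = a" using psd_sqrt[OF assms(1)] by metis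
  then show ?thesis
    using norm_diff_square_le[OF h(1), of r] assms(2) norm_self_adjoint_square[OF h(1)] by simp
qed

text \<open>Certificates add by the triangle inequality; this is the gain of encoding positivity by
  a norm bound rather than by squares.\<close>

lemma psd_add:
  assumes "psd a" "psd b"
  shows "psd (a + b)"
proof -
  obtain s t where s: "norm (s *\<^sub>R 1 - a) \<le> s" and t: "norm (t *\<^sub>R 1 - b) \<le> t"
    using assms by (auto simp: psd_def)
  have "(s *\<^sub>R 1 - a) + (t *\<^sub>R 1 - b) = (s + t) *\<^sub>R 1 - (a + b)" by (simp add: algebra_simps)
  then have "norm ((s + t) *\<^sub>R 1 - (a + b)) \<le> s + t"
    using norm_triangle_ineq[of "s *\<^sub>R 1 - a" "t *\<^sub>R 1 - b"] s t by (smt (verit))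
  then show ?thesis using assms by (auto simp: psd_def star_add)
qed

lemma psd_zero: "psd 0"
  by (auto simp: psd_def intro: exI[of _ 0])

lemma psd_scaleR:
  assumes "psd a" "r \<ge> 0"
  shows "psd (r *\<^sub>R a)"
proof -
  obtain h where "h\<dagger> = h" "h * h = a" using psd_sqrt[OF assms(1)] by metis
  then show ?thesis using psd_square[of "sqrt r *\<^sub>R h"] assms(2) by (simp add: star_scaleR)
qed

lemma psd_shift:
  assumes "x\<dagger> = x" "norm x \<le> t"
  shows "psd (t *\<^sub>R 1 + x)"
  unfolding psd_def using assms by (auto simp: star_add star_scaleR intro!: exI[of _ t])

text \<open>With \<open>t = norm a\<close> the certificate becomes an inequality between continuous
  functions of \<open>a\<close>, so it survives limits.\<close>

lemma closed_psd: "closed {a :: 'a::{cstar_algebra, real_normed_algebra_1}. psd a}"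
  unfolding closed_sequential_limits
proof (intro allI impI)
  fix f and l :: 'a
  assume "(\<forall>n. f n \<in> {a. psd a}) \<and> f \<longlonglongrightarrow> l"
  then have f: "\<And>n. f n \<in> {a. psd a}" "f \<longlonglongrightarrow> l" by auto
  have "(\<lambda>n. (f n)\<dagger>) \<longlonglongrightarrow> l\<dagger>" by (rule bounded_linear.tendsto[OF bounded_linear_star f(2)])
  then have "l\<dagger> = l" using f LIMSEQ_unique by (fastforce simp: psd_def)
  moreover have "norm (norm l *\<^sub>R 1 - l) \<le> norm l"
  proof (rule LIMSEQ_le)
    show "(\<lambda>n. norm (norm (f n) *\<^sub>R 1 - f n)) \<longlonglongrightarrow> norm (norm l *\<^sub>R 1 - l)"
      by (intro tendsto_intros f)
    show "(\<lambda>n. norm (f n)) \<longlonglongrightarrow> norm l" by (intro tendsto_intros f)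
    show "\<exists>N. \<forall>n\<ge>N. norm (norm (f n) *\<^sub>R 1 - f n) \<le> norm (f n)"
      using f(1) psd_norm_diff_le by auto
  qed
  ultimately show "l \<in> {a. psd a}" by (auto simp: psd_def)
qed

text \<open>The roots of \<open>a\<close> and of \<open>- a\<close> commute, and their squares add
  up to 0.\<close>

lemma psd_uminus_eq_0:
  assumes "psd a" "psd (- a)"
  shows "a = 0"
proof -
  obtain h where h: "h\<dagger> = h" "h * h = a" "\<And>w. w * a = a * w \<Longrightarrow> w * h = h * w"
    using psd_sqrt[OF assms(1)] by metis
  obtain k where k: "k\<dagger> = k" "k * k = - a" "\<And>w. w * (- a) = (- a) * w \<Longrightarrow> w * k = k * w"
    using psd_sqrt[OF assms(2)] by metis
  have "h * k = k * h" by (rule k(3)) (simp add: h(2)[symmetric] mult.assoc)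
  then have "h = 0"
    by (intro commuting_squares_sum_eq_0[of h k]) (simp_all only: h(1,2) k(1,2) add.right_inverse)
  then show ?thesis using h(2) by simp
qed

text \<open>Quadratic growth in \<open>n\<close>, to be set against a linear upper bound for the
  norms of powers.\<close>

lemma one_plus_power_ge: "d \<ge> 0 \<Longrightarrow> (real n * d)\<^sup>2 \<le> (1 + d) ^ (2 * n)"
proof -
  assume "d \<ge> 0"
  then have "real n * d \<le> (1 + d) ^ n" using Bernoulli_inequality[of d n] by (smt (verit))
  then have "(real n * d)\<^sup>2 \<le> ((1 + d) ^ n)\<^sup>2" using \<open>d \<ge> 0\<close> by (intro power_mono) auto
  then show ?thesis by (simp add: power_mult[symmetric] mult.commute)
qed

text \<open>The C*-identity iterated along repeated squaring: on exponents \<open>2 ^ k\<close> the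
  norm alone governs the growth of powers.\<close>

lemma norm_self_adjoint_power:
  fixes X :: "'a::{cstar_algebra, real_normed_algebra_1}"
  assumes "X\<dagger> = X"
  shows "norm (X ^ 2 ^ k) = norm X ^ 2 ^ k"
proof (induction k)
  case (Suc k)
  have "(X ^ n)\<dagger> = X ^ n" for n
    by (induction n) (simp_all add: star_mult assms power_commutes)
  then have "norm (X ^ 2 ^ k * X ^ 2 ^ k) = (norm (X ^ 2 ^ k))\<^sup>2"
    by (rule norm_self_adjoint_square)
  then show ?case
    by (simp add: Suc.IH power_add[symmetric] power_mult[symmetric] mult_2[symmetric] mult.commute)
qed simp

lemma mult_power_intertwine:
  fixes y :: "'a::monoid_mult"
  assumes "y * X = Z * y"
  shows "y * X ^ n = Z ^ n * y"
proof (induction n)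
  case (Suc n)
  have "y * X ^ Suc n = (y * X) * X ^ n" by (simp add: mult.assoc)
  also have "\<dots> = Z * (Z ^ n * y)" by (simp add: assms Suc.IH[symmetric] mult.assoc)
  finally show ?case by (simp add: mult.assoc)
qed simp

text \<open>With \<open>B = y y\<dagger>\<close>, \<open>C = - y\<dagger> y\<close> and \<open>X = 1 + s B\<close>, one has \<open>y\<dagger> X\<^sup>n = (1 - s C)\<^sup>n y\<dagger>\<close>, which is bounded
  in \<open>n\<close>.  Hence the increments \<open>s B X\<^sup>n\<close> of \<open>X\<^sup>n\<close> are bounded, so the norm of \<open>X\<^sup>n\<close> grows at most
  linearly, forcing \<open>norm X \<le> 1\<close>.\<close>

lemma neg_star_mult_self_psd_imp_0:
  fixes y :: "'a::{cstar_algebra, real_normed_algebra_1}"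
  assumes C: "psd (- (y\<dagger> * y))"
  shows "y = 0"
proof (rule ccontr)
  assume "y \<noteq> 0"
  define B where "B = y * y\<dagger>"
  \<comment> \<open>Normalized so that \<open>Z\<close> is a contraction and
    \<open>s *\<^sub>R (B * X ^ n)\<close> has norm at most 1.\<close>
  define s where "s = 1 / (norm y)\<^sup>2"
  define X where "X = 1 + s *\<^sub>R B"
  define Z where "Z = 1 + s *\<^sub>R (y\<dagger> * y)"
  have s: "s > 0" using \<open>y \<noteq> 0\<close> by (simp add: s_def)
  \<comment> \<open>With \<open>h\<close> the real part of \<open>y\<close> and \<open>k\<close> its
    imaginary part up to sign, \<open>y * y\<dagger> + y\<dagger> * y\<close> equals
    \<open>2 (h * h + k * k)\<close>. So \<open>B\<close> is a sum of squares plus the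
    hypothesis.\<close>
  have B: "psd B"
  proof -
    define h where "h = (1/2) *\<^sub>R (y + y\<dagger>)"
    define k where "k = (1/2) *\<^sub>R (\<i> *\<^sub>C (y - y\<dagger>))"
    have hk: "h\<dagger> = h" "k\<dagger> = k"
      by (simp_all add: h_def k_def star_scaleR star_add star_diff star_scaleC star_star add.commute
          scaleC_minus_left_cstar scaleC_diff_right)
    have hh: "h * h = (1/4) *\<^sub>R (y * y + y * y\<dagger> + y\<dagger> * y + y\<dagger> * y\<dagger>)"
      by (simp add: h_def algebra_simps)
    have "(\<i> *\<^sub>C (y - y\<dagger>)) * (\<i> *\<^sub>C (y - y\<dagger>)) = - ((y - y\<dagger>) * (y - y\<dagger>))"
      by (simp only: mult_scaleC_left mult_scaleC_right scaleC_i_i)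
    then have kk: "k * k = (1/4) *\<^sub>R (- (y * y) + y * y\<dagger> + y\<dagger> * y - y\<dagger> * y\<dagger>)"
      by (simp add: k_def) (simp add: algebra_simps)
    have "B = 2 *\<^sub>R (h * h + k * k) + - (y\<dagger> * y)"
      unfolding hh kk B_def by (simp add: algebra_simps scaleR_2[symmetric])
    moreover have "psd (2 *\<^sub>R (h * h + k * k))" by (simp add: psd_add psd_scaleR psd_square hk)
    ultimately show ?thesis using psd_add[OF _ C] by metis
  qed
  have "norm (s *\<^sub>R ((norm y)\<^sup>2 *\<^sub>R 1 - - (y\<dagger> * y))) \<le> s * (norm y)\<^sup>2"
    using psd_norm_diff_le[OF C, of "(norm y)\<^sup>2"] s by (simp add: cstar_identity)
  then have Z: "norm Z \<le> 1" using \<open>y \<noteq> 0\<close> by (simp add: Z_def s_def scaleR_add_right)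
  have "y\<dagger> * X = Z * y\<dagger>" by (simp add: X_def Z_def B_def algebra_simps)
  then have yX: "y\<dagger> * X ^ n = Z ^ n * y\<dagger>" for n by (rule mult_power_intertwine)
  have BX: "norm (s *\<^sub>R (B * X ^ n)) \<le> 1" for n
  proof -
    have "norm (Z ^ n) \<le> 1"
      using Z norm_power_ineq[of Z n] power_le_one[of "norm Z" n] by simp
    have "B * X ^ n = y * (Z ^ n * y\<dagger>)" by (simp add: B_def mult.assoc yX)
    then have "norm (B * X ^ n) \<le> norm y * (norm (Z ^ n) * norm (y\<dagger>))"
      by (auto intro!: order_trans[OF norm_mult_ineq] mult_left_mono norm_mult_ineq)
    also have "\<dots> \<le> norm y * (1 * norm y)"
      using \<open>norm (Z ^ n) \<le> 1\<close> by (intro mult_left_mono mult_mono) simp_all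
    finally show ?thesis using s \<open>y \<noteq> 0\<close> by (simp add: s_def field_simps power2_eq_square)
  qed
  have Xn: "norm (X ^ n) \<le> 1 + real n" for n
  proof (induction n)
    case (Suc n)
    have "X ^ Suc n = X ^ n + s *\<^sub>R (B * X ^ n)" by (simp add: X_def algebra_simps)
    then show ?case using BX[of n] Suc norm_triangle_ineq[of "X ^ n" "s *\<^sub>R (B * X ^ n)"] by simp
  qed simp
  have Xsa: "X\<dagger> = X" by (simp add: X_def B_def star_add star_scaleR star_mult star_star)
  have "norm X \<le> 1"
  proof (rule ccontr)
    assume "\<not> norm X \<le> 1"
    define d where "d = norm X - 1"
    with \<open>\<not> norm X \<le> 1\<close> have "d > 0" by simp
    \<comment> \<open>For \<open>n = 2 ^ k\<close> the bounds give \<open>n\<^sup>2 d\<^sup>2 \<le>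
      (1 + d) ^ (2 n) \<le> 1 + 2 n \<le> 3 n\<close>, hence \<open>n \<le> 3 / d\<^sup>2\<close>,
      which this choice contradicts. A power of two is taken so that
      \<open>norm_self_adjoint_power\<close> applies.\<close>
    obtain k where k: "3 / d\<^sup>2 < 2 ^ k" using real_arch_pow[of 2 "3 / d\<^sup>2"] by auto
    define n where "n = (2::nat) ^ k"
    have "(real n * d)\<^sup>2 \<le> (1 + d) ^ (2 * n)" using \<open>d > 0\<close> by (intro one_plus_power_ge) simp
    also have "\<dots> = norm (X ^ 2 ^ Suc k)"
      using norm_self_adjoint_power[OF Xsa, of "Suc k"] by (simp add: d_def n_def)
    also have "\<dots> \<le> 1 + real (2 * n)" using Xn[of "2 ^ Suc k"] by (simp add: n_def)
    also have "\<dots> \<le> 3 * real n" by (simp add: n_def)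
    finally have "real n * d\<^sup>2 \<le> 3" by (simp add: power2_eq_square n_def mult_ac)
    then show False using k \<open>d > 0\<close> by (simp add: n_def field_simps)
  qed
  \<comment> \<open>\<open>X\<close> is \<open>1 - (- s B)\<close>, so \<open>norm X \<le> 1\<close>
    is the certificate of \<open>- s B\<close> with \<open>t = 1\<close>.\<close>
  then have "psd (- (s *\<^sub>R B))"
    using Xsa by (auto simp: psd_def X_def star_add star_minus intro!: exI[of _ 1])
  moreover have "psd (s *\<^sub>R B)" using B s by (simp add: psd_scaleR)
  ultimately have "s *\<^sub>R B = 0" by (intro psd_uminus_eq_0)
  then have "y * y\<dagger> = 0" using s by (simp add: B_def)
  then have "y\<dagger> = 0" using star_mult_self_eq_0_iff[of "y\<dagger>"] by (simp add: star_star)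
  then have "norm y = 0" using norm_star[of y] by simp
  then show False using \<open>y \<noteq> 0\<close> by simp
qed

text \<open>With \<open>c = \<bar>a\<bar> - a\<close>, twice the negative part of \<open>a = x\<dagger> x\<close>, one has \<open>- (x c)\<dagger> (x c) = c\<^sup>3 / 2 \<ge> 0\<close>.\<close>

lemma psd_star_mult_self:
  fixes x :: "'a::{cstar_algebra, real_normed_algebra_1}"
  shows "psd (x\<dagger> * x)"
proof -
  define a where "a = x\<dagger> * x"
  have asa: "a\<dagger> = a" by (simp add: a_def star_mult star_star)
  \<comment> \<open>\<open>b\<close> plays the part of the absolute value of \<open>a\<close>. Its
    root \<open>g\<close> below turns \<open>c * (b * c)\<close> into the square of the self-adjoint
    element \<open>g * c\<close>.\<close>
  obtain b where b: "b\<dagger> = b" "psd b" "b * b = a * a" "\<And>w. w * (a * a) = (a * a) * w \<Longrightarrow> w * b = b * w"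
    using psd_sqrt[OF psd_square[OF asa]] by metis
  have ab: "a * b = b * a" by (rule b(4)) (simp add: mult.assoc)
  obtain g where g: "g\<dagger> = g" "g * g = b" "\<And>w. w * b = b * w \<Longrightarrow> w * g = g * w"
    using psd_sqrt[OF b(2)] by metis
  have ag: "a * g = g * a" by (rule g(3)) (rule ab)
  have bg: "b * g = g * b" by (simp add: g(2)[symmetric] mult.assoc)
  define c where "c = b - a"
  have csa: "c\<dagger> = c" by (simp add: c_def star_diff asa b)
  have gc: "g * c = c * g" by (simp add: c_def algebra_simps ag bg)
  have cc: "c * c = 2 *\<^sub>R (b * c)"
    by (simp add: c_def algebra_simps ab b(3) scaleR_2)
  have ac: "a * c = - (1/2) *\<^sub>R (c * c)"
  proof -
    have "2 *\<^sub>R (a * c) + c * c = 0" by (simp add: c_def algebra_simps ab b(3) scaleR_2)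
    then have "c * c = - (2 *\<^sub>R (a * c))" by (simp add: eq_neg_iff_add_eq_0 add.commute)
    then show ?thesis by simp
  qed
  have "- ((x * c)\<dagger> * (x * c)) = - (c * (a * c))"
    by (simp add: a_def star_mult csa mult.assoc)
  also have "\<dots> = (1/2) *\<^sub>R (c * (c * c))" unfolding ac by simp
  also have "c * (c * c) = 2 *\<^sub>R ((g * c) * (g * c))"
  proof -
    have "c * (b * c) = (g * c) * (g * c)"
      by (simp add: g(2)[symmetric] mult.assoc gc)
    then show ?thesis unfolding cc by simp
  qed
  finally have eq: "- ((x * c)\<dagger> * (x * c)) = (g * c) * (g * c)" by simp
  have "psd ((g * c) * (g * c))" by (rule psd_square) (simp add: star_mult csa g gc)
  then have "x * c = 0" unfolding eq[symmetric] by (rule neg_star_mult_self_psd_imp_0)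
  then have "a * c = 0" by (simp add: a_def mult.assoc)
  then have "c\<dagger> * c = 0" using ac by (simp add: csa)
  then have "c = 0" using star_mult_self_eq_0_iff by blast
  then show ?thesis using b(2) by (simp add: c_def a_def)
qed

section \<open>The positive cone, described through the unitization\<close>

lemma pos_cone_iff_psd: "a \<in> pos_cone \<longleftrightarrow> psd (embed a)"
proof
  assume "a \<in> pos_cone"
  then obtain b where "a = b\<dagger> * b" by (auto simp: pos_cone_def)
  then show "psd (embed a)" using psd_star_mult_self[of "embed b"] by (simp add: embed_simps)
next
  assume "psd (embed a)"
  then obtain h where h: "h\<dagger> = h" "h * h = embed a" using psd_sqrt by metis
  \<comment> \<open>The root is only known to lie in the unitization; its scalar part squares to
    that of \<open>embed a\<close>, which is 0, so it comes from the algebra.\<close>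
  have "scal h * scal h = 0" using h(2) by (metis unitization.sel(2) unitization_simps(12))
  then have "h = embed (alg h)" by (simp add: unitization_eqI)
  then have "embed ((alg h)\<dagger> * alg h) = embed a" using h by (simp add: embed_simps)
  then show "a \<in> pos_cone" unfolding pos_cone_def by blast
qed

lemma pos_cone_add: "a \<in> pos_cone \<Longrightarrow> b \<in> pos_cone \<Longrightarrow> a + b \<in> pos_cone"
  by (simp add: pos_cone_iff_psd embed_simps psd_add)

lemma pos_cone_scaleR: "a \<in> pos_cone \<Longrightarrow> r \<ge> 0 \<Longrightarrow> r *\<^sub>R a \<in> pos_cone"
  by (simp add: pos_cone_iff_psd embed_simps psd_scaleR)

lemma pos_cone_zero [simp]: "0 \<in> pos_cone"
  by (simp add: pos_cone_iff_psd embed_simps psd_zero)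

lemma pos_cone_sum: "(\<And>i. i \<in> I \<Longrightarrow> f i \<in> pos_cone) \<Longrightarrow> sum f I \<in> pos_cone"
  by (induction I rule: infinite_finite_induct) (auto simp: pos_cone_add)

lemma star_mult_self_in_pos_cone [simp]:
  fixes b :: "'a::cstar_algebra"
  shows "b\<dagger> * b \<in> pos_cone" "b * b\<dagger> \<in> pos_cone"
proof -
  show "b\<dagger> * b \<in> pos_cone" for b :: 'a by (auto simp: pos_cone_def)
  from this[of "b\<dagger>"] show "b * b\<dagger> \<in> pos_cone" by (simp add: star_star)
qed

lemma pos_cone_pointed: "a \<in> pos_cone \<Longrightarrow> - a \<in> pos_cone \<Longrightarrow> a = 0"
proof -
  assume "a \<in> pos_cone" "- a \<in> pos_cone"
  then have "embed a = 0" by (intro psd_uminus_eq_0) (simp_all add: pos_cone_iff_psd embed_simps(3))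
  then have "alg (embed a) = alg 0" by (rule arg_cong)
  then show "a = 0" by simp
qed

lemma closed_pos_cone: "closed (pos_cone :: 'a::cstar_algebra set)"
proof -
  have "bounded_linear (embed :: 'a \<Rightarrow> 'a unitization)"
    by (rule bounded_linear_intro[where K = 1]) (simp_all add: embed_simps)
  then have "closed (embed -` {a :: 'a unitization. psd a})"
    by (intro closed_vimage closed_psd linear_continuous_on)
  then show ?thesis by (simp add: vimage_def pos_cone_iff_psd[symmetric])
qed

lemma convex_pos_cone: "convex (pos_cone :: 'a::cstar_algebra set)"
  by (auto simp: convex_def pos_cone_add pos_cone_scaleR)

text \<open>This is the positive element \<open>t + x\<close> of the unitization conjugated by
  \<open>c\<close>; a root \<open>g\<close> of it exhibits the result as the square of
  \<open>g * c\<close>. It supplies the order estimates for compressions.\<close>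

lemma pos_cone_conjugate_shift:
  assumes "x\<dagger> = x" "norm x \<le> t"
  shows "t *\<^sub>R (c\<dagger> * c) + c\<dagger> * x * c \<in> pos_cone"
proof -
  obtain g where g: "g\<dagger> = g" "g * g = t *\<^sub>R 1 + embed x"
    using psd_sqrt[OF psd_shift[of "embed x" t]] assms by (metis embed_simps(7) norm_embed)
  have "embed (t *\<^sub>R (c\<dagger> * c) + c\<dagger> * x * c) = (embed c)\<dagger> * (g * g) * embed c"
    unfolding g(2) by (simp add: embed_simps algebra_simps)
  also have "\<dots> = (g * embed c)\<dagger> * (g * embed c)" by (simp add: star_mult g(1) mult.assoc)
  finally show ?thesis by (simp add: pos_cone_iff_psd psd_star_mult_self)
qed

text \<open>The other summands add up to \<open>- f j\<close>, and the cone is pointed. Applied to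
  sums of \<open>b\<dagger> * b\<close>, it forces each \<open>b\<close> to vanish.\<close>

lemma sum_pos_cone_eq_0:
  assumes "finite I" "\<And>i. i \<in> I \<Longrightarrow> f i \<in> pos_cone" "sum f I = 0" "j \<in> I"
  shows "f j = 0"
proof (rule pos_cone_pointed)
  have "sum f (I - {j}) + f j = 0" using assms by (simp add: sum.remove add.commute)
  then have "- f j = sum f (I - {j})" by (simp add: eq_neg_iff_add_eq_0 neg_eq_iff_add_eq_0 add.commute)
  then show "- f j \<in> pos_cone" using assms by (auto intro: pos_cone_sum)
qed (rule assms(2)[OF assms(4)])

section \<open>Homomorphisms and the universal property\<close>

abbreviation univ_hom :: "('a::cstar_algebra \<Rightarrow> 'b::cstar_algebra) \<Rightarrow> bool" where
  "univ_hom \<equiv> star_hom univ_cstar univ_cstar"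

lemma star_hom_univD:
  assumes "univ_hom \<phi>"
  shows "\<phi> (x + y) = \<phi> x + \<phi> y" "\<phi> (x * y) = \<phi> x * \<phi> y" "\<phi> (c *\<^sub>C x) = c *\<^sub>C \<phi> x" "\<phi> (x\<dagger>) = (\<phi> x)\<dagger>"
  using assms by (simp_all add: star_hom_def)

lemma star_hom_univ_scaleR: "univ_hom \<phi> \<Longrightarrow> \<phi> (r *\<^sub>R x) = r *\<^sub>R \<phi> x"
  by (simp add: scaleR_scaleC star_hom_univD)

text \<open>For self-adjoint \<open>a\<close> of norm at most 1, \<open>1 - a * a\<close> has a root
  \<open>1 - y\<close> with \<open>y\<close> in the algebra itself, so the homomorphism can be
  applied to \<open>y\<close>. In the unitization of the target the images satisfy
  \<open>h * h + k * k = 1\<close>, which bounds \<open>h\<close>. Rescaling and the C*-identity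
  give the general case.\<close>

lemma star_hom_norm_le:
  fixes \<phi> :: "'a::cstar_algebra \<Rightarrow> 'b::cstar_algebra"
  assumes \<phi>: "univ_hom \<phi>"
  shows "norm (\<phi> x) \<le> norm x"
proof -
  note hom = star_hom_univD[OF \<phi>] star_hom_univ_scaleR[OF \<phi>]
  have unit: "norm (\<phi> a) \<le> 1" if sa: "a\<dagger> = a" and na: "norm a \<le> 1" for a
  proof -
    have "norm (a * a) \<le> 1" using na by (simp add: norm_self_adjoint_square[OF sa] power_le_one)
    then obtain y where y: "2 *\<^sub>R y = a * a + y * y" "(a * a)\<dagger> = a * a \<Longrightarrow> y\<dagger> = y"
      "\<And>w. w * (a * a) = (a * a) * w \<Longrightarrow> w * y = y * w"
      using sqrt_one_minus_exists by metis
    have ysa: "y\<dagger> = y" by (rule y(2)) (simp add: star_mult sa)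
    have ay: "a * y = y * a" by (rule y(3)) (simp add: mult.assoc)
    define h where "h = embed (\<phi> a)"
    define k where "k = 1 - embed (\<phi> y)"
    have hy: "2 *\<^sub>R embed (\<phi> y) = h * h + embed (\<phi> y) * embed (\<phi> y)"
      using arg_cong[OF y(1), of "\<lambda>u. embed (\<phi> u)"] by (simp add: hom embed_simps h_def)
    have "(norm h)\<^sup>2 \<le> 1"
    proof (rule norm_le_of_sum_of_squares[where k = k])
      show "h\<dagger> = h" "k\<dagger> = k"
        by (simp_all add: h_def k_def star_diff embed_simps(7)[symmetric] hom(4)[symmetric] sa ysa)
      have "embed (\<phi> a) * embed (\<phi> y) = embed (\<phi> y) * embed (\<phi> a)"
        unfolding embed_simps(4)[symmetric] hom(2)[symmetric] ay ..
      then show "h * k = k * h" by (simp add: h_def k_def algebra_simps)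
      have "k * k = 1 - 2 *\<^sub>R embed (\<phi> y) + embed (\<phi> y) * embed (\<phi> y)"
        by (simp add: k_def algebra_simps scaleR_2)
      then show "h * h + k * k = 1 *\<^sub>R 1" unfolding hy by simp
    qed simp
    then have "norm h \<le> 1" by (simp add: power2_le_iff_abs_le power_le_one_iff)
    then show ?thesis by (simp add: h_def)
  qed
  have sa: "norm (\<phi> a) \<le> norm a" if "a\<dagger> = a" for a
  proof (cases "a = 0")
    case True
    then show ?thesis using hom(5)[of 0 0] by simp
  next
    case False
    have "norm (\<phi> ((1 / norm a) *\<^sub>R a)) \<le> 1"
      using False that by (intro unit) (simp_all add: star_scaleR)
    then show ?thesis using False by (simp add: hom field_simps)
  qed
  have "(norm (\<phi> x))\<^sup>2 = norm (\<phi> (x\<dagger> * x))" by (simp add: hom cstar_identity)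
  also have "\<dots> \<le> norm (x\<dagger> * x)" by (rule sa) (simp add: star_mult star_star)
  also have "\<dots> = (norm x)\<^sup>2" by (rule cstar_identity)
  finally show ?thesis using power2_le_imp_le by fastforce
qed

lemma bounded_linear_star_hom:
  assumes "univ_hom \<phi>"
  shows "bounded_linear \<phi>"
  using star_hom_norm_le[OF assms]
  by (intro bounded_linear_intro[where K = 1])
    (simp_all add: star_hom_univD[OF assms] star_hom_univ_scaleR[OF assms])

lemma star_hom_pos_cone:
  assumes "univ_hom \<phi>" "a \<in> pos_cone"
  shows "\<phi> a \<in> pos_cone"
  using assms by (auto simp: pos_cone_def star_hom_univD)

lemma scaleC_subspace_iff:
  "module.subspace scaleC C \<longleftrightarrow> (0 :: 'a::cstar_algebra) \<in> C \<and>
    (\<forall>x\<in>C. \<forall>y\<in>C. x + y \<in> C) \<and> (\<forall>c. \<forall>x\<in>C. c *\<^sub>C x \<in> C)"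
proof -
  interpret vector_space "scaleC :: complex \<Rightarrow> 'a \<Rightarrow> 'a" by (rule vector_space_scaleC)
  show ?thesis by (auto simp: subspace_def)
qed

lemma cstar_generated_induct:
  assumes "cstar_generated X = UNIV"
    and "\<And>x. x \<in> X \<Longrightarrow> P x" "P 0" "\<And>x y. P x \<Longrightarrow> P y \<Longrightarrow> P (x + y)" "\<And>c x. P x \<Longrightarrow> P (c *\<^sub>C x)"
    "\<And>x y. P x \<Longrightarrow> P y \<Longrightarrow> P (x * y)" "\<And>x. P x \<Longrightarrow> P (x\<dagger>)"
    "\<And>f l. (\<And>n. P (f n)) \<Longrightarrow> f \<longlonglongrightarrow> l \<Longrightarrow> P l"
  shows "P (a :: 'a::cstar_algebra)"
proof -
  have "closed (Collect P)"
    unfolding closed_sequential_limits using assms(8) by blast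
  then have "cstar_subalgebra (Collect P)"
    using assms(3-7) by (auto simp: cstar_subalgebra_def scaleC_subspace_iff)
  moreover have "X \<subseteq> Collect P" using assms(2) by auto
  ultimately have "cstar_generated X \<subseteq> Collect P" unfolding cstar_generated_def by blast
  then show ?thesis using assms(1) by auto
qed

text \<open>The universal property speaks only of structures on one fixed type. A C*-algebra of
  another type enters as its copy on the range of an injection.\<close>

definition transport_cstar :: "('c::cstar_algebra \<Rightarrow> 'd) \<Rightarrow> 'd cstar_struct" where
  "transport_cstar \<iota> = \<lparr>carrier = range \<iota>, mult = \<lambda>x y. \<iota> (inv_into UNIV \<iota> x * inv_into UNIV \<iota> y),
     one = undefined, zero = \<iota> 0, add = \<lambda>x y. \<iota> (inv_into UNIV \<iota> x + inv_into UNIV \<iota> y),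
     smul = \<lambda>c x. \<iota> (c *\<^sub>C inv_into UNIV \<iota> x),
     adj = \<lambda>x. \<iota> ((inv_into UNIV \<iota> x)\<dagger>), nrm = \<lambda>x. norm (inv_into UNIV \<iota> x)\<rparr>"

context
  fixes \<iota> :: "'c::cstar_algebra \<Rightarrow> 'd"
  assumes inj: "inj \<iota>"
begin

lemma transport_simps:
  "carrier (transport_cstar \<iota>) = range \<iota>"
  "\<iota> a \<otimes>\<^bsub>transport_cstar \<iota>\<^esub> \<iota> b = \<iota> (a * b)" "\<zero>\<^bsub>transport_cstar \<iota>\<^esub> = \<iota> 0"
  "\<iota> a \<oplus>\<^bsub>transport_cstar \<iota>\<^esub> \<iota> b = \<iota> (a + b)" "smul (transport_cstar \<iota>) c (\<iota> a) = \<iota> (c *\<^sub>C a)"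
  "adj (transport_cstar \<iota>) (\<iota> a) = \<iota> (a\<dagger>)" "nrm (transport_cstar \<iota>) (\<iota> a) = norm a"
  by (simp_all add: transport_cstar_def inv_f_f[OF inj])

lemma abelian_group_transport: "abelian_group (transport_cstar \<iota>)"
  by (rule abelian_groupI) (auto simp: transport_simps add_ac inj_eq[OF inj]
      intro: exI[of _ "- x" for x])

lemma a_minus_transport: "\<iota> a \<ominus>\<^bsub>transport_cstar \<iota>\<^esub> \<iota> b = \<iota> (a - b)"
proof -
  interpret abelian_group "transport_cstar \<iota>" by (rule abelian_group_transport)
  have "\<ominus>\<^bsub>transport_cstar \<iota>\<^esub> \<iota> b = \<iota> (- b)"
    by (rule minus_equality) (auto simp: transport_simps)
  then show ?thesis by (simp add: a_minus_def transport_simps)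
qed

lemma finsum_transport: "finsum (transport_cstar \<iota>) (\<lambda>i. \<iota> (f i)) I = \<iota> (sum f I)"
proof -
  interpret abelian_group "transport_cstar \<iota>" by (rule abelian_group_transport)
  show ?thesis
    by (induction I rule: infinite_finite_induct) (auto simp: transport_simps)
qed

lemma cstar_algebra_on_transport: "cstar_algebra_on (transport_cstar \<iota>)"
proof (intro cstar_algebra_on.intro abelian_group_transport cstar_algebra_on_axioms.intro)
  fix f :: "nat \<Rightarrow> 'd"
  assume f: "\<And>n. f n \<in> carrier (transport_cstar \<iota>)"
    and cau: "\<And>\<epsilon>. \<epsilon> > 0 \<Longrightarrow> \<exists>N. \<forall>m\<ge>N. \<forall>n\<ge>N.
      nrm (transport_cstar \<iota>) (f m \<ominus>\<^bsub>transport_cstar \<iota>\<^esub> f n) < \<epsilon>"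
  define g where "g n = inv_into UNIV \<iota> (f n)" for n
  have fg: "f n = \<iota> (g n)" for n
    using f[of n] by (simp add: g_def transport_simps f_inv_into_f)
  have "Cauchy g"
    using cau by (simp add: fg a_minus_transport transport_simps Cauchy_def dist_norm)
  then obtain x where "g \<longlonglongrightarrow> x" using Cauchy_convergent convergent_def by blast
  then have "(\<lambda>n. nrm (transport_cstar \<iota>) (f n \<ominus>\<^bsub>transport_cstar \<iota>\<^esub> \<iota> x)) \<longlonglongrightarrow> 0"
    by (simp add: fg a_minus_transport transport_simps tendsto_norm_zero_iff LIM_zero_iff)
  then show "\<exists>x\<in>carrier (transport_cstar \<iota>).
      (\<lambda>n. nrm (transport_cstar \<iota>) (f n \<ominus>\<^bsub>transport_cstar \<iota>\<^esub> x)) \<longlonglongrightarrow> 0"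
    by (auto simp: transport_simps)
qed (auto simp: transport_simps mult.assoc distrib_left distrib_right scaleC_add_right
    scaleC_add_left scaleC_scaleC scaleC_one mult_scaleC_left mult_scaleC_right star_star star_add
    star_scaleC star_mult norm_scaleC norm_triangle_ineq norm_mult_ineq cstar_identity inj_eq[OF inj])

lemma CK_family_transport:
  assumes "CK_family E univ_cstar q T"
  shows "CK_family E (transport_cstar \<iota>) (\<lambda>v. \<iota> (q v)) (\<lambda>e. \<iota> (T e))"
  using assms by (auto simp: CK_family_def transport_simps inj_eq[OF inj] finsum_transport)

end

lemma graph_cstar_algebra_universal:
  fixes q :: "'v \<Rightarrow> 'c::cstar_algebra" and p :: "'v \<Rightarrow> 'a::cstar_algebra"
  assumes G: "graph_cstar_algebra E p S" and CK: "CK_family E univ_cstar q T"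
    and inj: "inj (\<iota> :: 'c \<Rightarrow> 'a + (nat \<Rightarrow> nat \<Rightarrow> complex))"
  obtains \<phi> where "univ_hom \<phi>" "\<And>v. v \<in> verts E \<Longrightarrow> \<phi> (p v) = q v"
    "\<And>e. e \<in> arcs E \<Longrightarrow> \<phi> (S e) = T e"
proof -
  obtain \<psi> where \<psi>: "star_hom univ_cstar (transport_cstar \<iota>) \<psi>"
    and gen: "\<And>v. v \<in> verts E \<Longrightarrow> \<psi> (p v) = \<iota> (q v)" "\<And>e. e \<in> arcs E \<Longrightarrow> \<psi> (S e) = \<iota> (T e)"
    using G[unfolded graph_cstar_algebra_def, THEN conjunct2, THEN conjunct2, rule_format,
        OF conjI[OF cstar_algebra_on_transport[OF inj] CK_family_transport[OF inj CK]]]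
    by blast
  define \<phi> where "\<phi> = inv_into UNIV \<iota> \<circ> \<psi>"
  have \<psi>\<phi>: "\<psi> x = \<iota> (\<phi> x)" for x
    using \<psi> by (simp add: \<phi>_def star_hom_def transport_simps[OF inj] f_inv_into_f)
  have "univ_hom \<phi>"
    using \<psi> unfolding star_hom_def
    by (simp add: \<psi>\<phi> transport_simps[OF inj] inj_eq[OF inj])
  then show thesis
    using gen by (intro that[of \<phi>]) (simp_all add: \<psi>\<phi> inj_eq[OF inj])
qed

lemma star_hom_eqI:
  assumes G: "graph_cstar_algebra E p S" and \<phi>: "univ_hom \<phi>"
    and \<psi>: "univ_hom \<psi>"
    and "\<And>v. v \<in> verts E \<Longrightarrow> \<phi> (p v) = \<psi> (p v)" "\<And>e. e \<in> arcs E \<Longrightarrow> \<phi> (S e) = \<psi> (S e)"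
  shows "\<phi> = \<psi>"
proof
  fix a
  have gen: "cstar_generated (p ` verts E \<union> S ` arcs E) = UNIV"
    using G by (simp add: graph_cstar_algebra_def)
  show "\<phi> a = \<psi> a"
  proof (rule cstar_generated_induct[OF gen, of "\<lambda>x. \<phi> x = \<psi> x"])
    show "\<phi> 0 = \<psi> 0" using star_hom_univ_scaleR[OF \<phi>, of 0 0] star_hom_univ_scaleR[OF \<psi>, of 0 0] by simp
    fix f l assume f: "\<And>n. \<phi> (f n) = \<psi> (f n)" and lim: "f \<longlonglongrightarrow> l"
    have "(\<lambda>n. \<phi> (f n)) \<longlonglongrightarrow> \<phi> l" "(\<lambda>n. \<psi> (f n)) \<longlonglongrightarrow> \<psi> l"
      using bounded_linear_star_hom[OF \<phi>] bounded_linear_star_hom[OF \<psi>] lim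
      by (auto intro: bounded_linear.tendsto)
    then show "\<phi> l = \<psi> l" unfolding f by (rule LIMSEQ_unique)
  qed (use assms in \<open>auto simp: star_hom_univD[OF \<phi>] star_hom_univD[OF \<psi>]\<close>)
qed

section \<open>The gauge action\<close>

lemma CK_family_univ_iff:
  "CK_family E univ_cstar p (S :: 'e \<Rightarrow> 'a::cstar_algebra) \<longleftrightarrow>
     (\<forall>v\<in>verts E. p v * p v = p v \<and> (p v)\<dagger> = p v) \<and>
     (\<forall>v\<in>verts E. \<forall>w\<in>verts E. v \<noteq> w \<longrightarrow> p v * p w = 0) \<and>
     (\<forall>e\<in>arcs E. S e * (S e)\<dagger> * S e = S e) \<and>
     (\<forall>e\<in>arcs E. (S e)\<dagger> * S e = p (head E e)) \<and>
     (\<forall>v\<in>verts E. out_arcs E v \<noteq> {} \<longrightarrow> p v = (\<Sum>e\<in>out_arcs E v. S e * (S e)\<dagger>))"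
  by (simp add: CK_family_def)

text \<open>Since \<open>z\<close> has modulus 1 it cancels in
  \<open>S\<^sub>e\<dagger> S\<^sub>e\<close> and \<open>S\<^sub>e S\<^sub>e\<dagger>\<close>, so
  the rotated edges again form a Cuntz-Krieger family. Unique existence licenses the definite
  description in \<open>gauge_action\<close>.\<close>

lemma gauge_action_exists:
  fixes p :: "'v \<Rightarrow> 'a::cstar_algebra"
  assumes G: "graph_cstar_algebra E p S" and z: "cmod z = 1"
  shows "\<exists>!\<gamma>. univ_hom \<gamma> \<and>
     (\<forall>e\<in>arcs E. \<gamma> (S e) = z *\<^sub>C S e) \<and> (\<forall>v\<in>verts E. \<gamma> (p v) = p v)"
proof -
  have zz: "cnj z * z = 1" "z * cnj z = 1"
    using z by (simp_all add: complex_norm_square[symmetric] mult.commute)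
  have "CK_family E univ_cstar p S" using G by (simp add: graph_cstar_algebra_def)
  then have "CK_family E univ_cstar p (\<lambda>e. z *\<^sub>C S e)"
    by (simp add: CK_family_univ_iff star_scaleC mult_scaleC_left mult_scaleC_right scaleC_scaleC
        zz scaleC_one mult.assoc[symmetric])
  moreover have "inj (Inl :: 'a \<Rightarrow> 'a + (nat \<Rightarrow> nat \<Rightarrow> complex))" by simp
  ultimately obtain \<gamma> where "univ_hom \<gamma>" "\<And>v. v \<in> verts E \<Longrightarrow> \<gamma> (p v) = p v"
    "\<And>e. e \<in> arcs E \<Longrightarrow> \<gamma> (S e) = z *\<^sub>C S e"
    by (rule graph_cstar_algebra_universal[OF G]) blast
  then show ?thesis by (intro ex1I[of _ \<gamma>]) (auto intro!: star_hom_eqI[OF G])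
qed

lemma gauge_action:
  assumes "graph_cstar_algebra E p S" "cmod z = 1"
  shows "univ_hom (gauge_action E p S z)"
    "e \<in> arcs E \<Longrightarrow> gauge_action E p S z (S e) = z *\<^sub>C S e"
    "v \<in> verts E \<Longrightarrow> gauge_action E p S z (p v) = p v"
  using theI'[OF gauge_action_exists[OF assms]] unfolding gauge_action_def by blast+

text \<open>Edges move by a continuous scalar. The automorphisms are contractive, so a convergent
  sequence is moved uniformly in the angle, and continuity passes to limits.\<close>

lemma continuous_on_gauge_action:
  fixes p :: "'v \<Rightarrow> 'a::cstar_algebra"
  assumes G: "graph_cstar_algebra E p S"
  shows "continuous_on A (\<lambda>\<theta>. gauge_action E p S (cis \<theta>) a)"
proof -
  have gen: "cstar_generated (p ` verts E \<union> S ` arcs E) = UNIV"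
    using G by (simp add: graph_cstar_algebra_def)
  let ?\<gamma> = "\<lambda>\<theta>. gauge_action E p S (cis \<theta>)"
  have hom: "univ_hom (?\<gamma> \<theta>)" for \<theta> by (rule gauge_action(1)[OF G]) simp
  note hs = star_hom_univD[OF hom]
  show ?thesis
  proof (rule cstar_generated_induct[OF gen, of "\<lambda>a. continuous_on A (\<lambda>\<theta>. ?\<gamma> \<theta> a)"])
    fix x assume "x \<in> p ` verts E \<union> S ` arcs E"
    then show "continuous_on A (\<lambda>\<theta>. ?\<gamma> \<theta> x)"
    proof
      assume "x \<in> p ` verts E"
      then show ?thesis by (auto simp: gauge_action(3)[OF G])
    next
      assume "x \<in> S ` arcs E"
      moreover have "cis \<theta> *\<^sub>C y = cos \<theta> *\<^sub>R y + sin \<theta> *\<^sub>R \<i> *\<^sub>C y" for \<theta> and y :: 'a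
      proof -
        have "cis \<theta> = complex_of_real (cos \<theta>) + complex_of_real (sin \<theta>) * \<i>"
          by (simp add: complex_eq_iff)
        then show ?thesis by (simp only: scaleR_scaleC scaleC_scaleC scaleC_add_left)
      qed
      ultimately show ?thesis
        by (auto simp: gauge_action(2)[OF G] intro!: continuous_intros)
    qed
  next
    show "continuous_on A (\<lambda>\<theta>. ?\<gamma> \<theta> 0)"
      using linear_0[OF bounded_linear.linear[OF bounded_linear_star_hom[OF hom]]] by simp
  next
    fix f l assume f: "\<And>n. continuous_on A (\<lambda>\<theta>. ?\<gamma> \<theta> (f n))" and lim: "f \<longlonglongrightarrow> l"
    show "continuous_on A (\<lambda>\<theta>. ?\<gamma> \<theta> l)"
    proof (rule uniform_limit_theorem)
      show "uniform_limit A (\<lambda>n \<theta>. ?\<gamma> \<theta> (f n)) (\<lambda>\<theta>. ?\<gamma> \<theta> l) sequentially"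
      proof (rule uniform_limitI)
        fix e :: real assume "e > 0"
        have "dist (?\<gamma> \<theta> (f n)) (?\<gamma> \<theta> l) \<le> dist (f n) l" for \<theta> n
          using star_hom_norm_le[OF hom, of \<theta> "f n - l"]
          by (simp add: dist_norm linear_diff[OF bounded_linear.linear[OF bounded_linear_star_hom[OF hom]]])
        moreover have "\<forall>\<^sub>F n in sequentially. dist (f n) l < e" using lim \<open>e > 0\<close> by (rule tendstoD)
        ultimately show "\<forall>\<^sub>F n in sequentially. \<forall>\<theta>\<in>A. dist (?\<gamma> \<theta> (f n)) (?\<gamma> \<theta> l) < e"
          by (auto elim!: eventually_mono intro: le_less_trans)
      qed
    qed (use f in auto)
  next
    fix x c assume "continuous_on A (\<lambda>\<theta>. ?\<gamma> \<theta> x)"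
    then show "continuous_on A (\<lambda>\<theta>. ?\<gamma> \<theta> (c *\<^sub>C x))"
      unfolding hs by (rule bounded_linear.continuous_on[OF bounded_linear_scaleC])
  next
    fix x assume "continuous_on A (\<lambda>\<theta>. ?\<gamma> \<theta> x)"
    then show "continuous_on A (\<lambda>\<theta>. ?\<gamma> \<theta> (x\<dagger>))"
      unfolding hs by (rule bounded_linear.continuous_on[OF bounded_linear_star])
  qed (unfold hs, auto intro!: continuous_intros)
qed

text \<open>A Riemann sum divided by the length of the interval is a convex combination of values of
  \<open>f\<close>, and the mean is a limit of such sums.\<close>

lemma has_integral_mean_in_closed_convex:
  fixes f :: "real \<Rightarrow> 'b::real_normed_vector"
  assumes int: "(f has_integral I) {a..b}" and ab: "a < b" and C: "closed C" "convex C"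
    and f: "\<And>x. x \<in> {a..b} \<Longrightarrow> f x \<in> C"
  shows "(1 / (b - a)) *\<^sub>R I \<in> C"
proof -
  have "\<exists>y\<in>C. dist y ((1 / (b - a)) *\<^sub>R I) < e" if "e > 0" for e
  proof -
    obtain g where g: "gauge g" "\<And>D. D tagged_division_of cbox a b \<Longrightarrow> g fine D \<Longrightarrow>
        norm ((\<Sum>(x, K)\<in>D. measure lborel K *\<^sub>R f x) - I) < e * (b - a)"
      using int \<open>e > 0\<close> ab unfolding has_integral[of f I a b, simplified] box_real
      by (metis diff_gt_0_iff_gt mult_pos_pos)
    obtain D where D: "D tagged_division_of cbox a b" "g fine D"
      using fine_division_exists[OF g(1)] by blast
    define y where "y = (\<Sum>(x, K)\<in>D. (measure lborel K / (b - a)) *\<^sub>R f x)"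
    have y: "y = (1 / (b - a)) *\<^sub>R (\<Sum>(x, K)\<in>D. measure lborel K *\<^sub>R f x)"
      by (simp add: y_def scaleR_sum_right case_prod_unfold)
    have tot: "(\<Sum>(x, K)\<in>D. measure lborel K) = b - a"
      using additive_content_tagged_division[OF D(1)] ab by simp
    have "y \<in> C"
      unfolding y_def case_prod_unfold
    proof (rule convex_sum[OF _ C(2)])
      show "finite D" using D(1) by blast
      show "(\<Sum>i\<in>D. measure lborel (snd i) / (b - a)) = 1"
        using tot ab by (simp add: sum_divide_distrib[symmetric] case_prod_unfold)
      show "0 \<le> measure lborel (snd i) / (b - a)" for i using ab by simp
      show "f (fst i) \<in> C" if "i \<in> D" for i
        using f[of "fst i"] tag_in_interval[OF D(1), of "fst i" "snd i"] that by simp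
    qed
    moreover have "dist y ((1 / (b - a)) *\<^sub>R I) < e"
    proof -
      have "dist y ((1 / (b - a)) *\<^sub>R I) = norm ((\<Sum>(x, K)\<in>D. measure lborel K *\<^sub>R f x) - I) / (b - a)"
        using ab by (simp add: y dist_norm scaleR_diff_right[symmetric])
      also have "\<dots> < e" using g(2)[OF D] ab by (simp add: pos_divide_less_eq)
      finally show ?thesis .
    qed
    ultimately show ?thesis by blast
  qed
  then show ?thesis using closed_approachable[OF C(1)] by blast
qed

text \<open>Serves twice: with the positive cone for positivity of the expectation, and with the
  level sets of the compressed trace for invariance.\<close>

lemma gauge_expectation_in:
  assumes G: "graph_cstar_algebra E p S" and C: "closed C" "convex C"
    and a: "\<And>z. cmod z = 1 \<Longrightarrow> gauge_action E p S z a \<in> C"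
  shows "gauge_expectation E p S a \<in> C"
proof -
  have "((\<lambda>\<theta>. gauge_action E p S (cis \<theta>) a) has_integral
      integral {0..2 * pi} (\<lambda>\<theta>. gauge_action E p S (cis \<theta>) a)) {0..2 * pi}"
    by (intro integrable_integral integrable_continuous_real continuous_on_gauge_action[OF G])
  then have "(1 / (2 * pi - 0)) *\<^sub>R integral {0..2 * pi} (\<lambda>\<theta>. gauge_action E p S (cis \<theta>) a) \<in> C"
    by (rule has_integral_mean_in_closed_convex[OF _ _ C]) (simp_all add: a)
  then show ?thesis by (simp add: gauge_expectation_def)
qed

lemma gauge_expectation_pos_cone:
  assumes G: "graph_cstar_algebra E p S" and "a \<in> pos_cone"
  shows "gauge_expectation E p S a \<in> pos_cone"
  by (rule gauge_expectation_in[OF G closed_pos_cone convex_pos_cone])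
    (rule star_hom_pos_cone[OF gauge_action(1)[OF G] assms(2)])

section \<open>Bounded operators on a separable Hilbert space\<close>

text \<open>Indexing by \<open>nat\<close> makes operator matrices fit into the type of test
  algebras. The space becomes a real inner product space, on which complex scalars act through
  \<open>cmul\<close>.\<close>

typedef ell2 = "{x :: nat \<Rightarrow> complex. (\<lambda>i. (cmod (x i))\<^sup>2) summable_on UNIV}"
  morphisms coord Abs_ell2
  by (intro exI[of _ "\<lambda>_. 0"]) simp

setup_lifting type_definition_ell2

lemma ell2_eqI: "(\<And>i. coord x i = coord y i) \<Longrightarrow> x = y"
  by (auto simp: coord_inject[symmetric])

lemma coord_summable: "(\<lambda>i. (cmod (coord x i))\<^sup>2) summable_on UNIV"
  using coord[of x] by simp

lemma ell2_add_closed: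
  fixes x y :: "nat \<Rightarrow> complex"
  assumes "(\<lambda>i. (cmod (x i))\<^sup>2) summable_on UNIV" "(\<lambda>i. (cmod (y i))\<^sup>2) summable_on UNIV"
  shows "(\<lambda>i. (cmod (x i + y i))\<^sup>2) summable_on UNIV"
proof (rule summable_on_comparison_test)
  show "(\<lambda>i. 2 * (cmod (x i))\<^sup>2 + 2 * (cmod (y i))\<^sup>2) summable_on UNIV"
    by (intro summable_on_add summable_on_cmult_right assms)
  fix i
  have "(cmod (x i + y i))\<^sup>2 \<le> (cmod (x i) + cmod (y i))\<^sup>2"
    by (intro power_mono norm_triangle_ineq) simp
  also have "\<dots> \<le> 2 * (cmod (x i))\<^sup>2 + 2 * (cmod (y i))\<^sup>2"
    using zero_le_power2[of "cmod (x i) - cmod (y i)"] by (simp add: power2_eq_square algebra_simps)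
  finally show "(cmod (x i + y i))\<^sup>2 \<le> 2 * (cmod (x i))\<^sup>2 + 2 * (cmod (y i))\<^sup>2" .
qed simp

lemma ell2_scale_closed:
  fixes x :: "nat \<Rightarrow> complex"
  assumes "(\<lambda>i. (cmod (x i))\<^sup>2) summable_on UNIV"
  shows "(\<lambda>i. (cmod (c * x i))\<^sup>2) summable_on UNIV"
  using summable_on_cmult_right[OF assms, of "(cmod c)\<^sup>2"] by (simp add: norm_mult power_mult_distrib)

lemma ell2_inner_summable: "(\<lambda>i. coord x i \<bullet> coord y i) summable_on UNIV"
proof -
  have "(\<lambda>i. norm (coord x i \<bullet> coord y i)) summable_on UNIV"
  proof (rule summable_on_comparison_test)
    show "(\<lambda>i. (cmod (coord x i))\<^sup>2 + (cmod (coord y i))\<^sup>2) summable_on UNIV"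
      by (intro summable_on_add coord_summable)
    fix i
    have "norm (coord x i \<bullet> coord y i) \<le> cmod (coord x i) * cmod (coord y i)"
      using Cauchy_Schwarz_ineq2 by auto
    also have "\<dots> \<le> (cmod (coord x i))\<^sup>2 + (cmod (coord y i))\<^sup>2"
      using zero_le_power2[of "cmod (coord x i) - cmod (coord y i)"]
        mult_nonneg_nonneg[OF norm_ge_zero norm_ge_zero, of "coord x i" "coord y i"]
      by (simp only: power2_diff)
    finally show "norm (coord x i \<bullet> coord y i) \<le> (cmod (coord x i))\<^sup>2 + (cmod (coord y i))\<^sup>2" .
  qed simp
  then show ?thesis by (rule abs_summable_summable)
qed

instantiation ell2 :: real_inner
begin

lift_definition zero_ell2 :: ell2 is "\<lambda>_. 0" by simp
lift_definition plus_ell2 :: "ell2 \<Rightarrow> ell2 \<Rightarrow> ell2" is "\<lambda>x y i. x i + y i"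
  by (rule ell2_add_closed)
lift_definition uminus_ell2 :: "ell2 \<Rightarrow> ell2" is "\<lambda>x i. - x i" by simp
lift_definition minus_ell2 :: "ell2 \<Rightarrow> ell2 \<Rightarrow> ell2" is "\<lambda>x y i. x i - y i"
  using ell2_add_closed[of _ "\<lambda>i. - _ i"] by simp
lift_definition scaleR_ell2 :: "real \<Rightarrow> ell2 \<Rightarrow> ell2" is "\<lambda>r x i. of_real r * x i"
  by (rule ell2_scale_closed)

definition "inner x y = (\<Sum>\<^sub>\<infinity>i. coord x i \<bullet> coord y i)"
definition "norm x = sqrt (x \<bullet> (x :: ell2))"
definition "dist x y = norm (x - y :: ell2)"
definition "sgn x = inverse (norm x) *\<^sub>R (x :: ell2)"
definition "uniformity = (INF e\<in>{0<..}. principal {(x, y :: ell2). dist x y < e})"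
definition "open U = (\<forall>x\<in>U. eventually (\<lambda>(x', y :: ell2). x' = x \<longrightarrow> y \<in> U) uniformity)"

lemma coord_simps [simp]:
  "coord 0 i = 0" "coord (x + y) i = coord x i + coord y i" "coord (- x) i = - coord x i"
  "coord (x - y) i = coord x i - coord y i" "coord (r *\<^sub>R x) i = of_real r * coord x i"
  by (transfer; simp)+

instance
proof
  fix x y z :: ell2 and r s :: real
  show "x + y + z = x + (y + z)" "x + y = y + x" "0 + x = x" "- x + x = 0" "x - y = x + - y"
    "r *\<^sub>R (x + y) = r *\<^sub>R x + r *\<^sub>R y" "(r + s) *\<^sub>R x = r *\<^sub>R x + s *\<^sub>R x"
    "r *\<^sub>R s *\<^sub>R x = (r * s) *\<^sub>R x" "1 *\<^sub>R x = x"
    by (auto intro!: ell2_eqI simp: algebra_simps)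
  show "inner x y = inner y x" by (simp add: inner_ell2_def inner_commute)
  show "inner (x + y) z = inner x z + inner y z"
    by (simp add: inner_ell2_def inner_add_left infsum_add ell2_inner_summable)
  show "inner (r *\<^sub>R x) y = r * inner x y"
    by (simp add: inner_ell2_def scaleR_conv_of_real[symmetric] infsum_cmult_right')
  show "0 \<le> inner x x" by (simp add: inner_ell2_def infsum_nonneg)
  show "(inner x x = 0) = (x = 0)"
  proof
    assume "inner x x = 0"
    then have "coord x i \<bullet> coord x i = 0" for i
      unfolding inner_ell2_def using nonneg_infsum_le_0D[OF _ ell2_inner_summable[of x x]] by simp
    then show "x = 0" by (intro ell2_eqI) simp
  qed (simp add: inner_ell2_def)
qed (simp_all add: dist_ell2_def sgn_ell2_def uniformity_ell2_def open_ell2_def norm_ell2_def)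

end

lemma norm_ell2_power2: "(norm (x :: ell2))\<^sup>2 = (\<Sum>\<^sub>\<infinity>i. (cmod (coord x i))\<^sup>2)"
  by (simp add: power2_norm_eq_inner[of x] inner_ell2_def power2_norm_eq_inner[symmetric])

lemma sum_coord_le_norm:
  assumes "finite F"
  shows "(\<Sum>i\<in>F. (cmod (coord x i))\<^sup>2) \<le> (norm x)\<^sup>2"
  unfolding norm_ell2_power2 by (rule finite_sum_le_infsum[OF coord_summable assms]) auto

lemma cmod_coord_le: "cmod (coord x i) \<le> norm x"
  by (rule power2_le_imp_le) (use sum_coord_le_norm[of "{i}" x] in simp_all)

lemma norm_ell2_le:
  assumes "\<And>F. finite F \<Longrightarrow> (\<Sum>i\<in>F. (cmod (coord x i))\<^sup>2) \<le> C\<^sup>2" "C \<ge> 0"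
  shows "norm x \<le> C"
proof -
  have "(norm x)\<^sup>2 \<le> C\<^sup>2"
    unfolding norm_ell2_power2 by (rule infsum_le_finite_sums[OF coord_summable]) (rule assms(1))
  then show ?thesis using assms(2) by (rule power2_le_imp_le)
qed

instance ell2 :: banach
proof
  fix f :: "nat \<Rightarrow> ell2"
  assume f: "Cauchy f"
  have "bounded_linear (\<lambda>x. coord x i)" for i
    by (rule bounded_linear_intro[where K = 1]) (simp_all add: cmod_coord_le scaleR_conv_of_real)
  then have "Cauchy (\<lambda>n. coord (f n) i)" for i using f by (rule bounded_linear.Cauchy)
  then have "\<exists>l. (\<lambda>n. coord (f n) i) \<longlonglongrightarrow> l" for i using Cauchy_convergent convergent_def by blast
  then obtain l where l: "\<And>i. (\<lambda>n. coord (f n) i) \<longlonglongrightarrow> l i" by metis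
  \<comment> \<open>The pointwise limit \<open>l\<close> is not yet known to be square summable, so
    the Cauchy estimate is kept on finite index sets, uniformly in them.\<close>
  have fin: "\<exists>M. \<forall>m\<ge>M. \<forall>F. finite F \<longrightarrow> (\<Sum>i\<in>F. (cmod (coord (f m) i - l i))\<^sup>2) \<le> e\<^sup>2"
    if e: "e > 0" for e
  proof -
    obtain M where M: "\<forall>m\<ge>M. \<forall>n\<ge>M. norm (f m - f n) < e" using f e unfolding Cauchy_iff by meson
    have "(\<Sum>i\<in>F. (cmod (coord (f m) i - l i))\<^sup>2) \<le> e\<^sup>2" if "m \<ge> M" "finite F" for m F
    proof (rule LIMSEQ_le_const2)
      show "(\<lambda>n. \<Sum>i\<in>F. (cmod (coord (f m) i - coord (f n) i))\<^sup>2) \<longlonglongrightarrow>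
          (\<Sum>i\<in>F. (cmod (coord (f m) i - l i))\<^sup>2)"
        by (intro tendsto_intros l)
      have "(\<Sum>i\<in>F. (cmod (coord (f m) i - coord (f n) i))\<^sup>2) \<le> e\<^sup>2" if "n \<ge> M" for n
      proof -
        have "norm (f m - f n) \<le> e" using M \<open>m \<ge> M\<close> that by (simp add: less_imp_le)
        then have "(norm (f m - f n))\<^sup>2 \<le> e\<^sup>2" by (intro power_mono) auto
        then show ?thesis using sum_coord_le_norm[OF \<open>finite F\<close>, of "f m - f n"] by simp
      qed
      then show "\<exists>N. \<forall>n\<ge>N. (\<Sum>i\<in>F. (cmod (coord (f m) i - coord (f n) i))\<^sup>2) \<le> e\<^sup>2" by blast
    qed
    then show ?thesis by blast
  qed
  have diff: "(\<lambda>i. (cmod (coord (f m) i - l i))\<^sup>2) summable_on UNIV"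
    if "\<forall>F. finite F \<longrightarrow> (\<Sum>i\<in>F. (cmod (coord (f m) i - l i))\<^sup>2) \<le> e\<^sup>2" for m e
    by (rule nonneg_bdd_above_summable_on) (use that in \<open>auto simp: bdd_above_def\<close>)
  obtain M where "\<forall>F. finite F \<longrightarrow> (\<Sum>i\<in>F. (cmod (coord (f M) i - l i))\<^sup>2) \<le> 1\<^sup>2"
    using fin[of 1] by auto
  \<comment> \<open>The factor \<open>- 1\<close> is there so that adding \<open>coord (f M)\<close>
    leaves exactly \<open>l\<close>.\<close>
  from diff[OF this] have "(\<lambda>i. (cmod (- 1 * (coord (f M) i - l i)))\<^sup>2) summable_on UNIV"
    by (rule ell2_scale_closed)
  from ell2_add_closed[OF coord_summable[of "f M"] this]
  have "(\<lambda>i. (cmod (l i))\<^sup>2) summable_on UNIV" by simp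
  then obtain x where x: "coord x = l" by (metis Abs_ell2_inverse mem_Collect_eq)
  have "f \<longlonglongrightarrow> x"
    unfolding LIMSEQ_iff
  proof (intro allI impI)
    fix e :: real assume "e > 0"
    then obtain M where M: "\<forall>m\<ge>M. \<forall>F. finite F \<longrightarrow> (\<Sum>i\<in>F. (cmod (coord (f m) i - l i))\<^sup>2) \<le> (e / 2)\<^sup>2"
      using fin[of "e / 2"] by auto
    have "norm (f m - x) \<le> e / 2" if "m \<ge> M" for m
      by (rule norm_ell2_le) (use M that \<open>e > 0\<close> in \<open>simp_all add: x\<close>)
    then show "\<exists>M. \<forall>m\<ge>M. norm (f m - x) < e" using \<open>e > 0\<close> by (intro exI[of _ M]) fastforce
  qed
  then show "convergent f" by (auto simp: convergent_def)
qed

lift_definition ell2_basis :: "nat \<Rightarrow> ell2" is "\<lambda>j i. if i = j then 1 else 0"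
proof -
  fix j :: nat
  have "(\<lambda>i. (cmod (if i = j then 1 else 0))\<^sup>2) summable_on {j}" by simp
  then show "(\<lambda>i. (cmod (if i = j then 1 else 0))\<^sup>2) summable_on UNIV"
    by (rule summable_on_cong_neutral[THEN iffD1, rotated -1]) auto
qed

lift_definition cmul :: "complex \<Rightarrow> ell2 \<Rightarrow> ell2" is "\<lambda>c x i. c * x i"
  by (rule ell2_scale_closed)

lemma coord_basis [simp]: "coord (ell2_basis j) i = (if i = j then 1 else 0)"
  by transfer simp

lemma coord_cmul [simp]: "coord (cmul c x) i = c * coord x i"
  by transfer simp

lemma inner_cmul_left: "cmul c x \<bullet> y = x \<bullet> cmul (cnj c) y"
  by (simp add: inner_ell2_def inner_complex_def algebra_simps)

lemma norm_cmul: "norm (cmul c x) = cmod c * norm x"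
proof -
  have "(norm (cmul c x))\<^sup>2 = (cmod c * norm x)\<^sup>2"
    by (simp add: power_mult_distrib norm_ell2_power2 norm_mult infsum_cmult_right')
  then show ?thesis by (simp add: power2_eq_iff_nonneg)
qed

lemma bounded_linear_cmul: "bounded_linear (cmul c)"
  by (rule bounded_linear_intro[where K = "cmod c"])
    (auto intro!: ell2_eqI simp: norm_cmul algebra_simps)

text \<open>The scalar \<open>c\<close> is carried because the inner product is real: letting
  \<open>c\<close> vary recovers the full complex coordinate.\<close>

lemma inner_basis: "x \<bullet> cmul c (ell2_basis i) = coord x i \<bullet> c"
proof -
  have "x \<bullet> cmul c (ell2_basis i) = (\<Sum>\<^sub>\<infinity>j\<in>{i}. coord x j \<bullet> (c * coord (ell2_basis i) j))"
    unfolding inner_ell2_def by (rule infsum_cong_neutral) auto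
  then show ?thesis by simp
qed

text \<open>Kept as a relation: \<open>bops\<close> demands that a partner exists, and partners are
  unique, so the star can be defined by description.\<close>

definition adjoint_pair :: "(ell2 \<Rightarrow>\<^sub>L ell2) \<Rightarrow> (ell2 \<Rightarrow>\<^sub>L ell2) \<Rightarrow> bool" where
  "adjoint_pair T T' \<longleftrightarrow> (\<forall>x y. blinfun_apply T x \<bullet> y = x \<bullet> blinfun_apply T' y)"

text \<open>For complex linear maps the adjoint with respect to the real inner product is the usual
  adjoint.\<close>

definition bops :: "(ell2 \<Rightarrow>\<^sub>L ell2) set" where
  "bops = {T. (\<forall>c x. blinfun_apply T (cmul c x) = cmul c (blinfun_apply T x)) \<and> (\<exists>T'. adjoint_pair T T')}"

lemma adjoint_pair_sym: "adjoint_pair T T' \<longleftrightarrow> adjoint_pair T' T"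
  by (auto simp: adjoint_pair_def inner_commute)

lemma adjoint_pair_unique: "adjoint_pair T T' \<Longrightarrow> adjoint_pair T T'' \<Longrightarrow> T' = T''"
  by (rule blinfun_eqI) (metis adjoint_pair_def vector_eq_ldot)

lemma adjoint_pair_bops: "T \<in> bops \<Longrightarrow> adjoint_pair T T' \<Longrightarrow> T' \<in> bops"
proof -
  assume T: "T \<in> bops" "adjoint_pair T T'"
  have "x \<bullet> blinfun_apply T' (cmul c y) = x \<bullet> cmul c (blinfun_apply T' y)" for c x y
  proof -
    have "x \<bullet> blinfun_apply T' (cmul c y) = blinfun_apply T x \<bullet> cmul c y"
      using T(2) by (simp add: adjoint_pair_def)
    also have "\<dots> = cmul (cnj c) (blinfun_apply T x) \<bullet> y" by (simp add: inner_cmul_left)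
    also have "\<dots> = cmul (cnj c) x \<bullet> blinfun_apply T' y"
      using T by (simp add: bops_def adjoint_pair_def) metis
    finally show ?thesis by (simp add: inner_cmul_left)
  qed
  then have "blinfun_apply T' (cmul c y) = cmul c (blinfun_apply T' y)" for c y
    using vector_eq_ldot by blast
  then show "T' \<in> bops" using T(2) adjoint_pair_sym[of T T'] by (auto simp: bops_def)
qed

lemma adjoint_pair_compose:
  "adjoint_pair S S' \<Longrightarrow> adjoint_pair T T' \<Longrightarrow> adjoint_pair (S o\<^sub>L T) (T' o\<^sub>L S')"
  by (simp add: adjoint_pair_def)

lemma adjoint_pair_add:
  "adjoint_pair S S' \<Longrightarrow> adjoint_pair T T' \<Longrightarrow> adjoint_pair (S + T) (S' + T')"
  by (simp add: adjoint_pair_def plus_blinfun.rep_eq inner_add_left inner_add_right)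

lemma adjoint_pair_scaleR: "adjoint_pair T T' \<Longrightarrow> adjoint_pair (r *\<^sub>R T) (r *\<^sub>R T')"
  by (simp add: adjoint_pair_def scaleR_blinfun.rep_eq)

lemma cmul_blinfun: "blinfun_apply (Blinfun (cmul c)) = cmul c"
  by (rule bounded_linear_Blinfun_apply[OF bounded_linear_cmul])

lemma adjoint_pair_cmul: "adjoint_pair (Blinfun (cmul c)) (Blinfun (cmul (cnj c)))"
  by (simp add: adjoint_pair_def cmul_blinfun inner_cmul_left)

lemma cmul_add: "cmul c (x + y) = cmul c x + cmul c y"
  by (rule ell2_eqI) (simp add: algebra_simps)

lemma cmul_scaleR: "cmul c (r *\<^sub>R x) = r *\<^sub>R cmul c x"
  by (rule ell2_eqI) (simp add: algebra_simps)

lemma cmul_zero: "cmul c 0 = 0"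
  by (rule ell2_eqI) simp

lemma cmul_cmul: "cmul c (cmul d x) = cmul (c * d) x"
  by (rule ell2_eqI) (simp add: algebra_simps)

lemma bops_zero: "0 \<in> bops"
  by (auto simp: bops_def adjoint_pair_def zero_blinfun.rep_eq cmul_zero intro!: exI[of _ 0])

lemma bops_add: "S \<in> bops \<Longrightarrow> T \<in> bops \<Longrightarrow> S + T \<in> bops"
  by (auto simp: bops_def plus_blinfun.rep_eq cmul_add intro: adjoint_pair_add)

lemma bops_scaleR: "T \<in> bops \<Longrightarrow> r *\<^sub>R T \<in> bops"
  by (auto simp: bops_def scaleR_blinfun.rep_eq cmul_scaleR intro: adjoint_pair_scaleR)

lemma bops_compose: "S \<in> bops \<Longrightarrow> T \<in> bops \<Longrightarrow> S o\<^sub>L T \<in> bops"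
  by (auto simp: bops_def intro: adjoint_pair_compose)

lemma bops_cmul: "Blinfun (cmul c) \<in> bops"
  by (auto simp: bops_def cmul_blinfun cmul_cmul mult.commute intro: adjoint_pair_cmul)

typedef bop = bops
  morphisms blinfun_of_bop Abs_bop
  using bops_zero by blast

lemma blinfun_of_bop_Abs: "T \<in> bops \<Longrightarrow> blinfun_of_bop (Abs_bop T) = T"
  by (rule Abs_bop_inverse)

abbreviation bop_apply :: "bop \<Rightarrow> ell2 \<Rightarrow> ell2" where
  "bop_apply T \<equiv> blinfun_apply (blinfun_of_bop T)"

lemma bop_eqI: "(\<And>x i. coord (bop_apply S x) i = coord (bop_apply T x) i) \<Longrightarrow> S = T"
  by (auto simp: blinfun_of_bop_inject[symmetric] intro!: blinfun_eqI ell2_eqI)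

instantiation bop :: real_normed_algebra
begin

definition "0 = Abs_bop 0"
definition "S + T = Abs_bop (blinfun_of_bop S + blinfun_of_bop T)"
definition "S - T = Abs_bop (blinfun_of_bop S - blinfun_of_bop T)"
definition "- T = Abs_bop (- blinfun_of_bop T)"
definition "S * T = Abs_bop (blinfun_of_bop S o\<^sub>L blinfun_of_bop T)"
definition "r *\<^sub>R T = Abs_bop (r *\<^sub>R blinfun_of_bop T)"
definition "norm T = norm (blinfun_of_bop T)"
definition "dist S T = norm (S - T :: bop)"
definition "sgn T = inverse (norm T) *\<^sub>R (T :: bop)"
definition "uniformity = (INF e\<in>{0<..}. principal {(x, y :: bop). dist x y < e})"
definition "open U = (\<forall>x\<in>U. eventually (\<lambda>(x', y :: bop). x' = x \<longrightarrow> y \<in> U) uniformity)"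

lemma blinfun_of_bop_simps:
  "blinfun_of_bop 0 = 0" "blinfun_of_bop (S + T) = blinfun_of_bop S + blinfun_of_bop T"
  "blinfun_of_bop (S - T) = blinfun_of_bop S - blinfun_of_bop T"
  "blinfun_of_bop (- T) = - blinfun_of_bop T"
  "blinfun_of_bop (S * T) = blinfun_of_bop S o\<^sub>L blinfun_of_bop T"
  "blinfun_of_bop (r *\<^sub>R T) = r *\<^sub>R blinfun_of_bop T"
  using bops_scaleR[OF blinfun_of_bop[of T], of "- 1"]
    bops_add[OF blinfun_of_bop[of S] bops_scaleR[OF blinfun_of_bop[of T], of "- 1"]]
  by (simp_all add: zero_bop_def plus_bop_def minus_bop_def uminus_bop_def times_bop_def
      scaleR_bop_def blinfun_of_bop_Abs bops_zero bops_add bops_compose bops_scaleR blinfun_of_bop)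

lemma bop_apply_simps [simp]:
  "bop_apply 0 x = 0" "bop_apply (S + T) x = bop_apply S x + bop_apply T x"
  "bop_apply (S - T) x = bop_apply S x - bop_apply T x" "bop_apply (- T) x = - bop_apply T x"
  "bop_apply (S * T) x = bop_apply S (bop_apply T x)" "bop_apply (r *\<^sub>R T) x = r *\<^sub>R bop_apply T x"
  by (simp_all add: blinfun_of_bop_simps plus_blinfun.rep_eq minus_blinfun.rep_eq
      uminus_blinfun.rep_eq scaleR_blinfun.rep_eq)

lemma bop_apply_linear:
  "bop_apply T (x + y) = bop_apply T x + bop_apply T y" "bop_apply T (r *\<^sub>R x) = r *\<^sub>R bop_apply T x"
  "bop_apply T (cmul c x) = cmul c (bop_apply T x)"
  using blinfun_of_bop[of T] by (simp_all add: blinfun.add_right blinfun.scaleR_right bops_def)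

instance
proof
  fix S T U :: bop and r s :: real
  show "S + T + U = S + (T + U)" "S + T = T + S" "0 + S = S" "- S + S = 0" "S - T = S + - T"
    "r *\<^sub>R (S + T) = r *\<^sub>R S + r *\<^sub>R T" "(r + s) *\<^sub>R S = r *\<^sub>R S + s *\<^sub>R S"
    "r *\<^sub>R s *\<^sub>R S = (r * s) *\<^sub>R S" "1 *\<^sub>R S = S" "S * T * U = S * (T * U)"
    "(S + T) * U = S * U + T * U" "S * (T + U) = S * T + S * U"
    "r *\<^sub>R S * T = r *\<^sub>R (S * T)" "S * r *\<^sub>R T = r *\<^sub>R (S * T)"
    by (rule bop_eqI; simp add: bop_apply_linear algebra_simps)+
  show "norm (S + T) \<le> norm S + norm T" "norm (r *\<^sub>R S) = \<bar>r\<bar> * norm S"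
    "norm (S * T) \<le> norm S * norm T"
    by (simp_all add: norm_bop_def blinfun_of_bop_simps norm_triangle_ineq norm_blinfun_compose)
  show "(norm S = 0) = (S = 0)"
    by (simp add: norm_bop_def blinfun_of_bop_inject[symmetric] blinfun_of_bop_simps)
qed (simp_all add: dist_bop_def sgn_bop_def uniformity_bop_def open_bop_def)

end

instantiation bop :: cstar_algebra
begin

definition "c *\<^sub>C T = Abs_bop (Blinfun (cmul c) o\<^sub>L blinfun_of_bop T)"
definition "T\<dagger> = Abs_bop (THE T'. adjoint_pair (blinfun_of_bop T) T')"

lemma bop_apply_scaleC [simp]: "bop_apply (c *\<^sub>C T) x = cmul c (bop_apply T x)"
  by (simp add: scaleC_bop_def blinfun_of_bop_Abs bops_compose bops_cmul blinfun_of_bop cmul_blinfun)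

lemma adjoint_pair_star: "adjoint_pair (blinfun_of_bop T) (blinfun_of_bop (T\<dagger>))"
proof -
  obtain T' where T': "adjoint_pair (blinfun_of_bop T) T'"
    using blinfun_of_bop[of T] by (auto simp: bops_def)
  have "(THE T'. adjoint_pair (blinfun_of_bop T) T') = T'"
    using T' adjoint_pair_unique by blast
  then show ?thesis
    using T' adjoint_pair_bops[OF blinfun_of_bop T'] by (simp add: star_bop_def blinfun_of_bop_Abs)
qed

lemma bop_star_eqI:
  assumes "adjoint_pair (blinfun_of_bop T) (blinfun_of_bop T')"
  shows "T\<dagger> = T'"
  using adjoint_pair_unique[OF adjoint_pair_star assms] by (simp add: blinfun_of_bop_inject)

lemma norm_bop_apply_le: "norm (bop_apply T x) \<le> norm T * norm x"
  unfolding norm_bop_def by (rule norm_blinfun)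

lemma norm_bop_bound: "0 \<le> b \<Longrightarrow> (\<And>x. norm (bop_apply T x) \<le> b * norm x) \<Longrightarrow> norm T \<le> b"
  unfolding norm_bop_def by (rule norm_blinfun_bound)

lemma bop_inner_star: "bop_apply T x \<bullet> y = x \<bullet> bop_apply (T\<dagger>) y"
  using adjoint_pair_star by (simp add: adjoint_pair_def)

lemma bop_star_eqI':
  assumes "\<And>x y. bop_apply T x \<bullet> y = x \<bullet> bop_apply T' y"
  shows "T\<dagger> = T'"
  using assms by (intro bop_star_eqI) (simp add: adjoint_pair_def)

lemma bop_norm_star_mult_self: "norm (S\<dagger>) = norm S" "norm (S\<dagger> * S) = (norm S)\<^sup>2" for S :: bop
proof -
  have "(norm S)\<^sup>2 \<le> norm (S\<dagger> * S)" for S :: bop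
  proof -
    have "norm (bop_apply S x) \<le> sqrt (norm (S\<dagger> * S)) * norm x" for x
    proof -
      have "(norm (bop_apply S x))\<^sup>2 = x \<bullet> bop_apply (S\<dagger> * S) x"
        by (simp add: power2_norm_eq_inner bop_inner_star)
      also have "\<dots> \<le> norm x * norm (bop_apply (S\<dagger> * S) x)" by (rule norm_cauchy_schwarz)
      also have "\<dots> \<le> norm x * (norm (S\<dagger> * S) * norm x)"
        by (intro mult_left_mono norm_bop_apply_le) simp
      finally have "(norm (bop_apply S x))\<^sup>2 \<le> norm (S\<dagger> * S) * (norm x)\<^sup>2"
        by (simp add: power2_eq_square mult_ac)
      then show ?thesis by (rule norm_le_sqrtI)
    qed
    then have "norm S \<le> sqrt (norm (S\<dagger> * S))" by (intro norm_bop_bound) simp_all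
    then have "(norm S)\<^sup>2 \<le> (sqrt (norm (S\<dagger> * S)))\<^sup>2" by (intro power_mono) simp_all
    then show ?thesis by simp
  qed
  moreover have "(S\<dagger>)\<dagger> = S" for S :: bop
    by (rule bop_star_eqI') (metis bop_inner_star inner_commute)
  ultimately show "norm (S\<dagger>) = norm S" "norm (S\<dagger> * S) = (norm S)\<^sup>2" by (rule cstar_identityI)+
qed

instance
proof
  fix S T U :: bop and r s :: real and c d :: complex
  show "r *\<^sub>R S = complex_of_real r *\<^sub>C S" "c *\<^sub>C (S + T) = c *\<^sub>C S + c *\<^sub>C T"
    "(c + d) *\<^sub>C S = c *\<^sub>C S + d *\<^sub>C S" "c *\<^sub>C d *\<^sub>C S = (c * d) *\<^sub>C S" "1 *\<^sub>C S = S"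
    "(c *\<^sub>C S) * T = c *\<^sub>C (S * T)" "S * (c *\<^sub>C T) = c *\<^sub>C (S * T)"
    by (rule bop_eqI; simp add: bop_apply_linear algebra_simps)+
  have le: "norm (c *\<^sub>C S) \<le> cmod c * norm S" for c and S :: bop
    by (rule norm_bop_bound) (simp_all add: norm_cmul mult.assoc mult_left_mono norm_bop_apply_le)
  show "norm (c *\<^sub>C S) = cmod c * norm S"
    by (rule norm_scaleCI[OF le], rule bop_eqI) (simp add: cmul_cmul)
  show "(S\<dagger>)\<dagger> = S" by (rule bop_star_eqI') (metis bop_inner_star inner_commute)
  show "(S + T)\<dagger> = S\<dagger> + T\<dagger>" "(S * T)\<dagger> = T\<dagger> * S\<dagger>" "(c *\<^sub>C S)\<dagger> = cnj c *\<^sub>C S\<dagger>"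
    by (rule bop_star_eqI'; simp add: inner_add_left inner_add_right inner_cmul_left bop_inner_star
        bop_apply_linear)+
  show "norm (S\<dagger> * S) = (norm S)\<^sup>2" by (rule bop_norm_star_mult_self)
next
  fix f :: "nat \<Rightarrow> bop"
  assume "Cauchy f"
  have sd: "(S - T)\<dagger> = S\<dagger> - T\<dagger>" for S T :: bop
    by (rule bop_star_eqI') (simp add: inner_diff_left inner_diff_right bop_inner_star)
  have nd: "norm (blinfun_of_bop S - blinfun_of_bop T) = norm (S - T)" for S T
    by (simp add: norm_bop_def blinfun_of_bop_simps)
  \<comment> \<open>The adjoints converge too because the star is isometric. The two limits form an
    adjoint pair, which keeps the limit inside \<open>bops\<close>.\<close>
  have "Cauchy (\<lambda>n. blinfun_of_bop (f n))" "Cauchy (\<lambda>n. blinfun_of_bop ((f n)\<dagger>))"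
    using \<open>Cauchy f\<close> unfolding Cauchy_iff nd sd[symmetric] bop_norm_star_mult_self by simp_all
  then obtain T T' where T: "(\<lambda>n. blinfun_of_bop (f n)) \<longlonglongrightarrow> T"
    and T': "(\<lambda>n. blinfun_of_bop ((f n)\<dagger>)) \<longlonglongrightarrow> T'"
    using Cauchy_convergent convergent_def by blast
  have lim: "(\<lambda>n. bop_apply (f n) x) \<longlonglongrightarrow> blinfun_apply T x"
    "(\<lambda>n. bop_apply ((f n)\<dagger>) x) \<longlonglongrightarrow> blinfun_apply T' x" for x
    by (intro blinfun.tendsto T T' tendsto_const)+
  have "adjoint_pair T T'"
    unfolding adjoint_pair_def
  proof (intro allI)
    fix x y
    have "(\<lambda>n. bop_apply (f n) x \<bullet> y) \<longlonglongrightarrow> blinfun_apply T x \<bullet> y" by (intro tendsto_intros lim)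
    moreover have "(\<lambda>n. bop_apply (f n) x \<bullet> y) \<longlonglongrightarrow> x \<bullet> blinfun_apply T' y"
      unfolding bop_inner_star by (intro tendsto_intros lim)
    ultimately show "blinfun_apply T x \<bullet> y = x \<bullet> blinfun_apply T' y" by (rule LIMSEQ_unique)
  qed
  moreover have "blinfun_apply T (cmul c x) = cmul c (blinfun_apply T x)" for c x
  proof (rule LIMSEQ_unique)
    show "(\<lambda>n. bop_apply (f n) (cmul c x)) \<longlonglongrightarrow> blinfun_apply T (cmul c x)" by (rule lim)
    show "(\<lambda>n. bop_apply (f n) (cmul c x)) \<longlonglongrightarrow> cmul c (blinfun_apply T x)"
      unfolding bop_apply_linear by (rule bounded_linear.tendsto[OF bounded_linear_cmul lim(1)])
  qed
  ultimately have "T \<in> bops" by (auto simp: bops_def)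
  then have "norm (f n - Abs_bop T) = norm (blinfun_of_bop (f n) - T)" for n
    by (simp add: nd[symmetric] blinfun_of_bop_Abs)
  then have "f \<longlonglongrightarrow> Abs_bop T"
    using T by (simp add: LIMSEQ_iff)
  then show "convergent f" by (auto simp: convergent_def)
qed

end

text \<open>Equal matrices make the adjoints agree on basis vectors, and a coordinate of
  \<open>S x\<close> is recovered by pairing \<open>x\<close> with such adjoint vectors. This admits
  \<open>bop\<close> as a test algebra.\<close>

lemma inj_bop_matrix: "inj (\<lambda>T i j. coord (bop_apply T (ell2_basis j)) i)"
proof (rule injI)
  fix S T :: bop
  assume eq: "(\<lambda>i j. coord (bop_apply S (ell2_basis j)) i) = (\<lambda>i j. coord (bop_apply T (ell2_basis j)) i)"
  have ceq: "z = w" if "\<And>c. z \<bullet> c = w \<bullet> c" for z w :: complex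
    using that vector_eq_rdot by blast
  have basis: "bop_apply S (ell2_basis j) = bop_apply T (ell2_basis j)" for j
    by (rule ell2_eqI) (use eq in \<open>simp add: fun_eq_iff\<close>)
  have "bop_apply (S\<dagger>) (ell2_basis i) = bop_apply (T\<dagger>) (ell2_basis i)" for i
  proof (rule ell2_eqI, rule ceq)
    fix j c
    show "coord (bop_apply (S\<dagger>) (ell2_basis i)) j \<bullet> c = coord (bop_apply (T\<dagger>) (ell2_basis i)) j \<bullet> c"
      by (simp add: inner_basis[symmetric] inner_commute[of "bop_apply _ _"] bop_inner_star[symmetric]
          bop_apply_linear basis)
  qed
  then have "coord (bop_apply S x) i \<bullet> c = coord (bop_apply T x) i \<bullet> c" for x i c
    by (simp add: inner_basis[symmetric] bop_inner_star bop_apply_linear)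
  then show "S = T" by (intro bop_eqI ceq)
qed

section \<open>Operators induced by partial injections of the index set\<close>

definition partial_inverse :: "(nat \<Rightarrow> nat option) \<Rightarrow> (nat \<Rightarrow> nat option) \<Rightarrow> bool" where
  "partial_inverse g h \<longleftrightarrow> (\<forall>i j. g i = Some j \<longleftrightarrow> h j = Some i)"

text \<open>A pullback: the resulting operator moves basis vector \<open>j\<close> to basis vector
  \<open>h j\<close>, or to 0 if \<open>h j\<close> is undefined, where \<open>h\<close> is the
  partial inverse of \<open>g\<close>.\<close>

definition comp_vec :: "(nat \<Rightarrow> nat option) \<Rightarrow> (nat \<Rightarrow> complex) \<Rightarrow> nat \<Rightarrow> complex" where
  "comp_vec g x i = (case g i of None \<Rightarrow> 0 | Some j \<Rightarrow> x j)"

text \<open>\<open>g\<close> is injective where it is defined, so every coordinate of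
  \<open>x\<close> is counted at most once.\<close>

lemma comp_vec_sum_le:
  assumes gh: "partial_inverse g h" and "finite F"
  shows "(\<Sum>i\<in>F. (cmod (comp_vec g (coord x) i))\<^sup>2) \<le> (norm x)\<^sup>2"
proof -
  let ?D = "{i\<in>F. g i \<noteq> None}"
  have inj: "inj_on (\<lambda>i. the (g i)) ?D"
    by (rule inj_on_inverseI[where g = "\<lambda>j. the (h j)"]) (use gh in \<open>force simp: partial_inverse_def\<close>)
  have "(\<Sum>i\<in>F. (cmod (comp_vec g (coord x) i))\<^sup>2) = (\<Sum>i\<in>?D. (cmod (coord x (the (g i))))\<^sup>2)"
    by (rule sum.mono_neutral_cong_right) (use assms in \<open>auto simp: comp_vec_def\<close>)
  also have "\<dots> = (\<Sum>j\<in>(\<lambda>i. the (g i)) ` ?D. (cmod (coord x j))\<^sup>2)"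
    by (subst sum.reindex[OF inj]) (simp add: o_def)
  also have "\<dots> \<le> (norm x)\<^sup>2" using assms(2) by (intro sum_coord_le_norm) simp
  finally show ?thesis .
qed

lemma comp_vec_exists:
  assumes gh: "partial_inverse g h"
  shows "\<exists>y. coord y = comp_vec g (coord x)"
proof -
  have "(\<lambda>i. (cmod (comp_vec g (coord x) i))\<^sup>2) summable_on UNIV"
    by (rule nonneg_bdd_above_summable_on)
      (use comp_vec_sum_le[OF gh] in \<open>auto simp: bdd_above_def\<close>)
  then show ?thesis by (metis Abs_ell2_inverse mem_Collect_eq)
qed

text \<open>The pullback along \<open>h\<close> is the adjoint: the two pairings are sums over the
  domains of \<open>g\<close> and \<open>h\<close>, and \<open>g\<close> maps the first bijectively
  onto the second.\<close>

lemma comp_bop_exists: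
  assumes gh: "partial_inverse g h"
  shows "\<exists>T. \<forall>x i. coord (bop_apply T x) i = comp_vec g (coord x) i"
proof -
  have hg: "partial_inverse h g" using gh by (auto simp: partial_inverse_def)
  have ex: "\<exists>W. (\<forall>x. coord (W x) = comp_vec g (coord x)) \<and> bounded_linear W"
    if gh: "partial_inverse g h" for g h
  proof -
    obtain W where W: "\<And>x. coord (W x) = comp_vec g (coord x)" using comp_vec_exists[OF gh] by metis
    have "bounded_linear W"
    proof (rule bounded_linear_intro[where K = 1])
      show "W (x + y) = W x + W y" "W (r *\<^sub>R x) = r *\<^sub>R W x" for x y r
        by (auto intro!: ell2_eqI simp: W comp_vec_def split: option.split)
      show "norm (W x) \<le> norm x * 1" for x
        using comp_vec_sum_le[OF gh] by (intro norm_ell2_le) (simp_all add: W)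
    qed
    with W show ?thesis by blast
  qed
  obtain V W where V: "\<And>x. coord (V x) = comp_vec g (coord x)" "bounded_linear V"
    and W: "\<And>x. coord (W x) = comp_vec h (coord x)" "bounded_linear W"
    using ex[OF gh] ex[OF hg] by metis
  have "V x \<bullet> y = x \<bullet> W y" for x y
  proof -
    have k: "h (the (g i)) = Some i" if "g i \<noteq> None" for i
      using gh that unfolding partial_inverse_def by (metis option.exhaust_sel)
    have bij: "bij_betw (\<lambda>i. the (g i)) {i. g i \<noteq> None} {j. h j \<noteq> None}"
    proof (rule bij_betw_byWitness[where f' = "\<lambda>j. the (h j)"])
      have k': "g (the (h j)) = Some j" if "h j \<noteq> None" for j
        using gh that unfolding partial_inverse_def by (metis option.exhaust_sel)
      show "\<forall>i\<in>{i. g i \<noteq> None}. the (h (the (g i))) = i" using k by simp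
      show "\<forall>j\<in>{j. h j \<noteq> None}. the (g (the (h j))) = j" using k' by simp
      show "(\<lambda>i. the (g i)) ` {i. g i \<noteq> None} \<subseteq> {j. h j \<noteq> None}"
      proof
        fix j assume "j \<in> (\<lambda>i. the (g i)) ` {i. g i \<noteq> None}"
        then obtain i where "j = the (g i)" "g i \<noteq> None" by blast
        then show "j \<in> {j. h j \<noteq> None}" using k[of i] by simp
      qed
      show "(\<lambda>j. the (h j)) ` {j. h j \<noteq> None} \<subseteq> {i. g i \<noteq> None}"
      proof
        fix i assume "i \<in> (\<lambda>j. the (h j)) ` {j. h j \<noteq> None}"
        then obtain j where "i = the (h j)" "h j \<noteq> None" by blast
        then show "i \<in> {i. g i \<noteq> None}" using k'[of j] by simp
      qed
    qed
    have "V x \<bullet> y = (\<Sum>\<^sub>\<infinity>i\<in>{i. g i \<noteq> None}. coord x (the (g i)) \<bullet> coord y i)"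
      unfolding inner_ell2_def V by (rule infsum_cong_neutral) (auto simp: comp_vec_def)
    also have "\<dots> = (\<Sum>\<^sub>\<infinity>i\<in>{i. g i \<noteq> None}. coord x (the (g i)) \<bullet> coord y (the (h (the (g i)))))"
    proof (rule infsum_cong)
      fix i assume "i \<in> {i. g i \<noteq> None}"
      then have "h (the (g i)) = Some i" using k by simp
      then show "coord x (the (g i)) \<bullet> coord y i = coord x (the (g i)) \<bullet> coord y (the (h (the (g i))))"
        by simp
    qed
    also have "\<dots> = (\<Sum>\<^sub>\<infinity>j\<in>{j. h j \<noteq> None}. coord x j \<bullet> coord y (the (h j)))"
      by (rule infsum_reindex_bij_betw[OF bij])
    also have "\<dots> = x \<bullet> W y"
      unfolding inner_ell2_def W by (rule infsum_cong_neutral) (auto simp: comp_vec_def)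
    finally show ?thesis .
  qed
  then have "adjoint_pair (Blinfun V) (Blinfun W)"
    by (simp add: adjoint_pair_def bounded_linear_Blinfun_apply V W)
  moreover have "V (cmul c x) = cmul c (V x)" for c x
    by (rule ell2_eqI) (simp add: V comp_vec_def split: option.split)
  ultimately have "Blinfun V \<in> bops"
    by (auto simp: bops_def bounded_linear_Blinfun_apply V)
  then show ?thesis
    by (intro exI[of _ "Abs_bop (Blinfun V)"])
      (simp add: blinfun_of_bop_Abs bounded_linear_Blinfun_apply V)
qed

definition comp_bop :: "(nat \<Rightarrow> nat option) \<Rightarrow> bop" where
  "comp_bop g = (SOME T. \<forall>x i. coord (bop_apply T x) i = comp_vec g (coord x) i)"

lemma coord_comp_bop:
  assumes "partial_inverse g h"
  shows "coord (bop_apply (comp_bop g) x) i = comp_vec g (coord x) i"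
  using someI_ex[OF comp_bop_exists[OF assms]] unfolding comp_bop_def by blast

text \<open>\<open>comp_bop\<close> is a choice, so the adjoint is identified by its coordinates:
  pairing with multiples of a basis vector moves \<open>comp_bop g\<close> onto that vector, where
  its value is known.\<close>

lemma star_comp_bop:
  assumes gh: "partial_inverse g h"
  shows "(comp_bop g)\<dagger> = comp_bop h"
proof (rule bop_eqI)
  fix x i
  have hg: "partial_inverse h g" using gh by (auto simp: partial_inverse_def)
  have "coord (bop_apply ((comp_bop g)\<dagger>) x) i \<bullet> c = coord (bop_apply (comp_bop h) x) i \<bullet> c" for c
  proof -
    have *: "bop_apply (comp_bop g) (cmul c (ell2_basis i)) =
        (case h i of None \<Rightarrow> 0 | Some j \<Rightarrow> cmul c (ell2_basis j))"
    proof (rule ell2_eqI)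
      fix k
      have "g k = Some i \<longleftrightarrow> h i = Some k" using gh by (simp add: partial_inverse_def)
      then show "coord (bop_apply (comp_bop g) (cmul c (ell2_basis i))) k =
          coord (case h i of None \<Rightarrow> 0 | Some j \<Rightarrow> cmul c (ell2_basis j)) k"
        by (cases "g k"; cases "h i") (auto simp: coord_comp_bop[OF gh] comp_vec_def)
    qed
    have "coord (bop_apply ((comp_bop g)\<dagger>) x) i \<bullet> c = cmul c (ell2_basis i) \<bullet> bop_apply ((comp_bop g)\<dagger>) x"
      by (simp add: inner_basis inner_commute[of "cmul c (ell2_basis i)"])
    also have "\<dots> = (case h i of None \<Rightarrow> 0 | Some j \<Rightarrow> cmul c (ell2_basis j)) \<bullet> x"
      by (simp only: bop_inner_star[symmetric] *)
    also have "\<dots> = coord (bop_apply (comp_bop h) x) i \<bullet> c"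
      by (cases "h i") (simp_all add: coord_comp_bop[OF hg] comp_vec_def inner_basis
          inner_commute[of "cmul c (ell2_basis j)" for j])
    finally show ?thesis .
  qed
  then show "coord (bop_apply ((comp_bop g)\<dagger>) x) i = coord (bop_apply (comp_bop h) x) i"
    using vector_eq_rdot by blast
qed

section \<open>A faithful family on the Hilbert space\<close>

text \<open>The basis of the Hilbert space is split into one infinite block per vertex, and the block of
  \<open>v\<close> into residue classes, one for each edge leaving \<open>v\<close>.  The operator of an edge maps the block of
  its head onto the residue class of the edge.\<close>

definition vertex_map :: "('v, 'e) pre_digraph \<Rightarrow> 'v \<Rightarrow> nat \<Rightarrow> nat option" where
  "vertex_map E v i = (if fst (prod_decode i) = to_nat_on (verts E) v then Some i else None)"

text \<open>Operators are pullbacks, so the index map runs against the operator: from the residue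
  class at the tail to the whole block of the head.\<close>

definition arc_map :: "('v, 'e) pre_digraph \<Rightarrow> 'e \<Rightarrow> nat \<Rightarrow> nat option" where
  "arc_map E e i =
    (let X = out_arcs E (tail E e); (c, m) = prod_decode i in
     if c = to_nat_on (verts E) (tail E e) \<and> m mod card X = to_nat_on X e
     then Some (prod_encode (to_nat_on (verts E) (head E e), m div card X)) else None)"

definition arc_map_inv :: "('v, 'e) pre_digraph \<Rightarrow> 'e \<Rightarrow> nat \<Rightarrow> nat option" where
  "arc_map_inv E e i =
    (let X = out_arcs E (tail E e); (c, k) = prod_decode i in
     if c = to_nat_on (verts E) (head E e)
     then Some (prod_encode (to_nat_on (verts E) (tail E e), card X * k + to_nat_on X e)) else None)"

lemma partial_inverse_vertex_map: "partial_inverse (vertex_map E v) (vertex_map E v)"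
  by (auto simp: partial_inverse_def vertex_map_def)

context
  fixes E :: "('v, 'e) pre_digraph"
  assumes cd: "countable_digraph E" and rf: "row_finite E"
begin

lemma tail_head_in_verts: "e \<in> arcs E \<Longrightarrow> tail E e \<in> verts E" "e \<in> arcs E \<Longrightarrow> head E e \<in> verts E"
  using cd by (auto simp: countable_digraph_def wf_digraph_def)

lemma finite_out_arcs: "v \<in> verts E \<Longrightarrow> finite (out_arcs E v)"
  using rf by (simp add: row_finite_def)

lemma out_arcs_index:
  assumes "v \<in> verts E"
  shows "bij_betw (to_nat_on (out_arcs E v)) (out_arcs E v) {..<card (out_arcs E v)}"
  using finite_out_arcs[OF assms] by (rule to_nat_on_finite)

lemma arc_index_less:
  assumes "e \<in> arcs E"
  shows "to_nat_on (out_arcs E (tail E e)) e < card (out_arcs E (tail E e))"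
  using bij_betwE[OF out_arcs_index[OF tail_head_in_verts(1)[OF assms]]] assms by auto

lemma partial_inverse_arc_map:
  assumes e: "e \<in> arcs E"
  shows "partial_inverse (arc_map E e) (arc_map_inv E e)"
  unfolding partial_inverse_def
proof (intro allI)
  fix i j
  let ?n = "card (out_arcs E (tail E e))" and ?d = "to_nat_on (out_arcs E (tail E e)) e"
  obtain c m where i: "i = prod_encode (c, m)" by (metis prod_decode_inverse surj_pair)
  obtain b k where j: "j = prod_encode (b, k)" by (metis prod_decode_inverse surj_pair)
  have d: "?d < ?n" using e by (rule arc_index_less)
  have "m mod ?n = ?d \<and> m div ?n = k \<longleftrightarrow> m = ?n * k + ?d"
  proof
    assume "m mod ?n = ?d \<and> m div ?n = k"
    then show "m = ?n * k + ?d" using mult_div_mod_eq[of ?n m] by simp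
  next
    assume "m = ?n * k + ?d"
    then show "m mod ?n = ?d \<and> m div ?n = k" using d by simp
  qed
  then show "arc_map E e i = Some j \<longleftrightarrow> arc_map_inv E e j = Some i"
    by (auto simp: arc_map_def arc_map_inv_def i j Let_def)
qed

lemma bop_CK_family:
  "CK_family E univ_cstar (\<lambda>v. comp_bop (vertex_map E v)) (\<lambda>e. comp_bop (arc_map E e))"
proof -
  let ?p = "\<lambda>v. comp_bop (vertex_map E v)" and ?T = "\<lambda>e. comp_bop (arc_map E e)"
  note pv = partial_inverse_vertex_map and pa = partial_inverse_arc_map
  have pa': "partial_inverse (arc_map_inv E e) (arc_map E e)" if "e \<in> arcs E" for e
    using pa[OF that] unfolding partial_inverse_def by blast
  have inv: "arc_map_inv E e j = Some i" if "e \<in> arcs E" "arc_map E e i = Some j" for e i j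
    using pa[OF that(1)] that(2) unfolding partial_inverse_def by blast
  have inv': "arc_map E e j = Some i" if "e \<in> arcs E" "arc_map_inv E e i = Some j" for e i j
    using pa'[OF that(1)] that(2) unfolding partial_inverse_def by blast
  have inj: "to_nat_on (verts E) v = to_nat_on (verts E) w \<longleftrightarrow> v = w" if "v \<in> verts E" "w \<in> verts E" for v w
    using cd that by (simp add: countable_digraph_def)
  note cv = coord_comp_bop[OF pv] and ca = coord_comp_bop[OF pa] and ca' = coord_comp_bop[OF pa']
  have SS: "coord (bop_apply (?T e * (?T e)\<dagger>) x) i =
      (if arc_map E e i = None then 0 else coord x i)" if "e \<in> arcs E" for e x i
    using inv[OF that, of i]
    by (cases "arc_map E e i")
      (simp_all add: star_comp_bop[OF pa[OF that]] ca[OF that] ca'[OF that] comp_vec_def)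
  show ?thesis
    unfolding CK_family_univ_iff
  proof (intro conjI ballI impI)
    fix v assume v: "v \<in> verts E"
    show "?p v * ?p v = ?p v"
      by (rule bop_eqI) (auto simp: cv comp_vec_def vertex_map_def)
    show "(?p v)\<dagger> = ?p v" by (rule star_comp_bop[OF pv])
    show "?p v * ?p w = 0" if "w \<in> verts E" "v \<noteq> w" for w
      by (rule bop_eqI) (use v that inj[OF v that(1)] in \<open>auto simp: cv comp_vec_def vertex_map_def\<close>)
    show "?p v =
        (\<Sum>e\<in>out_arcs E v. ?T e * (?T e)\<dagger>)"
      if ne: "out_arcs E v \<noteq> {}"
    proof (rule bop_eqI)
      fix x i
      let ?O = "out_arcs E v"
      have "card ?O > 0" using ne finite_out_arcs[OF v] by (simp add: card_gt_0_iff)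
      obtain c m where i: "i = prod_encode (c, m)" by (metis prod_decode_inverse surj_pair)
      have dom: "arc_map E e i \<noteq> None \<longleftrightarrow> c = to_nat_on (verts E) v \<and> m mod card ?O = to_nat_on ?O e"
        if "e \<in> ?O" for e
        using that by (auto simp: arc_map_def i Let_def)
      \<comment> \<open>The finitely many edges leaving \<open>v\<close> exhaust the residues modulo
        their number, so exactly one of them, \<open>e0\<close>, owns the residue of this
        coordinate. Row-finiteness enters here.\<close>
      have "m mod card ?O \<in> {..<card ?O}" using \<open>card ?O > 0\<close> by simp
      then obtain e0 where e0: "e0 \<in> ?O" "to_nat_on ?O e0 = m mod card ?O"
        using bij_betw_imp_surj_on[OF out_arcs_index[OF v]] by (metis (no_types, lifting) imageE)
      have uniq: "m mod card ?O = to_nat_on ?O e \<longleftrightarrow> e = e0" if "e \<in> ?O" for e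
        using inj_on_eq_iff[OF bij_betw_imp_inj_on[OF out_arcs_index[OF v]] e0(1) that]
        unfolding e0(2) by blast
      have sum: "coord (bop_apply (sum f A) x) i = (\<Sum>a\<in>A. coord (bop_apply (f a) x) i)"
        for f and A :: "'e set"
        by (induction A rule: infinite_finite_induct) simp_all
      have "coord (bop_apply (\<Sum>e\<in>?O. ?T e * (?T e)\<dagger>) x) i =
          (\<Sum>e\<in>?O. if e = e0 then (if c = to_nat_on (verts E) v then coord x i else 0) else 0)"
        unfolding sum
      proof (rule sum.cong[OF refl])
        fix e assume e: "e \<in> ?O"
        then have "e \<in> arcs E" by simp
        show "coord (bop_apply (?T e * (?T e)\<dagger>) x) i =
            (if e = e0 then (if c = to_nat_on (verts E) v then coord x i else 0) else 0)"
          unfolding SS[OF \<open>e \<in> arcs E\<close>] using dom[OF e] uniq[OF e] by auto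
      qed
      also have "\<dots> = (if c = to_nat_on (verts E) v then coord x i else 0)"
        using e0(1) finite_out_arcs[OF v] by (simp add: sum.delta)
      finally show "coord (bop_apply (?p v) x) i =
          coord (bop_apply (\<Sum>e\<in>?O. ?T e * (?T e)\<dagger>) x) i"
        by (simp add: cv comp_vec_def vertex_map_def i)
    qed
  next
    fix e assume e: "e \<in> arcs E"
    have "coord (bop_apply (?T e) x) i = 0" if "arc_map E e i = None" for x i
      by (simp add: ca[OF e] comp_vec_def that)
    then have "coord (bop_apply (?T e * (?T e)\<dagger>)
        (bop_apply (?T e) x)) i = coord (bop_apply (?T e) x) i" for x i
      unfolding SS[OF e] by simp
    then show "?T e * (?T e)\<dagger> * ?T e =
        ?T e"
      by (intro bop_eqI) simp
    show "(?T e)\<dagger> * ?T e = ?p (head E e)"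
    proof (rule bop_eqI)
      fix x i
      have "arc_map_inv E e i = None \<longleftrightarrow> vertex_map E (head E e) i = None"
        by (simp add: arc_map_inv_def vertex_map_def Let_def case_prod_unfold)
      moreover have "vertex_map E (head E e) i \<noteq> None \<Longrightarrow> vertex_map E (head E e) i = Some i"
        by (simp add: vertex_map_def split: if_splits)
      ultimately show "coord (bop_apply ((?T e)\<dagger> * ?T e) x) i =
          coord (bop_apply (?p (head E e)) x) i"
        using inv'[OF e, of i]
        by (cases "arc_map_inv E e i")
          (auto simp: star_comp_bop[OF pa[OF e]] ca[OF e] ca'[OF e] cv comp_vec_def)
    qed
  qed
qed

lemma comp_bop_arc_map_neq_0:
  assumes e: "e \<in> arcs E"
  shows "comp_bop (arc_map E e) \<noteq> 0"
proof
  assume 0: "comp_bop (arc_map E e) = 0"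
  \<comment> \<open>The first basis vector in the block of the head, where the operator does not
    vanish.\<close>
  let ?j = "prod_encode (to_nat_on (verts E) (head E e), 0)"
  obtain i where "arc_map_inv E e ?j = Some i" by (simp add: arc_map_inv_def Let_def)
  then have "arc_map E e i = Some ?j"
    using partial_inverse_arc_map[OF e] unfolding partial_inverse_def by blast
  then have "coord (bop_apply (comp_bop (arc_map E e)) (ell2_basis ?j)) i = 1"
    by (simp add: coord_comp_bop[OF partial_inverse_arc_map[OF e]] comp_vec_def)
  then show False unfolding 0 by simp
qed

text \<open>The matrix map makes \<open>bop\<close> an admissible test algebra, and the homomorphism
  into it sends \<open>S e\<close> to a nonzero operator.\<close>

lemma graph_cstar_generator_neq_0:
  fixes p :: "'v \<Rightarrow> 'a::cstar_algebra"
  assumes G: "graph_cstar_algebra E p S" and e: "e \<in> arcs E"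
  shows "S e \<noteq> 0"
proof -
  have inj: "inj (\<lambda>T. Inr (\<lambda>i j. coord (bop_apply T (ell2_basis j)) i) :: 'a + (nat \<Rightarrow> nat \<Rightarrow> complex))"
    using inj_bop_matrix unfolding inj_def by blast
  show ?thesis
  proof (rule graph_cstar_algebra_universal[OF G bop_CK_family inj])
    fix \<phi> assume \<phi>: "univ_hom \<phi>"
      "\<And>e. e \<in> arcs E \<Longrightarrow> \<phi> (S e) = comp_bop (arc_map E e)"
    have "\<phi> 0 = 0" using star_hom_univ_scaleR[OF \<phi>(1), of 0 0] by simp
    then show "S e \<noteq> 0" using \<phi>(2)[OF e] comp_bop_arc_map_neq_0[OF e] by auto
  qed
qed

end

section \<open>Traces\<close>

text \<open>Relational form of \<open>trace_ext\<close>. It records membership in the domain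
  together with the value, so linear combinations can be tracked before any definite description is
  evaluated.\<close>

definition has_trace :: "('a::cstar_algebra \<Rightarrow> ennreal) \<Rightarrow> 'a \<Rightarrow> complex \<Rightarrow> bool" where
  "has_trace \<tau> x t \<longleftrightarrow> (\<exists>a\<in>finite_cone \<tau>. \<exists>b\<in>finite_cone \<tau>. \<exists>c\<in>finite_cone \<tau>. \<exists>d\<in>finite_cone \<tau>.
     x = a - b + \<i> *\<^sub>C (c - d) \<and>
     t = Complex (enn2real (\<tau> a) - enn2real (\<tau> b)) (enn2real (\<tau> c) - enn2real (\<tau> d)))"

lemma has_traceI:
  assumes "a \<in> finite_cone \<tau>" "b \<in> finite_cone \<tau>" "c \<in> finite_cone \<tau>" "d \<in> finite_cone \<tau>"
    "x = a - b + \<i> *\<^sub>C (c - d)"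
    "t = Complex (enn2real (\<tau> a) - enn2real (\<tau> b)) (enn2real (\<tau> c) - enn2real (\<tau> d))"
  shows "has_trace \<tau> x t"
  using assms unfolding has_trace_def by blast

lemma has_traceE:
  assumes "has_trace \<tau> x t"
  obtains a b c d where "a \<in> finite_cone \<tau>" "b \<in> finite_cone \<tau>" "c \<in> finite_cone \<tau>" "d \<in> finite_cone \<tau>"
    "x = a - b + \<i> *\<^sub>C (c - d)"
    "t = Complex (enn2real (\<tau> a) - enn2real (\<tau> b)) (enn2real (\<tau> c) - enn2real (\<tau> d))"
  using assms unfolding has_trace_def by blast

locale trace =
  fixes \<tau> :: "'a::cstar_algebra \<Rightarrow> ennreal"
  assumes is_trace: "is_trace \<tau>"
begin

lemma trace_add: "a \<in> pos_cone \<Longrightarrow> b \<in> pos_cone \<Longrightarrow> \<tau> (a + b) = \<tau> a + \<tau> b"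
  using is_trace by (simp add: is_trace_def)

lemma trace_scaleR: "a \<in> pos_cone \<Longrightarrow> r \<ge> 0 \<Longrightarrow> \<tau> (r *\<^sub>R a) = ennreal r * \<tau> a"
  using is_trace by (simp add: is_trace_def)

lemma trace_star_commute: "\<tau> (a\<dagger> * a) = \<tau> (a * a\<dagger>)"
  using is_trace by (simp add: is_trace_def)

lemma trace_zero [simp]: "\<tau> 0 = 0"
  using trace_scaleR[of 0 0] by simp

lemma trace_sum:
  "finite I \<Longrightarrow> (\<And>i. i \<in> I \<Longrightarrow> f i \<in> pos_cone) \<Longrightarrow> \<tau> (sum f I) = (\<Sum>i\<in>I. \<tau> (f i))"
  by (induction I rule: finite_induct) (simp_all add: trace_add pos_cone_sum)

lemma trace_mono:
  assumes "a \<in> pos_cone" "b - a \<in> pos_cone"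
  shows "\<tau> a \<le> \<tau> b"
  using trace_add[OF assms] by simp

lemma finite_cone_zero [simp]: "0 \<in> finite_cone \<tau>"
  by (simp add: finite_cone_def)

lemma finite_cone_add: "a \<in> finite_cone \<tau> \<Longrightarrow> b \<in> finite_cone \<tau> \<Longrightarrow> a + b \<in> finite_cone \<tau>"
  by (simp add: finite_cone_def trace_add pos_cone_add)

lemma finite_cone_scaleR: "a \<in> finite_cone \<tau> \<Longrightarrow> r \<ge> 0 \<Longrightarrow> r *\<^sub>R a \<in> finite_cone \<tau>"
  by (simp add: finite_cone_def trace_scaleR pos_cone_scaleR ennreal_mult_less_top)

lemma finite_cone_mono:
  assumes "a \<in> pos_cone" "b - a \<in> pos_cone" "b \<in> finite_cone \<tau>"
  shows "a \<in> finite_cone \<tau>"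
  using trace_mono[OF assms(1,2)] assms(1,3) by (auto simp: finite_cone_def intro: le_less_trans)

lemma enn2real_trace_add:
  "a \<in> finite_cone \<tau> \<Longrightarrow> b \<in> finite_cone \<tau> \<Longrightarrow> enn2real (\<tau> (a + b)) = enn2real (\<tau> a) + enn2real (\<tau> b)"
  by (simp add: finite_cone_def trace_add enn2real_plus)

lemma enn2real_trace_scaleR:
  "a \<in> finite_cone \<tau> \<Longrightarrow> r \<ge> 0 \<Longrightarrow> enn2real (\<tau> (r *\<^sub>R a)) = r * enn2real (\<tau> a)"
  by (simp add: finite_cone_def trace_scaleR enn2real_mult)

lemma finite_cone_trace_less_top: "a \<in> finite_cone \<tau> \<Longrightarrow> \<tau> a < \<infinity>"
  by (simp add: finite_cone_def)

lemma ennreal_trace: "a \<in> finite_cone \<tau> \<Longrightarrow> ennreal (enn2real (\<tau> a)) = \<tau> a"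
  by (simp add: finite_cone_def)

lemma has_trace_trace_ext: "has_trace \<tau> x t \<Longrightarrow> trace_ext \<tau> x = t"
  by (elim has_traceE) (simp add: trace_ext_eq[OF is_trace])

lemma has_trace_unique: "has_trace \<tau> x t \<Longrightarrow> has_trace \<tau> x s \<Longrightarrow> t = s"
  using has_trace_trace_ext by blast

lemma trace_domain_iff: "x \<in> trace_domain \<tau> \<longleftrightarrow> has_trace \<tau> x (trace_ext \<tau> x)"
proof
  assume "x \<in> trace_domain \<tau>"
  then obtain t where "has_trace \<tau> x t" unfolding trace_domain_def has_trace_def by blast
  then show "has_trace \<tau> x (trace_ext \<tau> x)" using has_trace_trace_ext by metis
qed (auto simp: trace_domain_def has_trace_def)

lemma has_trace_domain: "has_trace \<tau> x t \<Longrightarrow> x \<in> trace_domain \<tau>"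
  using has_trace_trace_ext trace_domain_iff by metis

lemma has_trace_finite_cone: "a \<in> finite_cone \<tau> \<Longrightarrow> has_trace \<tau> a (of_real (enn2real (\<tau> a)))"
  by (rule has_traceI[of a _ 0 0 0]) (simp_all add: complex_eq_iff)

lemma has_trace_add:
  assumes "has_trace \<tau> x s" "has_trace \<tau> y t"
  shows "has_trace \<tau> (x + y) (s + t)"
proof -
  obtain a b c d where x: "a \<in> finite_cone \<tau>" "b \<in> finite_cone \<tau>" "c \<in> finite_cone \<tau>" "d \<in> finite_cone \<tau>"
    "x = a - b + \<i> *\<^sub>C (c - d)"
    "s = Complex (enn2real (\<tau> a) - enn2real (\<tau> b)) (enn2real (\<tau> c) - enn2real (\<tau> d))"
    using assms(1) by (rule has_traceE)
  obtain a' b' c' d' where y: "a' \<in> finite_cone \<tau>" "b' \<in> finite_cone \<tau>" "c' \<in> finite_cone \<tau>"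
    "d' \<in> finite_cone \<tau>" "y = a' - b' + \<i> *\<^sub>C (c' - d')"
    "t = Complex (enn2real (\<tau> a') - enn2real (\<tau> b')) (enn2real (\<tau> c') - enn2real (\<tau> d'))"
    using assms(2) by (rule has_traceE)
  show ?thesis
  proof (rule has_traceI)
    show "x + y = (a + a') - (b + b') + \<i> *\<^sub>C ((c + c') - (d + d'))"
      by (simp add: x(5) y(5) scaleC_add_right scaleC_diff_right)
    show "s + t = Complex (enn2real (\<tau> (a + a')) - enn2real (\<tau> (b + b')))
        (enn2real (\<tau> (c + c')) - enn2real (\<tau> (d + d')))"
      using x(1-4) y(1-4) by (simp add: x(6) y(6) complex_eq_iff enn2real_trace_add)
  qed (use x(1-4) y(1-4) in \<open>simp_all add: finite_cone_add\<close>)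
qed

lemma has_trace_minus: "has_trace \<tau> x t \<Longrightarrow> has_trace \<tau> (- x) (- t)"
  by (elim has_traceE, rule has_traceI[of b _ a d c for a b c d])
    (assumption | simp add: scaleC_diff_right complex_eq_iff)+

lemma has_trace_scaleR_nonneg:
  assumes "has_trace \<tau> x t" "r \<ge> 0"
  shows "has_trace \<tau> (r *\<^sub>R x) (of_real r * t)"
proof -
  obtain a b c d where x: "a \<in> finite_cone \<tau>" "b \<in> finite_cone \<tau>" "c \<in> finite_cone \<tau>" "d \<in> finite_cone \<tau>"
    "x = a - b + \<i> *\<^sub>C (c - d)"
    "t = Complex (enn2real (\<tau> a) - enn2real (\<tau> b)) (enn2real (\<tau> c) - enn2real (\<tau> d))"
    using assms(1) by (rule has_traceE)
  show ?thesis
  proof (rule has_traceI)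
    show "r *\<^sub>R x = r *\<^sub>R a - r *\<^sub>R b + \<i> *\<^sub>C (r *\<^sub>R c - r *\<^sub>R d)"
      by (simp add: x(5) scaleR_add_right scaleR_diff_right scaleR_scaleC scaleC_add_right
          scaleC_diff_right scaleC_scaleC mult.commute)
    show "of_real r * t = Complex (enn2real (\<tau> (r *\<^sub>R a)) - enn2real (\<tau> (r *\<^sub>R b)))
        (enn2real (\<tau> (r *\<^sub>R c)) - enn2real (\<tau> (r *\<^sub>R d)))"
      using x(1-4) assms(2) by (simp add: x(6) complex_eq_iff enn2real_trace_scaleR algebra_simps)
  qed (use x(1-4) assms(2) in \<open>simp_all add: finite_cone_scaleR\<close>)
qed

lemma has_trace_scaleR: "has_trace \<tau> x t \<Longrightarrow> has_trace \<tau> (r *\<^sub>R x) (of_real r * t)"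
  using has_trace_scaleR_nonneg[of x t r] has_trace_minus[OF has_trace_scaleR_nonneg[of x t "- r"]]
  by (cases "r \<ge> 0") simp_all

lemma has_trace_i: "has_trace \<tau> x t \<Longrightarrow> has_trace \<tau> (\<i> *\<^sub>C x) (\<i> * t)"
  by (elim has_traceE, rule has_traceI[of d _ c a b for a b c d])
    (assumption | simp add: scaleC_add_right scaleC_i_i complex_eq_iff)+

lemma has_trace_scaleC:
  assumes "has_trace \<tau> x t"
  shows "has_trace \<tau> (c *\<^sub>C x) (c * t)"
proof -
  have c: "complex_of_real (Re c) + complex_of_real (Im c) * \<i> = c" by (simp add: complex_eq_iff)
  have "has_trace \<tau> (Re c *\<^sub>R x + Im c *\<^sub>R \<i> *\<^sub>C x) (of_real (Re c) * t + of_real (Im c) * (\<i> * t))"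
    by (intro has_trace_add has_trace_scaleR has_trace_i assms)
  moreover have "c *\<^sub>C x = Re c *\<^sub>R x + Im c *\<^sub>R \<i> *\<^sub>C x"
    by (simp only: scaleR_scaleC scaleC_scaleC scaleC_add_left[symmetric] c)
  moreover have "c * t = of_real (Re c) * t + of_real (Im c) * (\<i> * t)"
    by (simp add: complex_eq_iff algebra_simps)
  ultimately show ?thesis by simp
qed

lemma has_trace_zero: "has_trace \<tau> 0 0"
  using has_trace_finite_cone[of 0] by simp

lemma has_trace_diff: "has_trace \<tau> x s \<Longrightarrow> has_trace \<tau> y t \<Longrightarrow> has_trace \<tau> (x - y) (s - t)"
  using has_trace_add[OF _ has_trace_minus] by fastforce

text \<open>By the parallelogram law the square of a sum is dominated by twice the squares, so
  polarization stays among elements of finite trace.\<close>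

lemma finite_cone_star_add:
  assumes "x * x\<dagger> \<in> finite_cone \<tau>" "y * y\<dagger> \<in> finite_cone \<tau>"
  shows "(x + y) * (x + y)\<dagger> \<in> finite_cone \<tau>"
proof (rule finite_cone_mono)
  show "2 *\<^sub>R (x * x\<dagger> + y * y\<dagger>) \<in> finite_cone \<tau>"
    by (intro finite_cone_scaleR finite_cone_add assms) simp
  have "2 *\<^sub>R (x * x\<dagger> + y * y\<dagger>) - (x + y) * (x + y)\<dagger> = (x - y) * (x - y)\<dagger>"
    by (simp add: star_add star_diff algebra_simps scaleR_2)
  then show "2 *\<^sub>R (x * x\<dagger> + y * y\<dagger>) - (x + y) * (x + y)\<dagger> \<in> pos_cone" by simp
qed simp

text \<open>The trace property for products, from the polarization identity
  \<open>4 x y\<dagger> = \<Sum>\<^sub>k i\<^sup>k (x + i\<^sup>k y) (x + i\<^sup>k y)\<dagger>\<close> and its counterpart for \<open>4 y\<dagger> x\<close>.\<close>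

lemma has_trace_mult_commute:
  assumes fin: "x * x\<dagger> \<in> finite_cone \<tau>" "y * y\<dagger> \<in> finite_cone \<tau>"
  obtains t where "has_trace \<tau> (x * y\<dagger>) t" "has_trace \<tau> (y\<dagger> * x) t"
proof -
  define w where "w c = x + c *\<^sub>C y" for c
  have cy: "(c *\<^sub>C y) * (c *\<^sub>C y)\<dagger> = y * y\<dagger>" "(c *\<^sub>C y)\<dagger> * (c *\<^sub>C y) = y\<dagger> * y" if "c * cnj c = 1" for c
    using that by (simp_all add: star_scaleC mult_scaleC_left mult_scaleC_right scaleC_scaleC
        scaleC_one mult.commute[of "cnj c" c])
  have w: "w c * (w c)\<dagger> \<in> finite_cone \<tau>" if "c * cnj c = 1" for c
    unfolding w_def by (rule finite_cone_star_add) (simp_all add: fin cy that)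
  then have w': "(w c)\<dagger> * w c \<in> finite_cone \<tau>" if "c * cnj c = 1" for c
    using that trace_star_commute[of "w c"] by (simp add: finite_cone_def)
  define s where "s c = complex_of_real (enn2real (\<tau> (w c * (w c)\<dagger>)))" for c
  have tr: "has_trace \<tau> (w c * (w c)\<dagger>) (s c)" "has_trace \<tau> ((w c)\<dagger> * w c) (s c)" if "c * cnj c = 1" for c
    using has_trace_finite_cone[OF w[OF that]] has_trace_finite_cone[OF w'[OF that]]
    by (simp_all add: s_def trace_star_commute)
  define t where "t = (1/4) * (s 1 + \<i> * s \<i> + (- 1) * s (- 1) + (- \<i>) * s (- \<i>))"
  have exp: "w c * (w c)\<dagger> = x * x\<dagger> + y * y\<dagger> + cnj c *\<^sub>C (x * y\<dagger>) + c *\<^sub>C (y * x\<dagger>)"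
    "(w c)\<dagger> * w c = x\<dagger> * x + y\<dagger> * y + c *\<^sub>C (x\<dagger> * y) + cnj c *\<^sub>C (y\<dagger> * x)" if "c * cnj c = 1" for c
    using cy[OF that] unfolding w_def
    by (simp_all add: star_add distrib_left distrib_right star_scaleC mult_scaleC_left
        mult_scaleC_right scaleC_scaleC mult.commute[of "cnj c" c] that scaleC_one scaleC_add_right algebra_simps)
  have "(4::complex) = 1 + 1 + 1 + 1" by simp
  then have four: "4 *\<^sub>C z = z + z + z + z" for z :: 'a by (simp only: scaleC_add_left scaleC_one)
  note lin = scaleC_add_right scaleC_diff_right scaleC_scaleC scaleC_minus_left_cstar scaleC_one
  have "has_trace \<tau> ((1/4) *\<^sub>C (w 1 * (w 1)\<dagger> + \<i> *\<^sub>C (w \<i> * (w \<i>)\<dagger>) + (- 1) *\<^sub>C (w (- 1) * (w (- 1))\<dagger>)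
      + (- \<i>) *\<^sub>C (w (- \<i>) * (w (- \<i>))\<dagger>))) t"
    unfolding t_def by (intro has_trace_scaleC has_trace_add tr) simp_all
  moreover have "(1/4) *\<^sub>C (w 1 * (w 1)\<dagger> + \<i> *\<^sub>C (w \<i> * (w \<i>)\<dagger>) + (- 1) *\<^sub>C (w (- 1) * (w (- 1))\<dagger>)
      + (- \<i>) *\<^sub>C (w (- \<i>) * (w (- \<i>))\<dagger>)) = (1/4) *\<^sub>C 4 *\<^sub>C (x * y\<dagger>)"
    by (rule arg_cong[of _ _ "scaleC (1/4)"]) (simp add: exp four lin)
  moreover have "has_trace \<tau> ((1/4) *\<^sub>C ((w 1)\<dagger> * w 1 + \<i> *\<^sub>C ((w \<i>)\<dagger> * w \<i>) + (- 1) *\<^sub>C ((w (- 1))\<dagger> * w (- 1))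
      + (- \<i>) *\<^sub>C ((w (- \<i>))\<dagger> * w (- \<i>)))) t"
    unfolding t_def by (intro has_trace_scaleC has_trace_add tr) simp_all
  moreover have "(1/4) *\<^sub>C ((w 1)\<dagger> * w 1 + \<i> *\<^sub>C ((w \<i>)\<dagger> * w \<i>) + (- 1) *\<^sub>C ((w (- 1))\<dagger> * w (- 1))
      + (- \<i>) *\<^sub>C ((w (- \<i>))\<dagger> * w (- \<i>))) = (1/4) *\<^sub>C 4 *\<^sub>C (y\<dagger> * x)"
    by (rule arg_cong[of _ _ "scaleC (1/4)"]) (simp add: exp four lin)
  ultimately show thesis by (intro that[of t]) (simp_all add: scaleC_scaleC scaleC_one)
qed

text \<open>\<open>P * a * P\<close> need not lie below \<open>a\<close> in the order. The trace
  property first turns it into \<open>b * P * b\<dagger>\<close>, which does lie below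
  \<open>b * b\<dagger>\<close>.\<close>

lemma trace_compress_le:
  assumes P: "P\<dagger> = P" "P * P = P" and a: "a \<in> pos_cone"
  shows "P * a * P \<in> pos_cone" "\<tau> (P * a * P) \<le> \<tau> a"
proof -
  obtain b where b: "a = b\<dagger> * b" using a by (auto simp: pos_cone_def)
  have PaP: "P * a * P = (b * P)\<dagger> * (b * P)" by (simp add: b star_mult P mult.assoc)
  then show "P * a * P \<in> pos_cone" by simp
  have bP: "(b * P) * (b * P)\<dagger> = b * P * b\<dagger>" by (simp add: star_mult P mult.assoc) (metis P(2) mult.assoc)
  have "b * b\<dagger> - (b * P) * (b * P)\<dagger> = (b - b * P) * (b - b * P)\<dagger>"
    unfolding bP by (simp add: star_diff star_mult P algebra_simps) (metis P(2) mult.assoc diff_self)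
  then have "\<tau> ((b * P) * (b * P)\<dagger>) \<le> \<tau> (b * b\<dagger>)" by (intro trace_mono) simp_all
  then show "\<tau> (P * a * P) \<le> \<tau> a" unfolding PaP unfolding b by (simp add: trace_star_commute)
qed

text \<open>If \<open>norm (a - P) \<le> 1/2\<close> then \<open>P a P \<ge> P / 2\<close>.\<close>

lemma finite_trace_projection:
  assumes sf: "semifinite_trace \<tau>" and P: "P\<dagger> = P" "P * P = P"
  shows "P \<in> finite_cone \<tau>"
proof -
  have Pp: "P \<in> pos_cone" using star_mult_self_in_pos_cone(1)[of P] by (simp add: P)
  then have "P \<in> closure (finite_cone \<tau>)" using sf by (auto simp: semifinite_trace_def)
  then obtain a where a: "a \<in> finite_cone \<tau>" "dist a P < 1/2"
    unfolding closure_approachable by (metis half_gt_zero zero_less_one)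
  have ap: "a \<in> pos_cone" using a by (simp add: finite_cone_def)
  have "(1/2) *\<^sub>R (P\<dagger> * P) + P\<dagger> * (a - P) * P \<in> pos_cone"
    by (rule pos_cone_conjugate_shift)
      (use a(2) in \<open>simp_all add: star_diff pos_cone_star[OF ap] P dist_norm\<close>)
  moreover have "(1/2) *\<^sub>R (P\<dagger> * P) + P\<dagger> * (a - P) * P = P * a * P - (1/2) *\<^sub>R P"
    using scaleR_half_double[of P] by (simp add: P algebra_simps)
  ultimately have "P * a * P - (1/2) *\<^sub>R P \<in> pos_cone" by simp
  moreover have "P * a * P \<in> finite_cone \<tau>"
    using trace_compress_le[OF P ap] a(1) by (auto simp: finite_cone_def intro: le_less_trans)
  ultimately have "(1/2) *\<^sub>R P \<in> finite_cone \<tau>"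
    using Pp by (intro finite_cone_mono[of "(1/2) *\<^sub>R P" "P * a * P"]) (simp_all add: pos_cone_scaleR)
  then have "2 *\<^sub>R ((1/2) *\<^sub>R P) \<in> finite_cone \<tau>" by (rule finite_cone_scaleR) simp
  then show ?thesis by simp
qed

section \<open>Bounded functionals from compression by a projection of finite trace\<close>

context
  fixes P :: 'a
  assumes P: "P\<dagger> = P" "P * P = P" "P \<in> finite_cone \<tau>"
begin

text \<open>With \<open>t = norm x\<close>, both \<open>t P + P x P\<close> and
  \<open>t P - P x P\<close> are positive and add up to \<open>2 t P\<close>, so both have finite
  trace. Nonnegativity of the two values is the bound on \<open>s\<close>.\<close>

lemma has_trace_corner_self_adjoint:
  assumes "x\<dagger> = x"
  obtains s where "has_trace \<tau> (P * x * P) (of_real s)" "\<bar>s\<bar> \<le> norm x * enn2real (\<tau> P)"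
proof -
  define t where "t = norm x"
  define a where "a = t *\<^sub>R P + P * x * P"
  define b where "b = t *\<^sub>R P - P * x * P"
  have "a \<in> pos_cone" "b \<in> pos_cone"
    using pos_cone_conjugate_shift[of x t P] pos_cone_conjugate_shift[of "- x" t P] assms
    by (simp_all add: a_def b_def t_def P(1,2) star_minus)
  moreover have ab: "a + b = (2 * t) *\<^sub>R P" by (simp add: a_def b_def scaleR_2[symmetric])
  moreover have tP: "(2 * t) *\<^sub>R P \<in> finite_cone \<tau>" by (intro finite_cone_scaleR P) (simp add: t_def)
  ultimately have fin: "a \<in> finite_cone \<tau>" "b \<in> finite_cone \<tau>"
    using finite_cone_mono[of a "(2 * t) *\<^sub>R P"] finite_cone_mono[of b "(2 * t) *\<^sub>R P"]
    by (simp_all add: ab[symmetric])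
  define s where "s = enn2real (\<tau> a) - t * enn2real (\<tau> P)"
  have "has_trace \<tau> (a - t *\<^sub>R P) (of_real (enn2real (\<tau> a)) - of_real t * of_real (enn2real (\<tau> P)))"
    by (intro has_trace_diff has_trace_scaleR has_trace_finite_cone fin P)
  then have "has_trace \<tau> (P * x * P) (of_real s)" by (simp add: a_def s_def)
  moreover have "enn2real (\<tau> a) + enn2real (\<tau> b) = 2 * t * enn2real (\<tau> P)"
    using enn2real_trace_add[OF fin] enn2real_trace_scaleR[OF P(3), of "2 * t"] by (simp add: ab t_def)
  then have "\<bar>s\<bar> \<le> t * enn2real (\<tau> P)"
    using enn2real_nonneg[of "\<tau> a"] enn2real_nonneg[of "\<tau> b"]
    unfolding s_def abs_le_iff by linarith
  ultimately show thesis using that by (simp add: t_def)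
qed

text \<open>Real and imaginary parts are estimated separately, whence the factor 2.\<close>

lemma has_trace_corner:
  obtains t where "has_trace \<tau> (P * x * P) t" "cmod t \<le> norm x * (2 * enn2real (\<tau> P))"
proof -
  define h where "h = (1/2) *\<^sub>R (x + x\<dagger>)"
  define k where "k = (1/2) *\<^sub>R (\<i> *\<^sub>C (x\<dagger> - x))"
  have sa: "h\<dagger> = h" "k\<dagger> = k"
    by (simp_all add: h_def k_def star_scaleR star_add star_diff star_scaleC star_star add.commute
        scaleC_minus_left_cstar scaleC_diff_right)
  have "norm h \<le> norm x" "norm k \<le> norm x"
    using norm_triangle_ineq[of x "x\<dagger>"] norm_triangle_ineq4[of "x\<dagger>" x]
    by (simp_all add: h_def k_def norm_scaleC)
  obtain r s where r: "has_trace \<tau> (P * h * P) (of_real r)" "\<bar>r\<bar> \<le> norm h * enn2real (\<tau> P)"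
    and s: "has_trace \<tau> (P * k * P) (of_real s)" "\<bar>s\<bar> \<le> norm k * enn2real (\<tau> P)"
    using has_trace_corner_self_adjoint[OF sa(1)] has_trace_corner_self_adjoint[OF sa(2)] by metis
  have ik: "\<i> *\<^sub>C k = (1/2) *\<^sub>R (x - x\<dagger>)"
    by (simp add: k_def scaleR_scaleC scaleC_scaleC scaleC_diff_right mult.assoc[symmetric]
        scaleC_minus_left_cstar)
  have "x = h + \<i> *\<^sub>C k"
    unfolding ik h_def by (simp add: scaleR_add_right[symmetric] scaleR_2[symmetric])
  then have "P * x * P = P * h * P + \<i> *\<^sub>C (P * k * P)"
    by (simp add: algebra_simps mult_scaleC_left mult_scaleC_right)
  then have "has_trace \<tau> (P * x * P) (of_real r + \<i> * of_real s)"
    using has_trace_add[OF r(1) has_trace_i[OF s(1)]] by simp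
  moreover have "cmod (of_real r + \<i> * of_real s) \<le> norm x * (2 * enn2real (\<tau> P))"
  proof -
    have "cmod (of_real r + \<i> * of_real s) \<le> \<bar>r\<bar> + \<bar>s\<bar>"
      by (rule order_trans[OF norm_triangle_ineq]) (simp add: norm_mult)
    moreover have "norm h * enn2real (\<tau> P) \<le> norm x * enn2real (\<tau> P)"
      "norm k * enn2real (\<tau> P) \<le> norm x * enn2real (\<tau> P)"
      using \<open>norm h \<le> norm x\<close> \<open>norm k \<le> norm x\<close> by (simp_all add: mult_right_mono)
    ultimately show ?thesis using r(2) s(2) by simp
  qed
  ultimately show thesis using that by blast
qed

lemma has_trace_corner_ext: "has_trace \<tau> (P * x * P) (trace_ext \<tau> (P * x * P))"
  using has_trace_corner has_trace_trace_ext by metis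

lemma trace_corner_add: "trace_ext \<tau> (P * (x + y) * P) = trace_ext \<tau> (P * x * P) + trace_ext \<tau> (P * y * P)"
  using has_trace_add[OF has_trace_corner_ext[of x] has_trace_corner_ext[of y]]
  by (intro has_trace_trace_ext) (simp add: algebra_simps)

lemma trace_corner_scaleC: "trace_ext \<tau> (P * (c *\<^sub>C x) * P) = c * trace_ext \<tau> (P * x * P)"
  using has_trace_scaleC[OF has_trace_corner_ext[of x]]
  by (intro has_trace_trace_ext) (simp add: mult_scaleC_left mult_scaleC_right)

lemma bounded_linear_trace_corner: "bounded_linear (\<lambda>x. trace_ext \<tau> (P * x * P))"
proof (rule bounded_linear_intro)
  fix x y :: 'a and r :: real
  show "trace_ext \<tau> (P * (x + y) * P) = trace_ext \<tau> (P * x * P) + trace_ext \<tau> (P * y * P)"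
    by (rule trace_corner_add)
  show "trace_ext \<tau> (P * (r *\<^sub>R x) * P) = r *\<^sub>R trace_ext \<tau> (P * x * P)"
    by (simp only: scaleR_scaleC trace_corner_scaleC scaleR_conv_of_real)
  show "norm (trace_ext \<tau> (P * x * P)) \<le> norm x * (2 * enn2real (\<tau> P))"
    using has_trace_corner has_trace_trace_ext by metis
qed

lemma trace_corner_pos_cone:
  assumes "a \<in> pos_cone"
  shows "P * a * P \<in> finite_cone \<tau>" "trace_ext \<tau> (P * a * P) = of_real (enn2real (\<tau> (P * a * P)))"
proof -
  have pc: "P * a * P \<in> pos_cone" by (rule trace_compress_le[OF P(1,2) assms])
  have "norm a *\<^sub>R (P\<dagger> * P) + P\<dagger> * (- a) * P \<in> pos_cone"
    by (rule pos_cone_conjugate_shift) (simp_all add: star_minus pos_cone_star[OF assms])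
  then have "norm a *\<^sub>R P - P * a * P \<in> pos_cone" by (simp add: P)
  then show fin: "P * a * P \<in> finite_cone \<tau>"
    by (rule finite_cone_mono[OF pc]) (simp add: finite_cone_scaleR P)
  show "trace_ext \<tau> (P * a * P) = of_real (enn2real (\<tau> (P * a * P)))"
    by (rule has_trace_trace_ext[OF has_trace_finite_cone[OF fin]])
qed

end

text \<open>For \<open>a = b\<dagger> * b\<close> the compressed trace equals that of
  \<open>b * P n * b\<dagger>\<close>, which tends to \<open>b * b\<dagger>\<close> in norm. Lower
  semicontinuity bounds the lower limit from below, \<open>trace_compress_le\<close> the upper limit
  from above.\<close>

lemma trace_compress_tendsto:
  assumes lsc: "lsc_trace \<tau>" and P: "\<And>n. (P n)\<dagger> = P n" "\<And>n. P n * P n = P n"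
    and lim: "\<And>x. (\<lambda>n. x * P n) \<longlonglongrightarrow> x" and a: "a \<in> pos_cone"
  shows "(\<lambda>n. \<tau> (P n * a * P n)) \<longlonglongrightarrow> \<tau> a"
proof -
  obtain b where b: "a = b\<dagger> * b" using a by (auto simp: pos_cone_def)
  have PaP: "P n * a * P n = (b * P n)\<dagger> * (b * P n)" for n by (simp add: b star_mult P(1) mult.assoc)
  have bP: "(b * P n) * (b * P n)\<dagger> = b * P n * b\<dagger>" for n
    using P(2)[of n] by (simp add: star_mult P(1)) (metis mult.assoc)
  have "(\<lambda>n. b * P n * b\<dagger>) \<longlonglongrightarrow> b * b\<dagger>" by (intro tendsto_mult lim tendsto_const)
  then have "(\<lambda>n. (b * P n) * (b * P n)\<dagger>) \<longlonglongrightarrow> b * b\<dagger>" unfolding bP .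
  then have "\<tau> (b * b\<dagger>) \<le> liminf (\<lambda>n. \<tau> ((b * P n) * (b * P n)\<dagger>))"
    by (intro lsc[unfolded lsc_trace_def, rule_format]) simp
  then have "\<tau> a \<le> liminf (\<lambda>n. \<tau> (P n * a * P n))"
    unfolding PaP unfolding b by (simp add: trace_star_commute)
  moreover have "limsup (\<lambda>n. \<tau> (P n * a * P n)) \<le> \<tau> a"
    by (rule Limsup_bounded) (simp add: trace_compress_le P a)
  ultimately show ?thesis
    using Liminf_le_Limsup[of sequentially "\<lambda>n. \<tau> (P n * a * P n)"]
    by (intro Liminf_eq_Limsup) (auto intro: order_antisym order_trans)
qed

end

section \<open>The structure of a graph algebra\<close>

lemma path_vertex_iff: "(u, []) \<in> paths E \<longleftrightarrow> u \<in> verts E"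
  by (auto simp: paths_def pre_digraph.awalk_def pre_digraph.cas.simps)

lemma path_Cons_iff:
  assumes "countable_digraph E"
  shows "(u, e # es) \<in> paths E \<longleftrightarrow> e \<in> arcs E \<and> u = tail E e \<and> (head E e, es) \<in> paths E"
  using assms
  by (auto simp: paths_def pre_digraph.awalk_def pre_digraph.cas.simps countable_digraph_def wf_digraph_def)

lemma path_range_vertex: "path_range E (u, []) = u"
  by (simp add: path_range_def)

lemma path_range_Cons: "path_range E (u, e # es) = path_range E (head E e, es)"
  by (simp add: path_range_def)

lemma path_range_snoc: "path_range E (u, es @ [e]) = head E e"
  by (simp add: path_range_def)

locale graph_cstar =
  fixes E :: "('v, 'e) pre_digraph"
    and p :: "'v \<Rightarrow> 'a::cstar_algebra"
    and S :: "'e \<Rightarrow> 'a"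
  assumes cd: "countable_digraph E" and rf: "row_finite E" and G: "graph_cstar_algebra E p S"
begin

abbreviation gauge :: "complex \<Rightarrow> 'a \<Rightarrow> 'a" (\<open>\<gamma>\<close>) where "\<gamma> \<equiv> gauge_action E p S"

abbreviation expectation :: "'a \<Rightarrow> 'a" (\<open>\<Phi>\<close>) where "\<Phi> \<equiv> gauge_expectation E p S"

abbreviation SP :: "'v \<times> 'e list \<Rightarrow> 'a" where "SP \<equiv> path_elem p S"

lemma CK: "CK_family E univ_cstar p S"
  using G by (simp add: graph_cstar_algebra_def)

lemmas arc_verts = tail_head_in_verts[OF cd rf]

lemmas finite_out = finite_out_arcs[OF cd rf]

lemma p_idem: "v \<in> verts E \<Longrightarrow> p v * p v = p v"
  and p_star: "v \<in> verts E \<Longrightarrow> (p v)\<dagger> = p v"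
  and p_orth: "v \<in> verts E \<Longrightarrow> w \<in> verts E \<Longrightarrow> v \<noteq> w \<Longrightarrow> p v * p w = 0"
  and S_partial_isometry: "e \<in> arcs E \<Longrightarrow> S e * (S e)\<dagger> * S e = S e"
  and S_star_S_same: "e \<in> arcs E \<Longrightarrow> (S e)\<dagger> * S e = p (head E e)"
  and p_sum: "v \<in> verts E \<Longrightarrow> out_arcs E v \<noteq> {} \<Longrightarrow> p v = (\<Sum>e\<in>out_arcs E v. S e * (S e)\<dagger>)"
  using CK by (simp_all add: CK_family_univ_iff)

lemma p_mult: "v \<in> verts E \<Longrightarrow> w \<in> verts E \<Longrightarrow> p v * p w = (if v = w then p v else 0)"
  by (simp add: p_idem p_orth)

text \<open>The elements \<open>b\<^sub>f = S\<^sub>f\<dagger> - S\<^sub>f\<dagger> p\<^sub>v\<close> satisfy \<open>\<Sum> b\<^sub>f\<dagger> b\<^sub>f = 0\<close>.\<close>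

lemma p_tail_S:
  assumes e: "e \<in> arcs E"
  shows "p (tail E e) * S e = S e"
proof -
  let ?v = "tail E e"
  let ?O = "out_arcs E ?v"
  have v: "?v \<in> verts E" using arc_verts e by simp
  have eO: "e \<in> ?O" using e by simp
  define q where "q f = S f * (S f)\<dagger>" for f
  define b where "b f = (S f)\<dagger> - (S f)\<dagger> * p ?v" for f
  have pq: "p ?v = (\<Sum>f\<in>?O. q f)" using p_sum[OF v] eO unfolding q_def by blast
  have bb: "(b f)\<dagger> * b f = q f - q f * p ?v - p ?v * q f + p ?v * q f * p ?v" for f
    by (simp add: b_def q_def star_diff star_mult star_star p_star[OF v] algebra_simps)
  have "(\<Sum>f\<in>?O. (b f)\<dagger> * b f) = p ?v - p ?v * p ?v - p ?v * p ?v + p ?v * p ?v * p ?v"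
    unfolding bb by (simp add: sum.distrib sum_subtractf sum_distrib_left[symmetric]
        sum_distrib_right[symmetric] pq[symmetric])
  then have "(\<Sum>f\<in>?O. (b f)\<dagger> * b f) = 0" by (simp add: p_idem[OF v])
  from sum_pos_cone_eq_0[OF finite_out[OF v] _ this eO] have "(b e)\<dagger> * b e = 0" by simp
  then have "b e = 0" by (simp only: star_mult_self_eq_0_iff)
  then have "(S e)\<dagger> = (S e)\<dagger> * p ?v" by (simp add: b_def)
  then have "((S e)\<dagger>)\<dagger> = ((S e)\<dagger> * p ?v)\<dagger>" by (rule arg_cong)
  then show ?thesis by (simp add: star_star star_mult p_star[OF v])
qed

lemma p_S: "v \<in> verts E \<Longrightarrow> e \<in> arcs E \<Longrightarrow> p v * S e = (if v = tail E e then S e else 0)"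
  using p_tail_S[of e] p_orth[of v "tail E e"] arc_verts[of e] by (metis mult.assoc mult_zero_left)

lemma S_p: "v \<in> verts E \<Longrightarrow> e \<in> arcs E \<Longrightarrow> S e * p v = (if v = head E e then S e else 0)"
proof -
  assume v: "v \<in> verts E" and e: "e \<in> arcs E"
  have *: "S e = S e * p (head E e)"
    using S_partial_isometry[OF e] S_star_S_same[OF e] by (simp add: mult.assoc)
  have "S e * p v = S e * (p (head E e) * p v)" by (subst *) (simp add: mult.assoc)
  then show ?thesis using p_mult[OF arc_verts(2)[OF e] v] * by simp
qed

text \<open>Different tails are separated by their vertex projections. For equal tails, the squares
  of all \<open>S\<^sub>g\<dagger> S\<^sub>e\<close> add up to
  \<open>S\<^sub>e\<dagger> p\<^sub>v S\<^sub>e\<close>, which is already the term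
  \<open>g = e\<close>; so the remaining positive terms vanish.\<close>

lemma S_star_S_orth:
  assumes e: "e \<in> arcs E" and f: "f \<in> arcs E" and ne: "e \<noteq> f"
  shows "(S f)\<dagger> * S e = 0"
proof (cases "tail E e = tail E f")
  case False
  have "(S f)\<dagger> * S e = (p (tail E f) * S f)\<dagger> * (p (tail E e) * S e)" by (simp add: p_tail_S e f)
  also have "\<dots> = (S f)\<dagger> * (p (tail E f) * p (tail E e)) * S e"
    by (simp add: star_mult p_star arc_verts f mult.assoc)
  finally show ?thesis using p_orth[of "tail E f" "tail E e"] arc_verts e f False by simp
next
  case True
  let ?v = "tail E e"
  let ?O = "out_arcs E ?v"
  have v: "?v \<in> verts E" using arc_verts e by simp
  have eO: "e \<in> ?O" "f \<in> ?O - {e}" using e f ne True by simp_all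
  have fin: "finite ?O" by (rule finite_out[OF v])
  have pv: "p ?v = (\<Sum>g\<in>?O. S g * (S g)\<dagger>)" by (rule p_sum[OF v]) (use eO in blast)
  have "(\<Sum>g\<in>?O. ((S g)\<dagger> * S e)\<dagger> * ((S g)\<dagger> * S e)) = (S e)\<dagger> * p ?v * S e"
    by (simp add: pv star_mult star_star sum_distrib_left sum_distrib_right mult.assoc)
  also have "\<dots> = (S e)\<dagger> * S e" by (simp add: mult.assoc p_tail_S[OF e])
  also have "\<dots> = ((S e)\<dagger> * S e)\<dagger> * ((S e)\<dagger> * S e)"
    using S_partial_isometry[OF e] by (simp add: star_mult star_star mult.assoc)
  finally have "(\<Sum>g\<in>?O - {e}. ((S g)\<dagger> * S e)\<dagger> * ((S g)\<dagger> * S e)) = 0"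
    by (simp add: sum.remove[OF fin eO(1)])
  from sum_pos_cone_eq_0[OF finite_Diff[OF fin] _ this eO(2)]
  have "((S f)\<dagger> * S e)\<dagger> * ((S f)\<dagger> * S e) = 0" by simp
  then show ?thesis by (simp only: star_mult_self_eq_0_iff)
qed

lemma foldl_mult: "foldl (\<lambda>x f. x * S f) (a * b) fs = a * foldl (\<lambda>x f. x * S f) b fs"
  by (induction fs arbitrary: b) (simp_all add: mult.assoc)

text \<open>Paths are multiplied up from the left, whereas induction peels off the first edge. A
  remaining path of length 0 contributes the projection at the head, which \<open>S e\<close>
  absorbs.\<close>

lemma SP_Cons:
  assumes "e \<in> arcs E"
  shows "SP (u, e # es) = S e * SP (head E e, es)"
  using S_p[OF arc_verts(2)[OF assms] assms] by (cases es) (simp_all add: foldl_mult)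

lemma SP_snoc:
  assumes "(u, es) \<in> paths E" "path_range E (u, es) = tail E e" "e \<in> arcs E"
  shows "SP (u, es @ [e]) = SP (u, es) * S e"
  using assms p_tail_S[of e] by (cases es) (simp_all add: path_range_vertex)

lemmas path_Cons = path_Cons_iff[OF cd]

lemma path_snoc:
  assumes "(u, es) \<in> paths E" "path_range E (u, es) = tail E e" "e \<in> arcs E"
  shows "(u, es @ [e]) \<in> paths E"
  using assms
  by (induction es arbitrary: u)
    (simp_all add: path_Cons path_vertex_iff path_range_vertex path_range_Cons arc_verts)

lemma path_verts: "(u, es) \<in> paths E \<Longrightarrow> u \<in> verts E" "(u, es) \<in> paths E \<Longrightarrow> path_range E (u, es) \<in> verts E"
proof -
  show "(u, es) \<in> paths E \<Longrightarrow> u \<in> verts E" by (cases es) (auto simp: path_Cons path_vertex_iff arc_verts)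
  show "(u, es) \<in> paths E \<Longrightarrow> path_range E (u, es) \<in> verts E"
    by (induction es arbitrary: u) (auto simp: path_Cons path_vertex_iff path_range_vertex path_range_Cons)
qed

lemma p_SP:
  assumes "v \<in> verts E" "(u, es) \<in> paths E"
  shows "p v * SP (u, es) = (if v = u then SP (u, es) else 0)"
proof (cases es)
  case Nil
  then show ?thesis using assms by (simp add: p_mult path_vertex_iff)
next
  case (Cons e fs)
  then have e: "e \<in> arcs E" "u = tail E e" using assms(2) by (simp_all add: path_Cons)
  show ?thesis using p_S[OF assms(1) e(1)] e(2) unfolding Cons SP_Cons[OF e(1)]
    by (simp add: mult.assoc[symmetric])
qed

lemma SP_range: "(u, es) \<in> paths E \<Longrightarrow> SP (u, es) * p (path_range E (u, es)) = SP (u, es)"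
  by (induction es arbitrary: u)
    (simp_all add: path_vertex_iff path_range_vertex p_idem path_Cons path_range_Cons SP_Cons mult.assoc
      del: path_elem.simps(2))

lemma SP_star_SP: "(u, es) \<in> paths E \<Longrightarrow> (SP (u, es))\<dagger> * SP (u, es) = p (path_range E (u, es))"
proof (induction es arbitrary: u)
  case (Cons e es)
  then have e: "e \<in> arcs E" and es: "(head E e, es) \<in> paths E" by (simp_all add: path_Cons)
  have "(SP (u, e # es))\<dagger> * SP (u, e # es) = (SP (head E e, es))\<dagger> * (((S e)\<dagger> * S e) * SP (head E e, es))"
    by (simp add: SP_Cons[OF e] star_mult mult.assoc del: path_elem.simps(2))
  also have "\<dots> = (SP (head E e, es))\<dagger> * SP (head E e, es)"
    by (simp add: S_star_S_same[OF e] p_SP arc_verts e es)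
  also have "\<dots> = p (path_range E (u, e # es))" by (simp only: Cons.IH[OF es] path_range_Cons)
  finally show ?case .
qed (simp add: path_vertex_iff path_range_vertex p_idem p_star)

text \<open>Equal first edges cancel to a vertex projection, which the next path absorbs; the first
  difference annihilates the product. Equal lengths exclude that one path extends the other.\<close>

lemma SP_star_SP_orth:
  "(u, es) \<in> paths E \<Longrightarrow> (w, fs) \<in> paths E \<Longrightarrow> length es = length fs \<Longrightarrow> (u, es) \<noteq> (w, fs) \<Longrightarrow>
    (SP (u, es))\<dagger> * SP (w, fs) = 0"
proof (induction es arbitrary: u w fs)
  case Nil
  then show ?case by (simp add: path_vertex_iff p_star p_orth)
next
  case (Cons e es)
  then obtain f fs' where fs: "fs = f # fs'" by (cases fs) auto
  have e: "e \<in> arcs E" "u = tail E e" "(head E e, es) \<in> paths E"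
    and f: "f \<in> arcs E" "w = tail E f" "(head E f, fs') \<in> paths E"
    using Cons.prems(1,2) by (simp_all add: path_Cons fs)
  have *: "(SP (u, e # es))\<dagger> * SP (w, f # fs') = (SP (head E e, es))\<dagger> * (((S e)\<dagger> * S f) * SP (head E f, fs'))"
    by (simp add: SP_Cons e f star_mult mult.assoc del: path_elem.simps(2))
  show ?case
  proof (cases "e = f")
    case False
    then show ?thesis unfolding fs * using S_star_S_orth[OF f(1) e(1)] by simp
  next
    case True
    have "(SP (head E e, es))\<dagger> * SP (head E e, fs') = 0"
      using Cons.prems e f True by (intro Cons.IH) (auto simp: fs)
    then show ?thesis unfolding fs * using True by (simp add: S_star_S_same f p_SP arc_verts)
  qed
qed

section \<open>Monomials and their stability under left multiplication by generators\<close>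

definition monomials :: "'a set" where
  "monomials = {SP \<mu> * (SP \<nu>)\<dagger> | \<mu> \<nu>. \<mu> \<in> paths E \<and> \<nu> \<in> paths E \<and> path_range E \<mu> = path_range E \<nu>}"

lemma monomialsI:
  "(u, es) \<in> paths E \<Longrightarrow> (w, fs) \<in> paths E \<Longrightarrow> path_range E (u, es) = path_range E (w, fs) \<Longrightarrow>
    SP (u, es) * (SP (w, fs))\<dagger> \<in> monomials"
  unfolding monomials_def by blast

lemma monomialsE:
  assumes "m \<in> monomials"
  obtains u es w fs where "m = SP (u, es) * (SP (w, fs))\<dagger>" "(u, es) \<in> paths E" "(w, fs) \<in> paths E"
    "path_range E (u, es) = path_range E (w, fs)"
  using assms unfolding monomials_def by auto

lemma p_monomial: "v \<in> verts E \<Longrightarrow> m \<in> monomials \<Longrightarrow> p v * m \<in> insert 0 monomials"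
  by (elim monomialsE) (auto simp: mult.assoc[symmetric] p_SP intro: monomialsI)

lemma S_monomial:
  assumes e: "e \<in> arcs E" and m: "m \<in> monomials"
  shows "S e * m \<in> insert 0 monomials"
  using m
proof (rule monomialsE)
  fix u es w fs
  assume m: "m = SP (u, es) * (SP (w, fs))\<dagger>" and paths: "(u, es) \<in> paths E" "(w, fs) \<in> paths E"
    and range: "path_range E (u, es) = path_range E (w, fs)"
  have uv: "u \<in> verts E" using paths path_verts by blast
  have Sm: "S e * m = S e * p u * SP (u, es) * (SP (w, fs))\<dagger>"
    using p_SP[OF uv paths(1)] by (simp add: m mult.assoc)
  show ?thesis
  proof (cases "u = head E e")
    case True
    have "S e * m = SP (tail E e, e # es) * (SP (w, fs))\<dagger>"
      unfolding m SP_Cons[OF e] True by (simp add: mult.assoc)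
    moreover have "(tail E e, e # es) \<in> paths E" using e paths True by (simp add: path_Cons)
    ultimately show ?thesis using paths range True
        by (auto intro!: monomialsI simp: path_range_Cons simp del: path_elem.simps)
  next
    case False
    then show ?thesis using S_p[OF uv e] Sm by simp
  qed
qed

text \<open>A nonempty left path loses its first edge or the product dies. If the left path is a
  vertex there is nothing to cancel, and the adjoint edge migrates into the right path, extending it
  by \<open>e\<close>.\<close>

lemma S_star_monomial:
  assumes e: "e \<in> arcs E" and m: "m \<in> monomials"
  shows "(S e)\<dagger> * m \<in> insert 0 monomials"
  using m
proof (rule monomialsE)
  fix u es w fs
  assume m: "m = SP (u, es) * (SP (w, fs))\<dagger>" and paths: "(u, es) \<in> paths E" "(w, fs) \<in> paths E"
    and range: "path_range E (u, es) = path_range E (w, fs)"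
  have uv: "u \<in> verts E" using paths path_verts by blast
  show ?thesis
  proof (cases es)
    case Nil
    have Sp: "(S e)\<dagger> * p u = (p u * S e)\<dagger>" by (simp add: star_mult p_star uv)
    have wu: "path_range E (w, fs) = u" using range Nil by (simp add: path_range_vertex)
    show ?thesis
    proof (cases "u = tail E e")
      case True
      have wp: "(w, fs @ [e]) \<in> paths E" using path_snoc paths(2) wu True e by simp
      have "(S e)\<dagger> * m = (S e)\<dagger> * p u * (SP (w, fs))\<dagger>" by (simp add: m Nil mult.assoc)
      also have "\<dots> = (S e)\<dagger> * (SP (w, fs))\<dagger>" unfolding Sp using p_tail_S[OF e] True by simp
      also have "\<dots> = (SP (w, fs @ [e]))\<dagger>"
        using SP_snoc[OF paths(2) _ e] wu True by (simp add: star_mult)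
      \<comment> \<open>The range projection is inserted to serve as a left path of length
        0.\<close>
      also have "\<dots> = (SP (w, fs @ [e]) * p (head E e))\<dagger>"
        using SP_range[OF wp] by (simp only: path_range_snoc)
      also have "\<dots> = SP (head E e, []) * (SP (w, fs @ [e]))\<dagger>"
        by (simp add: star_mult p_star arc_verts e)
      also have "\<dots> \<in> monomials"
        by (rule monomialsI) (simp_all add: wp path_vertex_iff arc_verts e path_range_vertex path_range_snoc)
      finally show ?thesis by simp
    next
      case False
      then have "(S e)\<dagger> * p u = 0" unfolding Sp using p_S[OF uv e] by simp
      then show ?thesis by (simp add: m Nil mult.assoc[symmetric])
    qed
  next
    case (Cons f fs')
    then have f: "f \<in> arcs E" "(head E f, fs') \<in> paths E" using paths(1) by (simp_all add: path_Cons)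
    have Sm: "(S e)\<dagger> * m = ((S e)\<dagger> * S f) * SP (head E f, fs') * (SP (w, fs))\<dagger>"
      by (simp add: m Cons SP_Cons[OF f(1)] mult.assoc del: path_elem.simps)
    show ?thesis
    proof (cases "e = f")
      case True
      then have "(S e)\<dagger> * m = SP (head E f, fs') * (SP (w, fs))\<dagger>"
        unfolding Sm using S_star_S_same[OF f(1)] p_SP[OF arc_verts(2)[OF f(1)] f(2)] by simp
      then show ?thesis using f paths range Cons
        by (auto intro!: monomialsI simp: path_range_Cons simp del: path_elem.simps)
    next
      case False
      then show ?thesis unfolding Sm using S_star_S_orth[OF f(1) e] by simp
    qed
  qed
qed

section \<open>An approximate unit of finite sums of vertex projections\<close>

definition vertex_set :: "nat \<Rightarrow> 'v set" where
  "vertex_set n = {v \<in> verts E. to_nat_on (verts E) v < n}"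

definition vproj :: "nat \<Rightarrow> 'a" where
  "vproj n = (\<Sum>v\<in>vertex_set n. p v)"

lemma finite_vertex_set: "finite (vertex_set n)"
proof (rule inj_on_finite[of "to_nat_on (verts E)" _ "{..<n}"])
  have "inj_on (to_nat_on (verts E)) (verts E)"
    using cd by (auto simp: countable_digraph_def intro: inj_on_to_nat_on)
  then show "inj_on (to_nat_on (verts E)) (vertex_set n)"
    by (rule inj_on_subset) (auto simp: vertex_set_def)
qed (auto simp: vertex_set_def)

lemma vproj_mult_eq:
  assumes "u \<in> verts E" "\<And>v. v \<in> verts E \<Longrightarrow> p v * x = (if v = u then x else 0)"
  shows "vproj n * x = (if u \<in> vertex_set n then x else 0)"
proof -
  have "vproj n * x = (\<Sum>v\<in>vertex_set n. if v = u then x else 0)"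
    unfolding vproj_def sum_distrib_right
    by (rule sum.cong) (auto simp: assms(2) vertex_set_def)
  then show ?thesis by (simp add: sum.delta[OF finite_vertex_set])
qed

lemma vproj_p: "v \<in> verts E \<Longrightarrow> vproj n * p v = (if v \<in> vertex_set n then p v else 0)"
  by (rule vproj_mult_eq) (auto simp: p_mult)

lemma vproj_S: "e \<in> arcs E \<Longrightarrow> vproj n * S e = (if tail E e \<in> vertex_set n then S e else 0)"
  by (rule vproj_mult_eq) (auto simp: p_S arc_verts)

lemma vproj_SP:
  "(u, es) \<in> paths E \<Longrightarrow> vproj n * SP (u, es) = (if u \<in> vertex_set n then SP (u, es) else 0)"
  by (rule vproj_mult_eq) (auto simp: p_SP path_verts)

lemma vproj_star: "(vproj n)\<dagger> = vproj n"
  unfolding vproj_def star_sum by (rule sum.cong) (auto simp: p_star vertex_set_def)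

lemma vproj_idem: "vproj n * vproj n = vproj n"
proof -
  have "vproj n * vproj n = (\<Sum>v\<in>vertex_set n. vproj n * p v)"
    by (subst (2) vproj_def) (simp add: sum_distrib_left)
  also have "\<dots> = vproj n"
    by (subst (2) vproj_def, rule sum.cong) (auto simp: vproj_p vertex_set_def)
  finally show ?thesis .
qed

lemma norm_vproj_le: "norm (vproj n) \<le> 1"
proof -
  have "norm (vproj n) * norm (vproj n) = norm (vproj n)"
    using cstar_identity[of "vproj n"] by (simp add: vproj_star vproj_idem power2_eq_square)
  then show ?thesis by auto
qed

lemma gen: "cstar_generated (p ` verts E \<union> S ` arcs E) = UNIV"
  using G by (simp add: graph_cstar_algebra_def)

lemma eventually_in_vertex_set: "v \<in> verts E \<Longrightarrow> \<forall>\<^sub>F n in sequentially. v \<in> vertex_set n"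
  unfolding vertex_set_def eventually_sequentially
  by (intro exI[of _ "Suc (to_nat_on (verts E) v)"]) auto

text \<open>Each generator and its adjoint is eventually fixed by \<open>vproj n\<close>. The
  induction carries \<open>x\<close> and \<open>x\<dagger>\<close> together, since the adjoint of a
  product starts with the adjoint of its last factor.\<close>

lemma vproj_tendsto:
  "(\<lambda>n. x * vproj n) \<longlonglongrightarrow> x \<and> (\<lambda>n. vproj n * x) \<longlonglongrightarrow> x"
proof -
  let ?L = "\<lambda>x. (\<lambda>n. vproj n * x) \<longlonglongrightarrow> x"
  have star: "(\<lambda>n. x * vproj n) \<longlonglongrightarrow> x \<longleftrightarrow> ?L (x\<dagger>)" for x
  proof
    assume "(\<lambda>n. x * vproj n) \<longlonglongrightarrow> x"
    then have "(\<lambda>n. (x * vproj n)\<dagger>) \<longlonglongrightarrow> x\<dagger>" by (rule bounded_linear.tendsto[OF bounded_linear_star])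
    then show "?L (x\<dagger>)" by (simp add: star_mult vproj_star)
  next
    assume "?L (x\<dagger>)"
    then have "(\<lambda>n. (vproj n * x\<dagger>)\<dagger>) \<longlonglongrightarrow> (x\<dagger>)\<dagger>"
      by (rule bounded_linear.tendsto[OF bounded_linear_star])
    then show "(\<lambda>n. x * vproj n) \<longlonglongrightarrow> x" by (simp add: star_mult vproj_star star_star)
  qed
  \<comment> \<open>The uniform bound \<open>norm (vproj n) \<le> 1\<close> passes the property to
    limits, with \<open>e / 3\<close> for each of three error terms.\<close>
  have L_lim: "?L l" if f: "\<And>n. ?L (f n)" "f \<longlonglongrightarrow> l" for f l
    unfolding LIMSEQ_iff
  proof (intro allI impI)
    fix e :: real assume "e > 0"
    then obtain m where m: "norm (f m - l) < e / 3"
      using f(2) unfolding LIMSEQ_iff by (metis divide_pos_pos order_refl zero_less_numeral)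
    obtain N where N: "\<And>n. n \<ge> N \<Longrightarrow> norm (vproj n * f m - f m) < e / 3"
      using f(1)[of m] \<open>e > 0\<close> unfolding LIMSEQ_iff by (metis divide_pos_pos zero_less_numeral)
    have "norm (vproj n * l - l) < e" if "n \<ge> N" for n
    proof -
      have "vproj n * l - l = - (vproj n * (f m - l)) + (vproj n * f m - f m) + (f m - l)"
        by (simp add: algebra_simps)
      then have "norm (vproj n * l - l) \<le>
          norm (vproj n * (f m - l)) + norm (vproj n * f m - f m) + norm (f m - l)"
        by (metis norm_minus_cancel norm_triangle_ineq norm_triangle_mono order_refl)
      moreover have "norm (vproj n * (f m - l)) \<le> 1 * norm (f m - l)"
        by (rule order_trans[OF norm_mult_ineq]) (intro mult_right_mono norm_vproj_le norm_ge_zero)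
      ultimately show ?thesis using m N[OF that] by simp
    qed
    then show "\<exists>N. \<forall>n\<ge>N. norm (vproj n * l - l) < e" by blast
  qed
  have "?L x \<and> ?L (x\<dagger>)"
  proof (rule cstar_generated_induct[OF gen, of "\<lambda>x. ?L x \<and> ?L (x\<dagger>)"])
    fix x assume "x \<in> p ` verts E \<union> S ` arcs E"
    then show "?L x \<and> ?L (x\<dagger>)"
    proof
      assume "x \<in> p ` verts E"
      then obtain v where v: "v \<in> verts E" "x = p v" by blast
      have "\<forall>\<^sub>F n in sequentially. vproj n * x = x"
        using eventually_in_vertex_set[OF v(1)] by eventually_elim (simp add: v vproj_p)
      then show ?thesis by (simp add: v p_star tendsto_eventually)
    next
      assume "x \<in> S ` arcs E"
      then obtain e where e: "e \<in> arcs E" "x = S e" by blast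
      have "\<forall>\<^sub>F n in sequentially. vproj n * S e = S e"
        using eventually_in_vertex_set[OF arc_verts(1)[OF e(1)]]
        by eventually_elim (simp add: e vproj_S)
      moreover have "\<forall>\<^sub>F n in sequentially. vproj n * (S e)\<dagger> = (S e)\<dagger>"
        using eventually_in_vertex_set[OF arc_verts(2)[OF e(1)]]
      proof eventually_elim
        case (elim n)
        have "S e * p (head E e) = S e" using S_p e arc_verts by simp
        then have "p (head E e) * (S e)\<dagger> = (S e)\<dagger>"
          using star_mult[of "S e" "p (head E e)"] by (simp add: p_star arc_verts e)
        then show ?case
          using vproj_p[OF arc_verts(2)[OF e(1)], of n] elim by (metis mult.assoc)
      qed
      ultimately show ?thesis by (simp add: e tendsto_eventually)
    qed
  next
    fix x y assume "?L x \<and> ?L (x\<dagger>)" "?L y \<and> ?L (y\<dagger>)"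
    then show "?L (x + y) \<and> ?L ((x + y)\<dagger>)" by (simp add: star_add distrib_left tendsto_add)
  next
    fix x y assume xy: "?L x \<and> ?L (x\<dagger>)" "?L y \<and> ?L (y\<dagger>)"
    then have "(\<lambda>n. (vproj n * x) * y) \<longlonglongrightarrow> x * y" "(\<lambda>n. (vproj n * y\<dagger>) * x\<dagger>) \<longlonglongrightarrow> y\<dagger> * x\<dagger>"
      by (intro tendsto_mult tendsto_const; simp)+
    then show "?L (x * y) \<and> ?L ((x * y)\<dagger>)" by (simp add: star_mult mult.assoc)
  next
    fix c x assume "?L x \<and> ?L (x\<dagger>)"
    then show "?L (c *\<^sub>C x) \<and> ?L ((c *\<^sub>C x)\<dagger>)"
      by (auto simp: star_scaleC mult_scaleC_right intro: bounded_linear.tendsto[OF bounded_linear_scaleC])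
  next
    fix f l assume "\<And>n. ?L (f n) \<and> ?L ((f n)\<dagger>)" "f \<longlonglongrightarrow> l"
    then show "?L l \<and> ?L (l\<dagger>)"
      using L_lim[of f l] L_lim[of "\<lambda>n. (f n)\<dagger>" "l\<dagger>"] bounded_linear.tendsto[OF bounded_linear_star, of f l]
      by blast
  qed (simp_all add: star_star)
  then show ?thesis using star by simp
qed

text \<open>The closed span \<open>D\<close> of the monomials is stable under left multiplication by
  generators and their adjoints, hence a left ideal. It contains every \<open>vproj n\<close>, so
  \<open>x * vproj n\<close> lies in \<open>D\<close> and tends to \<open>x\<close>.\<close>

lemma monomial_span_dense:
  assumes C: "module.subspace scaleC C" "closed C" "monomials \<subseteq> C"
  shows "x \<in> C"
proof -
  define D where "D = \<Inter>{C. module.subspace scaleC C \<and> closed C \<and> monomials \<subseteq> C}"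
  have D_min: "D \<subseteq> C" if "module.subspace scaleC C" "closed C" "monomials \<subseteq> C" for C
    using that unfolding D_def by blast
  have D0: "0 \<in> D" and Dadd: "\<And>x y. x \<in> D \<Longrightarrow> y \<in> D \<Longrightarrow> x + y \<in> D"
    and Dsc: "\<And>c x. x \<in> D \<Longrightarrow> c *\<^sub>C x \<in> D"
    unfolding D_def by (auto simp: scaleC_subspace_iff)
  have Dcl: "closed D" unfolding D_def by (rule closed_Inter) auto
  have DM: "monomials \<subseteq> D" unfolding D_def by blast
  have left: "g * y \<in> D" if g: "\<And>m. m \<in> monomials \<Longrightarrow> g * m \<in> insert 0 monomials" and y: "y \<in> D" for g y
  proof -
    have "D \<subseteq> {y. g * y \<in> D}"
    proof (rule D_min)
      show "module.subspace scaleC {y. g * y \<in> D}"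
        by (auto simp: scaleC_subspace_iff D0 distrib_left Dadd mult_scaleC_right Dsc)
      show "closed {y. g * y \<in> D}"
        using continuous_closed_vimage[OF Dcl, of "\<lambda>y. g * y"] by (simp add: vimage_def)
      show "monomials \<subseteq> {y. g * y \<in> D}"
      proof
        fix m assume "m \<in> monomials"
        from g[OF this] show "m \<in> {y. g * y \<in> D}" using D0 DM by auto
      qed
    qed
    then show ?thesis using y by blast
  qed
  have Dlim: "l \<in> D" if "\<And>n. f n \<in> D" "f \<longlonglongrightarrow> l" for f l
    using Dcl that closed_sequentially by blast
  have ideal: "\<forall>y\<in>D. x * y \<in> D \<and> x\<dagger> * y \<in> D" for x
  proof (rule cstar_generated_induct[OF gen, of "\<lambda>x. \<forall>y\<in>D. x * y \<in> D \<and> x\<dagger> * y \<in> D"])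
    fix x assume "x \<in> p ` verts E \<union> S ` arcs E"
    then show "\<forall>y\<in>D. x * y \<in> D \<and> x\<dagger> * y \<in> D"
      using left[OF p_monomial] left[OF S_monomial] left[OF S_star_monomial] by (auto simp: p_star)
  next
    fix f l assume f: "\<And>n. \<forall>y\<in>D. f n * y \<in> D \<and> (f n)\<dagger> * y \<in> D" and lim: "f \<longlonglongrightarrow> l"
    show "\<forall>y\<in>D. l * y \<in> D \<and> l\<dagger> * y \<in> D"
    proof
      fix y assume y: "y \<in> D"
      have "(\<lambda>n. f n * y) \<longlonglongrightarrow> l * y" "(\<lambda>n. (f n)\<dagger> * y) \<longlonglongrightarrow> l\<dagger> * y"
        by (intro tendsto_mult lim tendsto_const bounded_linear.tendsto[OF bounded_linear_star])+
      then show "l * y \<in> D \<and> l\<dagger> * y \<in> D"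
        using Dlim[of "\<lambda>n. f n * y" "l * y"] Dlim[of "\<lambda>n. (f n)\<dagger> * y" "l\<dagger> * y"] f y by simp
    qed
  qed (auto simp: D0 distrib_right star_add Dadd mult_scaleC_left star_scaleC Dsc star_mult mult.assoc
      star_star)
  have "vproj n \<in> D" for n
  proof -
    have "p v \<in> D" if "v \<in> verts E" for v
    proof -
      have "SP (v, []) * (SP (v, []))\<dagger> \<in> monomials"
        using that by (intro monomialsI) (simp_all add: path_vertex_iff)
      then show ?thesis using DM that by (auto simp: p_star p_idem)
    qed
    then have "(\<Sum>v\<in>V. p v) \<in> D" if "V \<subseteq> verts E" for V
      using that by (induction V rule: infinite_finite_induct) (auto simp: D0 Dadd)
    then show ?thesis unfolding vproj_def by (auto simp: vertex_set_def)
  qed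
  then have "x * vproj n \<in> D" for n using ideal by blast
  then have "x \<in> D" by (rule Dlim) (rule vproj_tendsto[THEN conjunct1])
  then show ?thesis using D_min[OF C] by blast
qed

section \<open>Traces on a graph algebra\<close>

lemma gauge_path:
  assumes z: "cmod z = 1"
  shows "(u, es) \<in> paths E \<Longrightarrow> \<gamma> z (SP (u, es)) = z ^ length es *\<^sub>C SP (u, es)"
proof (induction es arbitrary: u)
  case Nil
  then show ?case using gauge_action(3)[OF G z] by (simp add: path_vertex_iff scaleC_one)
next
  case (Cons e es)
  then have e: "e \<in> arcs E" "(head E e, es) \<in> paths E" by (simp_all add: path_Cons)
  show ?case
    unfolding SP_Cons[OF e(1)] star_hom_univD[OF gauge_action(1)[OF G z]] Cons.IH[OF e(2)]
      gauge_action(2)[OF G z e(1)]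
    by (simp add: mult_scaleC_left mult_scaleC_right scaleC_scaleC mult.commute)
qed

lemma gauge_vproj:
  assumes z: "cmod z = 1"
  shows "\<gamma> z (vproj n) = vproj n"
proof -
  have lin: "linear (\<gamma> z)"
    by (rule bounded_linear.linear[OF bounded_linear_star_hom[OF gauge_action(1)[OF G z]]])
  show ?thesis
    unfolding vproj_def linear_sum[OF lin]
    by (rule sum.cong) (auto simp: vertex_set_def gauge_action(3)[OF G z])
qed

lemma exists_rotation:
  assumes "m \<noteq> n"
  obtains z where "cmod z = 1" "z ^ m * cnj (z ^ n) = - 1"
proof -
  have "\<exists>z. cmod z = 1 \<and> z ^ m * cnj (z ^ n) = - 1" if "m > n" for m n :: nat
  proof (intro exI conjI)
    \<comment> \<open>The product is \<open>z\<close> to the power \<open>m - n\<close>, so half a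
      turn is divided into \<open>m - n\<close> equal parts. The opposite order of the exponents is
      settled by conjugation.\<close>
    let ?z = "cis (pi / real (m - n))"
    have "?z ^ m * cnj (?z ^ n) = cis (real m * (pi / real (m - n)) + - (real n * (pi / real (m - n))))"
      by (simp only: Complex.DeMoivre cis_cnj cis_mult complex_cnj_power)
    also have "real m * (pi / real (m - n)) + - (real n * (pi / real (m - n))) =
        (real m - real n) * (pi / real (m - n))"
      by (simp only: left_diff_distrib add_uminus_conv_diff)
    also have "\<dots> = pi" using that by (simp add: of_nat_diff)
    finally show "?z ^ m * cnj (?z ^ n) = - 1" by simp
  qed simp
  from this[of n m] this[of m n] consider
      z where "cmod z = 1" "z ^ m * cnj (z ^ n) = - 1" | z where "cmod z = 1" "z ^ n * cnj (z ^ m) = - 1"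
    using assms by (meson nat_neq_iff)
  then show thesis
  proof cases
    case 2
    have "cnj (z ^ n * cnj (z ^ m)) = - 1" by (simp only: 2(2)) simp
    then show thesis using 2(1) by (intro that[of z]) (simp_all add: mult.commute)
  qed (rule that)
qed

end

locale graph_trace = graph_cstar E p S + trace \<tau>
  for E :: "('v, 'e) pre_digraph" and p :: "'v \<Rightarrow> 'a::cstar_algebra" and S :: "'e \<Rightarrow> 'a"
    and \<tau> :: "'a \<Rightarrow> ennreal" +
  assumes semifinite: "semifinite_trace \<tau>"
begin

lemma finite_cone_p: "v \<in> verts E \<Longrightarrow> p v \<in> finite_cone \<tau>"
  by (rule finite_trace_projection[OF semifinite]) (simp_all add: p_star p_idem)

lemma finite_cone_vproj: "vproj n \<in> finite_cone \<tau>"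
  by (rule finite_trace_projection[OF semifinite vproj_star vproj_idem])

lemma finite_cone_SP:
  assumes "(u, es) \<in> paths E"
  shows "SP (u, es) * (SP (u, es))\<dagger> \<in> finite_cone \<tau>"
    "\<tau> (SP (u, es) * (SP (u, es))\<dagger>) = \<tau> (p (path_range E (u, es)))"
proof -
  show eq: "\<tau> (SP (u, es) * (SP (u, es))\<dagger>) = \<tau> (p (path_range E (u, es)))"
    using trace_star_commute[of "SP (u, es)"] SP_star_SP[OF assms] by simp
  show "SP (u, es) * (SP (u, es))\<dagger> \<in> finite_cone \<tau>"
    using finite_cone_p[OF path_verts(2)[OF assms]] eq by (simp add: finite_cone_def)
qed

lemma trace_head_le_tail:
  assumes e: "e \<in> arcs E"
  shows "\<tau> (p (tail E e)) = (\<Sum>f\<in>out_arcs E (tail E e). \<tau> (S f * (S f)\<dagger>))"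
    "\<tau> (S e * (S e)\<dagger>) = \<tau> (p (head E e))" "\<tau> (p (head E e)) \<le> \<tau> (p (tail E e))"
proof -
  have v: "tail E e \<in> verts E" using arc_verts e by simp
  have ne: "e \<in> out_arcs E (tail E e)" using e by simp
  then have "p (tail E e) = (\<Sum>f\<in>out_arcs E (tail E e). S f * (S f)\<dagger>)" by (intro p_sum[OF v]) blast
  then show sum: "\<tau> (p (tail E e)) = (\<Sum>f\<in>out_arcs E (tail E e). \<tau> (S f * (S f)\<dagger>))"
    by (simp add: trace_sum finite_out[OF v])
  show eq: "\<tau> (S e * (S e)\<dagger>) = \<tau> (p (head E e))"
    using trace_star_commute[of "S e"] S_star_S_same[OF e] by simp
  show "\<tau> (p (head E e)) \<le> \<tau> (p (tail E e))"
    unfolding sum eq[symmetric] using ne by (intro member_le_sum) (simp_all add: finite_out[OF v])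
qed

lemma trace_range_le_source: "(u, es) \<in> paths E \<Longrightarrow> \<tau> (p (path_range E (u, es))) \<le> \<tau> (p u)"
proof (induction es arbitrary: u)
  case (Cons e es)
  then have e: "e \<in> arcs E" "u = tail E e" "(head E e, es) \<in> paths E" by (simp_all add: path_Cons)
  show ?case using Cons.IH[OF e(3)] trace_head_le_tail(3)[OF e(1)] e(2) by (simp add: path_range_Cons)
qed (simp add: path_range_vertex)

lemma path_append_split:
  "(u, xs @ e # ys) \<in> paths E \<Longrightarrow> (u, xs) \<in> paths E \<and> path_range E (u, xs) = tail E e \<and>
    e \<in> arcs E \<and> (head E e, ys) \<in> paths E \<and> path_range E (u, xs @ e # ys) = path_range E (head E e, ys)"
  by (induction xs arbitrary: u)
    (auto simp: path_Cons path_vertex_iff path_range_vertex path_range_Cons arc_verts)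

lemma no_loop_exit:
  assumes faithful: "faithful_trace \<tau>" and L: "L \<in> loops E"
  shows "\<not> has_exit E L"
proof
  assume "has_exit E L"
  then obtain e f g where e: "e \<in> set (snd L)" and fg: "f \<in> out_arcs E (tail E e)"
    "g \<in> out_arcs E (tail E e)" "f \<noteq> g" by (auto simp: has_exit_def)
  obtain h where h: "h \<in> out_arcs E (tail E e)" "h \<noteq> e" using fg by (cases "f = e") auto
  obtain u xs ys where Lu: "L = (u, xs @ e # ys)" using e by (cases L) (auto simp: in_set_conv_decomp)
  have uL: "(u, xs @ e # ys) \<in> paths E" "path_range E (u, xs @ e # ys) = u"
    using L by (auto simp: loops_def Lu path_source_def)
  note split = path_append_split[OF uL(1)]
  have ea: "e \<in> arcs E" using split by blast
  \<comment> \<open>The loop is cut at \<open>e\<close>: \<open>xs\<close> leads from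
    \<open>u\<close> to the tail of \<open>e\<close>, \<open>ys\<close> from its head back to
    \<open>u\<close>, and the trace does not increase along either piece.\<close>
  have "\<tau> (p (tail E e)) \<le> \<tau> (p u)" using trace_range_le_source[of u xs] split by metis
  also have "\<dots> \<le> \<tau> (p (head E e))" using trace_range_le_source[of "head E e" ys] split uL(2) by metis
  finally have le: "\<tau> (p (tail E e)) \<le> \<tau> (p (head E e))" .
  have v: "tail E e \<in> verts E" using arc_verts ea by simp
  have "\<tau> (S e * (S e)\<dagger>) + \<tau> (S h * (S h)\<dagger>) = (\<Sum>f\<in>{e, h}. \<tau> (S f * (S f)\<dagger>))" using h(2) by simp
  also have "\<dots> \<le> \<tau> (p (tail E e))"
    unfolding trace_head_le_tail(1)[OF ea] using h ea by (intro sum_mono2 finite_out[OF v]) auto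
  also note le
  finally have "\<tau> (p (head E e)) + \<tau> (S h * (S h)\<dagger>) \<le> \<tau> (p (head E e)) + 0"
    unfolding trace_head_le_tail(2)[OF ea] by simp
  \<comment> \<open>Finiteness is what permits cancelling this value in the extended reals.\<close>
  moreover have "\<tau> (p (head E e)) < \<infinity>"
    by (intro finite_cone_trace_less_top finite_cone_p arc_verts ea)
  ultimately have "\<tau> (S h * (S h)\<dagger>) = 0"
    by (auto simp: ennreal_add_left_cancel_le)
  then have "S h = 0" using faithful trace_star_commute[of "S h"] by (simp add: faithful_trace_def)
  then show False using graph_cstar_generator_neq_0[OF cd rf G, of h] h(1) by simp
qed

end

locale gauge_trace = graph_trace E p S \<tau>
  for E :: "('v, 'e) pre_digraph" and p :: "'v \<Rightarrow> 'a::cstar_algebra" and S :: "'e \<Rightarrow> 'a"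
    and \<tau> :: "'a \<Rightarrow> ennreal" +
  assumes lsc: "lsc_trace \<tau>" and gauge_invariant: "gauge_invariant_trace E p S \<tau>"
begin

abbreviation corner_trace :: "nat \<Rightarrow> 'a \<Rightarrow> complex" where
  "corner_trace n x \<equiv> trace_ext \<tau> (vproj n * x * vproj n)"

lemmas corner = vproj_star vproj_idem finite_cone_vproj

lemma linear_corner_trace: "linear (corner_trace n)"
  by (rule bounded_linear.linear[OF bounded_linear_trace_corner[OF corner]])

lemma continuous_corner_trace: "continuous_on A (corner_trace n)"
  by (rule linear_continuous_on[OF bounded_linear_trace_corner[OF corner]])

lemma has_trace_gauge:
  assumes z: "cmod z = 1" and x: "has_trace \<tau> x t"
  shows "has_trace \<tau> (\<gamma> z x) t"
proof -
  let ?g = "\<gamma> z"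
  note hom = gauge_action(1)[OF G z]
  have fin: "?g a \<in> finite_cone \<tau>" "\<tau> (?g a) = \<tau> a" if "a \<in> finite_cone \<tau>" for a
    using that gauge_invariant z star_hom_pos_cone[OF hom, of a]
    by (simp_all add: finite_cone_def gauge_invariant_trace_def)
  have diff: "?g (x - y) = ?g x - ?g y" for x y
    by (rule linear_diff[OF bounded_linear.linear[OF bounded_linear_star_hom[OF hom]]])
  obtain a b c d where x: "a \<in> finite_cone \<tau>" "b \<in> finite_cone \<tau>" "c \<in> finite_cone \<tau>" "d \<in> finite_cone \<tau>"
    "x = a - b + \<i> *\<^sub>C (c - d)"
    "t = Complex (enn2real (\<tau> a) - enn2real (\<tau> b)) (enn2real (\<tau> c) - enn2real (\<tau> d))"
    using x by (rule has_traceE)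
  show ?thesis
    by (rule has_traceI[of "?g a" _ "?g b" "?g c" "?g d"])
      (use x(1-4) in \<open>simp_all add: x(5,6) fin star_hom_univD[OF hom] diff\<close>)
qed

lemma corner_trace_gauge:
  assumes z: "cmod z = 1"
  shows "corner_trace n (\<gamma> z x) = corner_trace n x"
  using has_trace_gauge[OF z has_trace_corner_ext[OF corner, of n x]]
  by (intro has_trace_trace_ext) (simp add: star_hom_univD[OF gauge_action(1)[OF G z]] gauge_vproj z)

text \<open>The level set through \<open>x\<close> is closed because the functional is bounded,
  convex because it is linear, and contains the gauge orbit of \<open>x\<close>; so it contains the
  mean over the orbit.\<close>

lemma corner_trace_expectation: "corner_trace n (\<Phi> x) = corner_trace n x"
proof -
  have "\<Phi> x \<in> {y. corner_trace n y = corner_trace n x}"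
  proof (rule gauge_expectation_in[OF G])
    show "closed {y. corner_trace n y = corner_trace n x}"
      by (intro closed_Collect_eq continuous_corner_trace continuous_on_const)
    show "convex {y. corner_trace n y = corner_trace n x}"
    proof (rule convexI)
      fix y z :: 'a and u v :: real
      assume yz: "y \<in> {y. corner_trace n y = corner_trace n x}" "z \<in> {y. corner_trace n y = corner_trace n x}"
        and uv: "u + v = 1"
      have "corner_trace n (u *\<^sub>R y + v *\<^sub>R z) = u *\<^sub>R corner_trace n y + v *\<^sub>R corner_trace n z"
        by (simp only: linear_add[OF linear_corner_trace] linear_scale[OF linear_corner_trace])
      also have "\<dots> = (u + v) *\<^sub>R corner_trace n x" using yz by (simp add: scaleR_add_left)
      finally show "u *\<^sub>R y + v *\<^sub>R z \<in> {y. corner_trace n y = corner_trace n x}" by (simp add: uv)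
    qed
  qed (simp add: corner_trace_gauge)
  then show ?thesis by simp
qed

text \<open>Recovers the possibly infinite values of the trace from bounded functionals; identities
  between the latter thereby pass to the trace.\<close>

lemma corner_tendsto:
  assumes a: "a \<in> pos_cone"
  shows "(\<lambda>n. ennreal (Re (corner_trace n a))) \<longlonglongrightarrow> \<tau> a"
proof -
  have "(\<lambda>n. \<tau> (vproj n * a * vproj n)) \<longlonglongrightarrow> \<tau> a"
    by (rule trace_compress_tendsto[OF lsc vproj_star vproj_idem _ a]) (use vproj_tendsto in blast)
  moreover have "\<tau> (vproj n * a * vproj n) = ennreal (Re (corner_trace n a))" for n
    using ennreal_trace[OF trace_corner_pos_cone(1)[OF corner a, of n]]
    unfolding trace_corner_pos_cone(2)[OF corner a] by simp
  ultimately show ?thesis by simp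
qed

lemma trace_expectation: "a \<in> pos_cone \<Longrightarrow> \<tau> (\<Phi> a) = \<tau> a"
  using corner_tendsto[of a] corner_tendsto[OF gauge_expectation_pos_cone[OF G, of a]]
  by (intro LIMSEQ_unique[of _ "\<tau> (\<Phi> a)"]) (simp_all add: corner_trace_expectation)

lemma has_trace_monomial:
  assumes \<mu>: "(u, es) \<in> paths E" and \<nu>: "(w, fs) \<in> paths E"
    and range: "path_range E (u, es) = path_range E (w, fs)"
  shows "has_trace \<tau> (SP (u, es) * (SP (w, fs))\<dagger>)
    (if (u, es) = (w, fs) then trace_ext \<tau> (p (path_range E (u, es))) else 0)"
proof -
  \<comment> \<open>Both orders of the product receive the same value \<open>t\<close>. For equal
    lengths the reversed product is a vertex projection or 0, which determines
    \<open>t\<close>.\<close>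
  obtain t where t: "has_trace \<tau> (SP (u, es) * (SP (w, fs))\<dagger>) t" "has_trace \<tau> ((SP (w, fs))\<dagger> * SP (u, es)) t"
    using has_trace_mult_commute[OF finite_cone_SP(1)[OF \<mu>] finite_cone_SP(1)[OF \<nu>]] by blast
  consider "(u, es) = (w, fs)" | "length es = length fs" "(u, es) \<noteq> (w, fs)" | "length es \<noteq> length fs" by blast
  then show ?thesis
  proof cases
    case 1
    then have "has_trace \<tau> (p (path_range E (u, es))) t" using t(2) SP_star_SP[OF \<mu>] by simp
    then show ?thesis using t(1) 1 has_trace_trace_ext by simp
  next
    case 2
    then have "has_trace \<tau> 0 t" using t(2) SP_star_SP_orth[OF \<nu> \<mu>] by metis
    then have "t = 0" using has_trace_unique[OF _ has_trace_zero] by blast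
    then show ?thesis unfolding if_not_P[OF 2(2)] using t(1) by simp
  next
    case 3
    obtain z where z: "cmod z = 1" "z ^ length es * cnj (z ^ length fs) = - 1"
      using exists_rotation[OF 3] by blast
    have "\<gamma> z (SP (u, es) * (SP (w, fs))\<dagger>) =
        (z ^ length es * cnj (z ^ length fs)) *\<^sub>C (SP (u, es) * (SP (w, fs))\<dagger>)"
      by (simp add: star_hom_univD[OF gauge_action(1)[OF G z(1)]] gauge_path[OF z(1)] \<mu> \<nu> star_scaleC
          mult_scaleC_left mult_scaleC_right scaleC_scaleC mult.commute)
    then have "has_trace \<tau> ((- 1) *\<^sub>C (SP (u, es) * (SP (w, fs))\<dagger>)) t"
      using has_trace_gauge[OF z(1) t(1)] unfolding z(2) by simp
    then have "t = (- 1) * t" using has_trace_unique[OF has_trace_scaleC[OF t(1), of "- 1"]] by metis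
    then have "t = 0" by simp
    then show ?thesis using t(1) 3 by auto
  qed
qed

lemma trace_monomial:
  assumes "\<mu> \<in> paths E" "\<nu> \<in> paths E" "path_range E \<mu> = path_range E \<nu>"
  shows "SP \<mu> * (SP \<nu>)\<dagger> \<in> trace_domain \<tau>"
    "trace_ext \<tau> (SP \<mu> * (SP \<nu>)\<dagger>) = (if \<mu> = \<nu> then trace_ext \<tau> (p (path_range E \<mu>)) else 0)"
proof -
  obtain u es w fs where \<mu>\<nu>: "\<mu> = (u, es)" "\<nu> = (w, fs)" by fastforce
  have "has_trace \<tau> (SP \<mu> * (SP \<nu>)\<dagger>) (if \<mu> = \<nu> then trace_ext \<tau> (p (path_range E \<mu>)) else 0)"
    using assms unfolding \<mu>\<nu> by (rule has_trace_monomial)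
  then show "SP \<mu> * (SP \<nu>)\<dagger> \<in> trace_domain \<tau>"
    "trace_ext \<tau> (SP \<mu> * (SP \<nu>)\<dagger>) = (if \<mu> = \<nu> then trace_ext \<tau> (p (path_range E \<mu>)) else 0)"
    by (rule has_trace_domain, rule has_trace_trace_ext)
qed

lemma corner_trace_monomial:
  assumes "\<mu> \<in> paths E" "\<nu> \<in> paths E" "path_range E \<mu> = path_range E \<nu>"
  shows "corner_trace n (SP \<mu> * (SP \<nu>)\<dagger>) =
    (if \<mu> = \<nu> \<and> fst \<mu> \<in> vertex_set n then trace_ext \<tau> (p (path_range E \<mu>)) else 0)"
proof -
  have P: "vproj n * SP \<kappa> = (if fst \<kappa> \<in> vertex_set n then SP \<kappa> else 0)" if "\<kappa> \<in> paths E" for \<kappa>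
    using vproj_SP[of "fst \<kappa>" "snd \<kappa>" n] that by simp
  have "vproj n * (SP \<mu> * (SP \<nu>)\<dagger>) * vproj n = (vproj n * SP \<mu>) * (vproj n * SP \<nu>)\<dagger>"
    by (simp add: star_mult vproj_star mult.assoc)
  then show ?thesis
    using trace_monomial(2)[OF assms] has_trace_trace_ext[OF has_trace_zero] by (auto simp: P assms)
qed

text \<open>The extended trace is not assumed continuous on its domain, so the closed span is
  handled through the corner functionals, which vanish on it. Splitting \<open>x\<close> into
  positive parts of finite trace then recovers its value as a limit of zeros.\<close>

lemma trace_off_diagonal_eq_0:
  assumes x: "x \<in> trace_domain \<tau>" "x \<in> off_diagonal E p S"
  shows "trace_ext \<tau> x = 0"
proof -
  have corner_0: "corner_trace n x = 0" for n
  proof -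
    have "off_diagonal E p S \<subseteq> {y. corner_trace n y = 0}"
      unfolding off_diagonal_def
    proof (rule closure_minimal)
      interpret vs: vector_space "scaleC :: complex \<Rightarrow> 'a \<Rightarrow> 'a" by (rule vector_space_scaleC)
      show "closed {y. corner_trace n y = 0}"
        by (intro closed_Collect_eq continuous_corner_trace continuous_on_const)
      show "vs.span {SP \<mu> * (SP \<nu>)\<dagger> | \<mu> \<nu>. \<mu> \<in> paths E \<and> \<nu> \<in> paths E \<and>
          path_range E \<mu> = path_range E \<nu> \<and> \<mu> \<noteq> \<nu>} \<subseteq> {y. corner_trace n y = 0}"
      proof (rule vs.span_minimal)
        show "vs.subspace {y. corner_trace n y = 0}"
          using linear_0[OF linear_corner_trace, of n]
          by (auto simp: scaleC_subspace_iff trace_corner_add[OF corner] trace_corner_scaleC[OF corner])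
      qed (auto simp: corner_trace_monomial)
    qed
    then show ?thesis using x(2) by blast
  qed
  obtain a b c d where abcd: "a \<in> finite_cone \<tau>" "b \<in> finite_cone \<tau>" "c \<in> finite_cone \<tau>" "d \<in> finite_cone \<tau>"
    "x = a - b + \<i> *\<^sub>C (c - d)"
    "trace_ext \<tau> x = Complex (enn2real (\<tau> a) - enn2real (\<tau> b)) (enn2real (\<tau> c) - enn2real (\<tau> d))"
    using x(1) unfolding trace_domain_iff by (rule has_traceE)
  \<comment> \<open>A finite limit allows passing from extended reals to complex numbers.\<close>
  have lim: "(\<lambda>n. corner_trace n y) \<longlonglongrightarrow> of_real (enn2real (\<tau> y))" if y: "y \<in> finite_cone \<tau>" for y
  proof -
    have yp: "y \<in> pos_cone" "\<tau> y < \<infinity>" using y by (simp_all add: finite_cone_def)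
    have "(\<lambda>n. enn2real (ennreal (Re (corner_trace n y)))) \<longlonglongrightarrow> enn2real (\<tau> y)"
      using yp(2) corner_tendsto[OF yp(1)] by (intro tendsto_enn2real) auto
    then show ?thesis
      unfolding trace_corner_pos_cone(2)[OF corner yp(1)] by (intro tendsto_of_real) simp
  qed
  have "(\<lambda>n. corner_trace n a - corner_trace n b + \<i> * (corner_trace n c - corner_trace n d)) \<longlonglongrightarrow>
      of_real (enn2real (\<tau> a)) - of_real (enn2real (\<tau> b)) + \<i> * (of_real (enn2real (\<tau> c)) - of_real (enn2real (\<tau> d)))"
    by (intro tendsto_intros lim abcd)
  moreover have "corner_trace n a - corner_trace n b + \<i> * (corner_trace n c - corner_trace n d) = corner_trace n x"
    for n
    unfolding abcd(5) trace_corner_add[OF corner] trace_corner_scaleC[OF corner]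
      linear_diff[OF linear_corner_trace] ..
  ultimately have "(\<lambda>n. 0 :: complex) \<longlonglongrightarrow>
      of_real (enn2real (\<tau> a)) - of_real (enn2real (\<tau> b)) + \<i> * (of_real (enn2real (\<tau> c)) - of_real (enn2real (\<tau> d)))"
    unfolding corner_0 by simp
  from LIMSEQ_unique[OF this tendsto_const]
  have "of_real (enn2real (\<tau> a)) - of_real (enn2real (\<tau> b)) +
      \<i> * (of_real (enn2real (\<tau> c)) - of_real (enn2real (\<tau> d))) = (0 :: complex)" .
  then show ?thesis unfolding abcd(6) by (simp add: complex_eq_iff)
qed

end

text \<open>On monomials the corner functionals involve only the values at vertices. They agree
  everywhere by density and continuity, and the traces are their limits on positive
  elements.\<close>

lemma gauge_trace_determined:
  assumes \<tau>: "gauge_trace E p S \<tau>" and \<sigma>: "gauge_trace E p S \<sigma>"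
    and eq: "\<And>v. v \<in> verts E \<Longrightarrow> \<sigma> (p v) = \<tau> (p v)" and a: "a \<in> pos_cone"
  shows "\<sigma> a = \<tau> a"
proof -
  interpret t: gauge_trace E p S \<tau> by (rule \<tau>)
  interpret s: gauge_trace E p S \<sigma> by (rule \<sigma>)
  have ext: "trace_ext \<sigma> (p v) = trace_ext \<tau> (p v)" if "v \<in> verts E" for v
    using t.has_trace_trace_ext[OF t.has_trace_finite_cone[OF t.finite_cone_p[OF that]]]
      s.has_trace_trace_ext[OF s.has_trace_finite_cone[OF s.finite_cone_p[OF that]]] eq[OF that] by simp
  have corner_eq: "s.corner_trace n x = t.corner_trace n x" for n x
  proof -
    have "x \<in> {x. s.corner_trace n x = t.corner_trace n x}"
    proof (rule t.monomial_span_dense)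
      show "module.subspace scaleC {x. s.corner_trace n x = t.corner_trace n x}"
        using linear_0[OF s.linear_corner_trace, of n] linear_0[OF t.linear_corner_trace, of n]
        by (auto simp: scaleC_subspace_iff s.trace_corner_add[OF s.corner] s.trace_corner_scaleC[OF s.corner]
            t.trace_corner_add[OF t.corner] t.trace_corner_scaleC[OF t.corner])
      show "closed {x. s.corner_trace n x = t.corner_trace n x}"
        by (intro closed_Collect_eq s.continuous_corner_trace t.continuous_corner_trace)
      show "t.monomials \<subseteq> {x. s.corner_trace n x = t.corner_trace n x}"
      proof
        fix m assume "m \<in> t.monomials"
        then obtain \<mu> \<nu> where m: "m = path_elem p S \<mu> * (path_elem p S \<nu>)\<dagger>" "\<mu> \<in> paths E" "\<nu> \<in> paths E"
          "path_range E \<mu> = path_range E \<nu>" unfolding t.monomials_def by blast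
        have "path_range E \<mu> \<in> verts E" using t.path_verts(2)[of "fst \<mu>" "snd \<mu>"] m(2) by simp
        then show "m \<in> {x. s.corner_trace n x = t.corner_trace n x}"
          unfolding m(1) mem_Collect_eq s.corner_trace_monomial[OF m(2-4)]
            t.corner_trace_monomial[OF m(2-4)] by (simp only: ext)
      qed
    qed
    then show ?thesis by simp
  qed
  show ?thesis
    using s.corner_tendsto[OF a] t.corner_tendsto[OF a] unfolding corner_eq by (rule LIMSEQ_unique)
qed

lemma (in gauge_trace) supported_on_diagonal: "supported_on_diagonal E p S \<tau>"
  unfolding supported_on_diagonal_def
proof (intro conjI ballI allI impI)
  show "trace_ext \<tau> x = 0" if "x \<in> trace_domain \<tau> \<inter> off_diagonal E p S" for x
    using that trace_off_diagonal_eq_0 by blast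
  fix \<sigma> :: "'a \<Rightarrow> ennreal" and a :: 'a
  assume \<sigma>: "is_trace \<sigma> \<and> semifinite_trace \<sigma> \<and> lsc_trace \<sigma> \<and> gauge_invariant_trace E p S \<sigma> \<and>
    (\<forall>d\<in>diagonal E p S \<inter> pos_cone. \<sigma> d = \<tau> d)" and a: "a \<in> pos_cone"
  have gt: "gauge_trace E p S \<sigma>" by unfold_locales (use \<sigma> in simp_all)
  have "\<sigma> (p v) = \<tau> (p v)" if v: "v \<in> verts E" for v
  proof -
    \<comment> \<open>Vertices are paths of length 0, so their projections belong to the diagonal,
      and agreement there already fixes the trace.\<close>
    have pv: "p v = SP (v, []) * (SP (v, []))\<dagger>" using v by (simp add: p_star p_idem)
    have "p v \<in> {SP \<mu> * (SP \<mu>)\<dagger> | \<mu>. \<mu> \<in> paths E}"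
      using pv v by (intro CollectI exI[of _ "(v, [])"]) (simp add: path_vertex_iff)
    then have "p v \<in> diagonal E p S" unfolding diagonal_def cstar_generated_def by auto
    moreover have "p v \<in> pos_cone" unfolding pv by simp
    ultimately show ?thesis using \<sigma> by blast
  qed
  then show "\<sigma> a = \<tau> a" using gauge_trace_determined[OF gauge_trace_axioms gt _ a] by blast
qed

theorem lemma3p3:
  fixes E :: "('v, 'e) pre_digraph"
    and p :: "'v \<Rightarrow> 'a::cstar_algebra"
    and S :: "'e \<Rightarrow> 'a"
  assumes "countable_digraph E" and "row_finite E" and "graph_cstar_algebra E p S"
  shows
    "((\<exists>\<tau> :: 'a \<Rightarrow> ennreal. is_trace \<tau> \<and> faithful_trace \<tau> \<and> semifinite_trace \<tau>) \<longrightarrow>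
        (\<forall>L \<in> loops E. \<not> has_exit E L))
     \<and>
     (\<forall>\<tau> :: 'a \<Rightarrow> ennreal.
        is_trace \<tau> \<and> gauge_invariant_trace E p S \<tau> \<and> semifinite_trace \<tau> \<and> lsc_trace \<tau> \<longrightarrow>
        (\<forall>a \<in> pos_cone. gauge_expectation E p S a \<in> pos_cone \<and>
           \<tau> (gauge_expectation E p S a) = \<tau> a) \<and>
        (\<forall>\<mu> \<in> paths E. \<forall>\<nu> \<in> paths E. path_range E \<mu> = path_range E \<nu> \<longrightarrow>
           path_elem p S \<mu> * (path_elem p S \<nu>)\<dagger> \<in> trace_domain \<tau> \<and>
           trace_ext \<tau> (path_elem p S \<mu> * (path_elem p S \<nu>)\<dagger>) =
             (if \<mu> = \<nu> then trace_ext \<tau> (p (path_range E \<mu>)) else 0)) \<and>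
        supported_on_diagonal E p S \<tau>)"
proof (intro conjI impI allI)
  assume "\<exists>\<tau> :: 'a \<Rightarrow> ennreal. is_trace \<tau> \<and> faithful_trace \<tau> \<and> semifinite_trace \<tau>"
  then obtain \<tau> :: "'a \<Rightarrow> ennreal" where \<tau>: "is_trace \<tau>" "faithful_trace \<tau>" "semifinite_trace \<tau>" by blast
  interpret graph_trace E p S \<tau> by unfold_locales (intro assms \<tau>)+
  show "\<forall>L \<in> loops E. \<not> has_exit E L" using no_loop_exit[OF \<tau>(2)] by blast
next
  fix \<tau> :: "'a \<Rightarrow> ennreal"
  assume "is_trace \<tau> \<and> gauge_invariant_trace E p S \<tau> \<and> semifinite_trace \<tau> \<and> lsc_trace \<tau>"
  then have \<tau>: "is_trace \<tau>" "gauge_invariant_trace E p S \<tau>" "semifinite_trace \<tau>" "lsc_trace \<tau>" by auto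
  interpret gauge_trace E p S \<tau> by unfold_locales (intro assms \<tau>)+
  show "\<forall>a \<in> pos_cone. gauge_expectation E p S a \<in> pos_cone \<and> \<tau> (gauge_expectation E p S a) = \<tau> a"
    using gauge_expectation_pos_cone[OF G] trace_expectation by blast
  show "\<forall>\<mu> \<in> paths E. \<forall>\<nu> \<in> paths E. path_range E \<mu> = path_range E \<nu> \<longrightarrow>
      path_elem p S \<mu> * (path_elem p S \<nu>)\<dagger> \<in> trace_domain \<tau> \<and>
      trace_ext \<tau> (path_elem p S \<mu> * (path_elem p S \<nu>)\<dagger>) =
        (if \<mu> = \<nu> then trace_ext \<tau> (p (path_range E \<mu>)) else 0)"
    using trace_monomial by blast
  show "supported_on_diagonal E p S \<tau>" by (rule supported_on_diagonal)
qed

end
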